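(* A countable discrete group is strongly amenable if and only if it has no nontrivial quotient group with the infinite conjugacy class property. In particular, a finitely generated (discrete) group is strongly amenable if and only if it is virtually nilpotent.
   Context: Let $G$ be a countable discrete group acting continuously on a nonempty compact Hausdorff space $X$. The action is proximal if for all $x,y\in X$ there exists a net $\{g_i\}$ in $G$ such that $\lim_i g_i x=\lim_i g_i y$. The group $G$ is strongly amenable if every proximal continuous action of $G$ on a nonempty compact Hausdorff space has a fixed point (a point $x$ with $gx=x$ for all $g\in G$). A group has the infinite conjugacy class property (is ICC) if each of its non-identity elements has an infinite conjugacy class. *)

theory Defs
  imports "HOL-Analysis.Abstract_Limits" "HOL-Analysis.T1_Spaces"
    "HOL-Algebra.Elementary_Groups" "HOL-Algebra.Generated_Groups" "HOL-Algebra.Group_Action"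
begin

text \<open>The acting group is discrete, so continuity of the action means continuity of
  each \<open>\<alpha> g\<close>.\<close>

definition continuous_action ::
  "('a, 'b) monoid_scheme \<Rightarrow> 'x topology \<Rightarrow> ('a \<Rightarrow> 'x \<Rightarrow> 'x) \<Rightarrow> bool"
  where "continuous_action G E \<alpha> \<longleftrightarrow>
    group_action G (topspace E) \<alpha> \<and> (\<forall>g\<in>carrier G. continuous_map E E (\<alpha> g))"

text \<open>Nets in \<open>G\<close> are rendered as proper filters \<open>F\<close> on \<open>G\<close>: a net gives the filter generated by
  its tails, and a filter \<open>F\<close> gives the net \<open>(A, g) \<mapsto> g\<close> indexed by the pairs \<open>g \<in> A\<close> with \<open>A\<close>
  a member of \<open>F\<close> contained in \<open>G\<close>, directed by reverse inclusion of \<open>A\<close>. Both constructions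
  preserve limits along the net.\<close>

definition proximal_action ::
  "('a, 'b) monoid_scheme \<Rightarrow> 'x topology \<Rightarrow> ('a \<Rightarrow> 'x \<Rightarrow> 'x) \<Rightarrow> bool"
  where "proximal_action G E \<alpha> \<longleftrightarrow>
    (\<forall>x\<in>topspace E. \<forall>y\<in>topspace E. \<exists>F z. F \<noteq> bot \<and> (\<forall>\<^sub>F g in F. g \<in> carrier G) \<and>
       limitin E (\<lambda>g. \<alpha> g x) z F \<and> limitin E (\<lambda>g. \<alpha> g y) z F)"

definition strongly_amenable_on :: "'x itself \<Rightarrow> ('a, 'b) monoid_scheme \<Rightarrow> bool"
  where "strongly_amenable_on _ G \<longleftrightarrow>
    (\<forall>(E :: 'x topology) \<alpha>.
       compact_space E \<and> Hausdorff_space E \<and> topspace E \<noteq> {} \<and>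
       continuous_action G E \<alpha> \<and> proximal_action G E \<alpha> \<longrightarrow>
       (\<exists>x\<in>topspace E. \<forall>g\<in>carrier G. \<alpha> g x = x))"

text \<open>HOL cannot quantify over all types inside a definition. The type \<open>'a set set\<close> is large
  enough to contain a copy of every orbit closure in a Hausdorff space, so that the following
  definition covers the actions on compact Hausdorff spaces carried by any type whatsoever; this
  is the lemma \<open>strongly_amenable_imp_on\<close> below.\<close>

definition strongly_amenable :: "('a, 'b) monoid_scheme \<Rightarrow> bool"
  where "strongly_amenable G \<longleftrightarrow> strongly_amenable_on TYPE('a set set) G"

lemma strongly_amenable_on_transport:
  fixes G :: "('a, 'b) monoid_scheme" and E :: "'x topology" and h :: "'x \<Rightarrow> 'w"
  assumes sa: "strongly_amenable_on TYPE('w) G"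
    and E: "compact_space E" "Hausdorff_space E"
    and act: "continuous_action G E \<alpha>" and prox: "proximal_action G E \<alpha>"
    and Y: "closedin E Y" "Y \<noteq> {}"
    and inv: "\<And>g y. g \<in> carrier G \<Longrightarrow> y \<in> Y \<Longrightarrow> \<alpha> g y \<in> Y"
    and h: "inj_on h Y"
  shows "\<exists>x\<in>Y. \<forall>g\<in>carrier G. \<alpha> g x = x"
proof -
  define k where "k = inv_into Y h"
  have kh [simp]: "k (h y) = y" if "y \<in> Y" for y
    using that h by (simp add: k_def)
  have YE: "Y \<subseteq> topspace E"
    using Y(1) by (rule closedin_subset)
  define S where "S = subtopology E Y"
  have tS [simp]: "topspace S = Y"
    using YE by (auto simp: S_def)
  define Z where "Z = pullback_topology (h ` Y) k S"
  have tZ [simp]: "topspace Z = h ` Y"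
    by (auto simp: Z_def topspace_pullback_topology)
  have ck: "continuous_map Z S k"
    using continuous_map_pullback[of S S id "h ` Y" k] by (simp add: Z_def)
  have "continuous_map S S (k \<circ> h)"
    by (rule continuous_map_eq[of _ _ id]) auto
  then have ch: "continuous_map S Z h"
    unfolding Z_def by (rule continuous_map_pullback') auto
  have hom: "homeomorphic_maps S Z h k"
    by (auto simp: homeomorphic_maps_def ch ck)
  then have homs: "S homeomorphic_space Z"
    by (auto simp: homeomorphic_space_def)
  have Zc: "compact_space Z"
    using homs E Y(1) homeomorphic_compact_space closedin_compact_space compact_space_subtopology
    unfolding S_def by blast
  have Zh: "Hausdorff_space Z"
    using homs E(2) homeomorphic_Hausdorff_space Hausdorff_space_subtopology
    unfolding S_def by blast
  interpret act: group_action G "topspace E" \<alpha>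
    using act by (simp add: continuous_action_def)
  interpret gh: group_hom G "BijGroup (topspace E)" \<alpha>
    by (rule act.group_hom)
  have grp: "group G"
    by (rule group_hom.axioms(1)[OF act.group_hom])
  have comp: "\<alpha> (g1 \<otimes>\<^bsub>G\<^esub> g2) y = \<alpha> g1 (\<alpha> g2 y)"
    if "g1 \<in> carrier G" "g2 \<in> carrier G" "y \<in> Y" for g1 g2 y
    using that YE by (intro act.composition_rule) auto
  have one: "\<alpha> \<one>\<^bsub>G\<^esub> y = y" if "y \<in> Y" for y
    using that YE by (metis act.id_eq_one restrict_apply' subsetD)
  define \<beta> where "\<beta> g = (\<lambda>w\<in>h ` Y. h (\<alpha> g (k w)))" for g
  have \<beta>_h: "\<beta> g (h y) = h (\<alpha> g y)" if "y \<in> Y" for g y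
    using that by (simp add: \<beta>_def)
  have \<beta>_in: "\<beta> g w \<in> h ` Y" if "g \<in> carrier G" "w \<in> h ` Y" for g w
    using that inv by (auto simp: \<beta>_h)
  have \<beta>_comp: "\<beta> (g1 \<otimes>\<^bsub>G\<^esub> g2) w = \<beta> g1 (\<beta> g2 w)"
    if "g1 \<in> carrier G" "g2 \<in> carrier G" "w \<in> h ` Y" for g1 g2 w
    using that inv by (auto simp: \<beta>_h comp simp del: gh.hom_mult)
  have \<beta>_one: "\<beta> \<one>\<^bsub>G\<^esub> w = w" if "w \<in> h ` Y" for w
    using that by (auto simp: \<beta>_h one simp del: gh.hom_one)
  have \<beta>_Bij: "\<beta> g \<in> Bij (h ` Y)" if g: "g \<in> carrier G" for g
  proof -
    have "bij_betw (\<beta> g) (h ` Y) (h ` Y)"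
      by (rule bij_betw_byWitness[where f' = "\<beta> (inv\<^bsub>G\<^esub> g)"])
        (use g \<beta>_in in \<open>auto simp: \<beta>_comp[symmetric] \<beta>_one\<close>)
    then show ?thesis
      by (auto simp: Bij_def \<beta>_def)
  qed
  have "group_hom G (BijGroup (h ` Y)) \<beta>"
  proof (intro group_hom.intro group_hom_axioms.intro homI)
    fix g1 g2 assume g: "g1 \<in> carrier G" "g2 \<in> carrier G"
    show "\<beta> (g1 \<otimes>\<^bsub>G\<^esub> g2) = \<beta> g1 \<otimes>\<^bsub>BijGroup (h ` Y)\<^esub> \<beta> g2"
    proof
      fix w
      show "\<beta> (g1 \<otimes>\<^bsub>G\<^esub> g2) w = (\<beta> g1 \<otimes>\<^bsub>BijGroup (h ` Y)\<^esub> \<beta> g2) w"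
        using g \<beta>_Bij \<beta>_comp
        by (cases "w \<in> h ` Y") (auto simp: BijGroup_def compose_def, simp add: \<beta>_def)
    qed
  qed (use \<beta>_Bij group_BijGroup in \<open>auto simp: BijGroup_def intro: grp\<close>)
  then have "group_action G (topspace Z) \<beta>"
    by (simp add: group_action_def)
  moreover have "continuous_map Z Z (\<beta> g)" if g: "g \<in> carrier G" for g
  proof -
    have "continuous_map S E (\<alpha> g)"
      using act g unfolding S_def continuous_action_def
      by (blast intro: continuous_map_from_subtopology)
    then have "continuous_map S S (\<alpha> g)"
      using inv g tS by (auto simp: S_def continuous_map_in_subtopology simp del: tS)
    then have "continuous_map Z Z (h \<circ> (\<alpha> g \<circ> k))"
      using ch ck by (blast intro: continuous_map_compose)
    then show ?thesis
      by (rule continuous_map_eq) (simp add: \<beta>_def)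
  qed
  ultimately have Za: "continuous_action G Z \<beta>"
    by (simp add: continuous_action_def)
  have "\<exists>F z. F \<noteq> bot \<and> (\<forall>\<^sub>F g in F. g \<in> carrier G) \<and>
       limitin Z (\<lambda>g. \<beta> g (h x)) z F \<and> limitin Z (\<lambda>g. \<beta> g (h y)) z F"
    if xy: "x \<in> Y" "y \<in> Y" for x y
  proof -
    obtain F z where F: "F \<noteq> bot" "\<forall>\<^sub>F g in F. g \<in> carrier G"
      and lim: "limitin E (\<lambda>g. \<alpha> g x) z F" "limitin E (\<lambda>g. \<alpha> g y) z F"
      using prox xy YE unfolding proximal_action_def by blast
    have ev: "\<forall>\<^sub>F g in F. \<alpha> g w \<in> Y" if "w \<in> Y" for w
      using F(2) by (rule eventually_mono) (use inv that in auto)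
    have "z \<in> Y"
    proof (rule ccontr)
      assume "z \<notin> Y"
      then have "\<forall>\<^sub>F g in F. \<alpha> g x \<in> topspace E - Y"
        using lim(1) Y(1) by (intro limitinD[OF lim(1)]) (auto dest: limitin_topspace)
      with ev[OF xy(1)] have "\<forall>\<^sub>F g in F. False"
        by eventually_elim auto
      with F(1) show False by simp
    qed
    then have lims: "limitin S (\<lambda>g. \<alpha> g x) z F" "limitin S (\<lambda>g. \<alpha> g y) z F"
      using lim ev xy by (auto simp: S_def limitin_subtopology)
    have "limitin Z (\<lambda>g. \<beta> g (h w)) (h z) F" if "w \<in> Y" "limitin S (\<lambda>g. \<alpha> g w) z F" for w
      using continuous_map_limit[OF ch that(2)] by (simp add: \<beta>_h that(1) comp_def)
    with F lims xy show ?thesis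
      by blast
  qed
  then have Zp: "proximal_action G Z \<beta>"
    by (auto simp: proximal_action_def)
  obtain w where w: "w \<in> h ` Y" "\<forall>g\<in>carrier G. \<beta> g w = w"
    using sa Zc Zh Za Zp Y(2) unfolding strongly_amenable_on_def
    by (metis tZ image_is_empty)
  then obtain y where y: "y \<in> Y" "w = h y"
    by blast
  with w(2) have "\<forall>g\<in>carrier G. h (\<alpha> g y) = h y"
    by (simp add: \<beta>_h)
  with y(1) inv h have "\<forall>g\<in>carrier G. \<alpha> g y = y"
    by (meson inj_onD)
  with y(1) show ?thesis
    by blast
qed

lemma strongly_amenable_imp_on:
  fixes G :: "('a, 'b) monoid_scheme"
  assumes sa: "strongly_amenable G"
  shows "strongly_amenable_on TYPE('x) G"
  unfolding strongly_amenable_on_def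
proof (intro allI impI, elim conjE)
  fix E :: "'x topology" and \<alpha>
  assume E: "compact_space E" "Hausdorff_space E" "topspace E \<noteq> {}"
    and act: "continuous_action G E \<alpha>" and prox: "proximal_action G E \<alpha>"
  interpret act: group_action G "topspace E" \<alpha>
    using act by (simp add: continuous_action_def)
  interpret gh: group_hom G "BijGroup (topspace E)" \<alpha>
    by (rule act.group_hom)
  obtain p where p: "p \<in> topspace E"
    using E(3) by blast
  define D where "D = (\<lambda>g. \<alpha> g p) ` carrier G"
  define Y where "Y = E closure_of D"
  have inE: "\<alpha> g x \<in> topspace E" if "g \<in> carrier G" "x \<in> topspace E" for g x
    using that by (rule act.element_image[OF _ _ refl])
  have DE: "D \<subseteq> topspace E"
    using inE p by (auto simp: D_def)
  have "D \<noteq> {}"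
    by (auto simp: D_def)
  then have Y: "closedin E Y" "Y \<noteq> {}"
    using DE by (auto simp: Y_def closure_of_eq_empty)
  have inv: "\<alpha> g y \<in> Y" if g: "g \<in> carrier G" and y: "y \<in> Y" for g y
  proof -
    have "\<alpha> g ` D \<subseteq> D"
    proof (clarsimp simp: D_def)
      fix g' assume "g' \<in> carrier G"
      then show "\<alpha> g (\<alpha> g' p) \<in> (\<lambda>g. \<alpha> g p) ` carrier G"
        using g p by (intro image_eqI[where x = "g \<otimes>\<^bsub>G\<^esub> g'"]) (auto simp: act.composition_rule simp del: gh.hom_mult)
    qed
    then have "\<alpha> g ` Y \<subseteq> Y"
      using continuous_map_image_closure_subset[of E E "\<alpha> g" D] act g closure_of_mono
      unfolding Y_def continuous_action_def by blast
    with y show ?thesis by blast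
  qed
  define h where "h y = {{g \<in> carrier G. \<alpha> g p \<in> U} | U. openin E U \<and> y \<in> U}" for y
  have "inj_on h Y"
  proof (rule inj_onI, rule ccontr)
    fix y y' assume y: "y \<in> Y" "y' \<in> Y" "h y = h y'" "y \<noteq> y'"
    then have "y \<in> topspace E" "y' \<in> topspace E"
      using closedin_subset[OF Y(1)] by auto
    then obtain U U' where U: "openin E U" "openin E U'" "y \<in> U" "y' \<in> U'" "disjnt U U'"
      using E(2) y(4) unfolding Hausdorff_space_def by metis
    then have "{g \<in> carrier G. \<alpha> g p \<in> U} \<in> h y'"
      using y(3) by (auto simp: h_def)
    then obtain V where V: "openin E V" "y' \<in> V"
      and eq: "{g \<in> carrier G. \<alpha> g p \<in> U} = {g \<in> carrier G. \<alpha> g p \<in> V}"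
      by (auto simp: h_def)
    have "openin E (V \<inter> U')" "y' \<in> V \<inter> U'"
      using U V by auto
    then obtain d where "d \<in> D" "d \<in> V \<inter> U'"
      using y(2) unfolding Y_def in_closure_of by blast
    then obtain g where "g \<in> carrier G" "\<alpha> g p \<in> V" "\<alpha> g p \<in> U'"
      by (auto simp: D_def)
    with eq U(5) show False
      by (auto simp: disjnt_iff)
  qed
  then obtain x where "x \<in> Y" "\<forall>g\<in>carrier G. \<alpha> g x = x"
    using strongly_amenable_on_transport[OF _ E(1,2) act prox Y inv] sa
    unfolding strongly_amenable_def by metis
  then show "\<exists>x\<in>topspace E. \<forall>g\<in>carrier G. \<alpha> g x = x"
    using closedin_subset[OF Y(1)] by blast
qed

definition conjugacy_class :: "('a, 'b) monoid_scheme \<Rightarrow> 'a \<Rightarrow> 'a set"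
  where "conjugacy_class G x = {g \<otimes>\<^bsub>G\<^esub> x \<otimes>\<^bsub>G\<^esub> inv\<^bsub>G\<^esub> g | g. g \<in> carrier G}"

definition icc :: "('a, 'b) monoid_scheme \<Rightarrow> bool"
  where "icc G \<longleftrightarrow> (\<forall>x\<in>carrier G. x \<noteq> \<one>\<^bsub>G\<^esub> \<longrightarrow> infinite (conjugacy_class G x))"

definition finitely_generated_group :: "('a, 'b) monoid_scheme \<Rightarrow> bool"
  where "finitely_generated_group G \<longleftrightarrow>
    group G \<and> (\<exists>S. finite S \<and> S \<subseteq> carrier G \<and> generate G S = carrier G)"

fun lower_central_series :: "('a, 'b) monoid_scheme \<Rightarrow> nat \<Rightarrow> 'a set"
  where
    "lower_central_series G 0 = carrier G"
  | "lower_central_series G (Suc n) =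
      generate G {x \<otimes>\<^bsub>G\<^esub> y \<otimes>\<^bsub>G\<^esub> inv\<^bsub>G\<^esub> x \<otimes>\<^bsub>G\<^esub> inv\<^bsub>G\<^esub> y | x y.
        x \<in> lower_central_series G n \<and> y \<in> carrier G}"

definition nilpotent_group :: "('a, 'b) monoid_scheme \<Rightarrow> bool"
  where "nilpotent_group G \<longleftrightarrow> group G \<and> (\<exists>n. lower_central_series G n = {\<one>\<^bsub>G\<^esub>})"

definition virtually_nilpotent :: "('a, 'b) monoid_scheme \<Rightarrow> bool"
  where "virtually_nilpotent G \<longleftrightarrow>
    (\<exists>H. subgroup H G \<and> finite (rcosets\<^bsub>G\<^esub> H) \<and> nilpotent_group (G\<lparr>carrier := H\<rparr>))"

end

theory Submission
  imports Defs Complex_Main "HOL-Library.Countable_Set"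
begin

text \<open>
  On a minimal subset of a proximal action, an element of finite conjugacy class acts trivially:
  its class has a common fixed point, and the set of these is closed and invariant. So if \<open>G\<close> has
  no ICC quotient, it acts trivially on minimal sets.

  Conversely, let \<open>G\<close> be countable, ICC and nontrivial. A subshift of \<open>{0,1}\<^sup>G\<close> is proximal if any
  two of its points agree, after a common translation, on any given finite set \<open>C\<close>. This is achieved
  for one \<open>C\<close> by a pattern \<open>p\<close> on \<open>C\<close> and a finite set \<open>M\<close> such that in every point \<open>p\<close> occurs in
  every translate \<open>M g\<close>, while somewhere it occurs on a whole translate \<open>M h\<close>. The two requirements
  are compatible because, by the ICC property and B. H. Neumann's lemma, \<open>M\<close> can be chosen such
  that occurrences on \<open>M h\<close> obstruct at most two sites of any other \<open>M g\<close>; the remaining occurrences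
  are then found with the Lovasz local lemma. Iterating over all \<open>C\<close>, one keeps a supply of
  patches that can be glued freely whenever they are far apart.

  A finitely generated group without ICC quotient is virtually nilpotent: by Zorn's lemma there would
  be a maximal normal \<open>N\<close> with \<open>G/N\<close> not virtually nilpotent, and an FC element of \<open>G/N\<close>
  contradicts maximality.
\<close>

section \<open>The local lemma for random subsets\<close>

text \<open>Why the two demands on \<open>M\<close> give proximality: if \<open>x\<close> shows
  \<open>p\<close> at every site of \<open>M h\<close> and \<open>y\<close> shows it at one site
  \<open>m h\<close>, then both show it at \<open>m h\<close> and agree on the translate
  \<open>C m h\<close>. For this the full occurrence on some \<open>M h\<close> must be found in
  every \<open>x\<close>, so the patch \<open>P\<close> that carries it is in turn made to recur, by
  a second round with \<open>P\<close> in place of \<open>p\<close>. The obstacle is that forcing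
  occurrences destroys freedom: a patch whose domain ends in the middle of some \<open>M g\<close>
  may have used up the room for \<open>p\<close> there. Legal patches are therefore those that leave
  each \<open>M g\<close> either served or with at least \<open>\<rho>\<close> free sites, and new
  domains get a random boundary so that no \<open>M g\<close> is cut up too badly. The failure
  probabilities are exponentially small in \<open>\<rho>\<close>, while \<open>M\<close> has
  \<open>2 * \<rho> * \<rho>\<close> sites and the windows have a radius fixed before
  \<open>\<rho>\<close>; the dependencies thus grow polynomially and the local lemma applies. Only
  finite patches are ever built; compactness produces the points.\<close>

definition depends_on :: "('b set \<Rightarrow> bool) \<Rightarrow> 'b set \<Rightarrow> bool"
  where "depends_on X S \<longleftrightarrow> (\<forall>R R'. R \<inter> S = R' \<inter> S \<longrightarrow> X R = X R')"

lemma depends_onD: "depends_on X S \<Longrightarrow> R \<inter> S = R' \<inter> S \<Longrightarrow> X R = X R'"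
  unfolding depends_on_def by blast

lemma depends_on_Ball_not:
  assumes "\<And>j. j \<in> J \<Longrightarrow> depends_on (B j) (S j)"
  shows "depends_on (\<lambda>R. \<forall>j\<in>J. \<not> B j R) (\<Union>j\<in>J. S j)"
  unfolding depends_on_def
proof (intro allI impI)
  fix R R' assume eq: "R \<inter> (\<Union>j\<in>J. S j) = R' \<inter> (\<Union>j\<in>J. S j)"
  have "B j R = B j R'" if "j \<in> J" for j
    using eq that by (intro depends_onD[OF assms[OF that]]) blast
  then show "(\<forall>j\<in>J. \<not> B j R) = (\<forall>j\<in>J. \<not> B j R')"
    by blast
qed

definition prob_sub :: "'b set \<Rightarrow> ('b set \<Rightarrow> bool) \<Rightarrow> real"
  where "prob_sub \<Omega> X = card {R \<in> Pow \<Omega>. X R} / 2 ^ card \<Omega>"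

lemma prob_sub_nonneg: "0 \<le> prob_sub \<Omega> X"
  by (simp add: prob_sub_def)

lemma prob_sub_mono:
  assumes "finite \<Omega>" "\<And>R. R \<subseteq> \<Omega> \<Longrightarrow> X R \<Longrightarrow> Y R"
  shows "prob_sub \<Omega> X \<le> prob_sub \<Omega> Y"
  using assms unfolding prob_sub_def
  by (intro divide_right_mono of_nat_mono card_mono) auto

lemma prob_sub_True: "finite \<Omega> \<Longrightarrow> prob_sub \<Omega> (\<lambda>R. True) = 1"
  by (simp add: prob_sub_def card_Pow flip: Pow_def)

lemma prob_sub_disj_le:
  assumes "finite \<Omega>"
  shows "prob_sub \<Omega> (\<lambda>R. X R \<or> Y R) \<le> prob_sub \<Omega> X + prob_sub \<Omega> Y"
proof -
  have "{R \<in> Pow \<Omega>. X R \<or> Y R} = {R \<in> Pow \<Omega>. X R} \<union> {R \<in> Pow \<Omega>. Y R}"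
    by auto
  then have "card {R \<in> Pow \<Omega>. X R \<or> Y R} \<le> card {R \<in> Pow \<Omega>. X R} + card {R \<in> Pow \<Omega>. Y R}"
    by (simp add: card_Un_le)
  then show ?thesis
    unfolding prob_sub_def add_divide_distrib[symmetric] of_nat_add[symmetric]
    by (intro divide_right_mono of_nat_mono) auto
qed

lemma prob_sub_Bex_le:
  assumes "finite \<Omega>" "finite J"
  shows "prob_sub \<Omega> (\<lambda>R. \<exists>j\<in>J. X j R) \<le> (\<Sum>j\<in>J. prob_sub \<Omega> (X j))"
  using assms(2)
proof (induction J)
  case empty
  then show ?case by (simp add: prob_sub_def)
next
  case (insert j J)
  have "prob_sub \<Omega> (\<lambda>R. \<exists>i\<in>insert j J. X i R) = prob_sub \<Omega> (\<lambda>R. X j R \<or> (\<exists>i\<in>J. X i R))"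
    by simp
  also have "\<dots> \<le> prob_sub \<Omega> (X j) + prob_sub \<Omega> (\<lambda>R. \<exists>i\<in>J. X i R)"
    by (rule prob_sub_disj_le[OF assms(1)])
  finally show ?case using insert by simp
qed

lemma prob_sub_diff:
  assumes "finite \<Omega>"
  shows "prob_sub \<Omega> (\<lambda>R. X R \<and> \<not> Y R) \<ge> prob_sub \<Omega> X - prob_sub \<Omega> (\<lambda>R. Y R \<and> X R)"
proof -
  have "prob_sub \<Omega> X \<le> prob_sub \<Omega> (\<lambda>R. (X R \<and> \<not> Y R) \<or> (Y R \<and> X R))"
    by (rule prob_sub_mono[OF assms]) auto
  also have "\<dots> \<le> prob_sub \<Omega> (\<lambda>R. X R \<and> \<not> Y R) + prob_sub \<Omega> (\<lambda>R. Y R \<and> X R)"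
    by (rule prob_sub_disj_le[OF assms])
  finally show ?thesis by simp
qed

text \<open>Exchanging the parts of two independent samples inside \<open>S\<close> is an involution that turns
  \<open>X R \<and> Y R\<close> into \<open>X R \<and> Y R'\<close>.\<close>

lemma prob_sub_indep:
  assumes fin: "finite \<Omega>" and X: "depends_on X S" and Y: "depends_on Y S'" and "S \<inter> S' = {}"
  shows "prob_sub \<Omega> (\<lambda>R. X R \<and> Y R) = prob_sub \<Omega> X * prob_sub \<Omega> Y"
proof -
  define sw where "sw = (\<lambda>(R, R'). ((R \<inter> S) \<union> (R' - S), (R' \<inter> S) \<union> (R - S)))"
  have invol: "sw (sw z) = z" for z
    unfolding sw_def by (cases z) auto
  have X': "X (R \<inter> S \<union> (R' - S)) = X R" for R R'
    by (rule depends_onD[OF X]) blast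
  have Y': "Y (R' \<inter> S \<union> (R - S)) = Y R" for R R'
    by (rule depends_onD[OF Y]) (use assms(4) in blast)
  have "bij_betw sw ({R \<in> Pow \<Omega>. X R \<and> Y R} \<times> Pow \<Omega>) ({R \<in> Pow \<Omega>. X R} \<times> {R \<in> Pow \<Omega>. Y R})"
  proof (rule bij_betw_byWitness[where f' = sw])
    show "sw ` ({R \<in> Pow \<Omega>. X R \<and> Y R} \<times> Pow \<Omega>) \<subseteq> {R \<in> Pow \<Omega>. X R} \<times> {R \<in> Pow \<Omega>. Y R}"
      by (auto simp: sw_def X' Y')
    show "sw ` ({R \<in> Pow \<Omega>. X R} \<times> {R \<in> Pow \<Omega>. Y R}) \<subseteq> {R \<in> Pow \<Omega>. X R \<and> Y R} \<times> Pow \<Omega>"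
    proof (clarsimp simp: sw_def X')
      fix R R' assume R: "R \<subseteq> \<Omega>" "X R" "R' \<subseteq> \<Omega>" "Y R'"
      have "Y (R \<inter> S \<union> (R' - S)) = Y R'"
        by (rule depends_onD[OF Y]) (use assms(4) in blast)
      with R show "R \<inter> S \<subseteq> \<Omega> \<and> R' - S \<subseteq> \<Omega> \<and> Y (R \<inter> S \<union> (R' - S)) \<and> R' \<inter> S \<subseteq> \<Omega> \<and> R - S \<subseteq> \<Omega>"
        by auto
    qed
  qed (auto simp: invol)
  then have "card ({R \<in> Pow \<Omega>. X R \<and> Y R} \<times> Pow \<Omega>) = card ({R \<in> Pow \<Omega>. X R} \<times> {R \<in> Pow \<Omega>. Y R})"
    by (rule bij_betw_same_card)
  then have "card {R \<in> Pow \<Omega>. X R \<and> Y R} * 2 ^ card \<Omega>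
      = card {R \<in> Pow \<Omega>. X R} * card {R \<in> Pow \<Omega>. Y R}"
    by (simp only: card_cartesian_product card_Pow[OF fin])
  then have "real (card {R \<in> Pow \<Omega>. X R \<and> Y R} * 2 ^ card \<Omega>)
      = real (card {R \<in> Pow \<Omega>. X R} * card {R \<in> Pow \<Omega>. Y R})"
    by (rule arg_cong)
  then have eq: "real (card {R \<in> Pow \<Omega>. X R \<and> Y R}) * 2 ^ card \<Omega>
      = real (card {R \<in> Pow \<Omega>. X R}) * real (card {R \<in> Pow \<Omega>. Y R})"
    by (simp only: of_nat_mult of_nat_power of_nat_numeral)
  have div: "c / N = (a / N) * (b / N)" if "c * N = a * b" "N \<noteq> 0" for a b c N :: real
  proof -
    have "c = a * b / N"
      using that by (simp add: eq_divide_eq)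
    then show ?thesis by simp
  qed
  show ?thesis
    unfolding prob_sub_def by (rule div[OF eq]) simp
qed

lemma prob_sub_fixed_trace:
  assumes "finite \<Omega>" "S \<subseteq> \<Omega>" "A \<subseteq> S"
  shows "prob_sub \<Omega> (\<lambda>R. R \<inter> S = A) = 1 / 2 ^ card S"
proof -
  have "bij_betw (\<lambda>R. R - S) {R \<in> Pow \<Omega>. R \<inter> S = A} (Pow (\<Omega> - S))"
    by (rule bij_betw_byWitness[where f' = "\<lambda>R. R \<union> A"]) (use assms in auto)
  then have "card {R \<in> Pow \<Omega>. R \<inter> S = A} = 2 ^ card (\<Omega> - S)"
    using assms by (simp add: bij_betw_same_card card_Pow)
  moreover have c: "card \<Omega> = card (\<Omega> - S) + card S"
    using card_Diff_subset[OF finite_subset[OF assms(2,1)] assms(2)] card_mono[OF assms(1,2)]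
    by linarith
  ultimately show ?thesis
    unfolding prob_sub_def c power_add by simp
qed

text \<open>The symmetric form: each bad event has probability at most \<open>p\<close>, and its
  support meets those of at most \<open>d\<close> events, counting itself. The constant 4 comes from
  keeping conditional probabilities below \<open>2 * p\<close>: the neighbours of an event then
  remove at most \<open>2 * p * d \<le> 1 / 2\<close> of the mass.\<close>

lemma local_lemma:
  fixes B :: "'i \<Rightarrow> 'b set \<Rightarrow> bool"
  assumes fin: "finite \<Omega>" "finite I"
    and dep: "\<And>i. i \<in> I \<Longrightarrow> depends_on (B i) (S i)"
    and p: "\<And>i. i \<in> I \<Longrightarrow> prob_sub \<Omega> (B i) \<le> p" "0 \<le> p" "4 * p \<le> 1"
    and deg: "\<And>i. i \<in> I \<Longrightarrow> card {j \<in> I. S i \<inter> S j \<noteq> {}} \<le> d" "4 * p * d \<le> 1"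
  shows "\<exists>R\<subseteq>\<Omega>. \<forall>i\<in>I. \<not> B i R"
proof -
  define good where "good J R \<longleftrightarrow> (\<forall>j\<in>J. \<not> B j R)" for J R
  \<comment> \<open>The conditional probability of \<open>B i\<close> given \<open>good J\<close> is
    at most \<open>2 * p\<close>, multiplied out because positivity of \<open>good J\<close> is
    known only afterwards.\<close>
  have claim: "prob_sub \<Omega> (\<lambda>R. B i R \<and> good J R) \<le> 2 * p * prob_sub \<Omega> (good J)"
    if "J \<subseteq> I" "i \<in> I" for J i
    using finite_subset[OF that(1) fin(2)] that
  proof (induction J arbitrary: i rule: finite_psubset_induct)
    case (psubset J)
    define J1 where "J1 = {j \<in> J. S i \<inter> S j \<noteq> {}}"
    define J2 where "J2 = J - J1"
    define G2 where "G2 = prob_sub \<Omega> (good J2)"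
    have G2: "0 \<le> G2" by (simp add: G2_def prob_sub_nonneg)
    have J2: "J2 \<subseteq> I" "J2 \<subseteq> J" using psubset.prems by (auto simp: J2_def)
    have "prob_sub \<Omega> (\<lambda>R. B i R \<and> good J R) \<le> prob_sub \<Omega> (\<lambda>R. B i R \<and> good J2 R)"
      by (rule prob_sub_mono[OF fin(1)]) (use J2 in \<open>auto simp: good_def\<close>)
    also have "\<dots> = prob_sub \<Omega> (B i) * G2"
      unfolding G2_def
    proof (rule prob_sub_indep[OF fin(1) dep[OF \<open>i \<in> I\<close>]])
      show "depends_on (good J2) (\<Union>j\<in>J2. S j)"
        unfolding good_def[abs_def] using J2(1) by (intro depends_on_Ball_not dep) auto
      show "S i \<inter> (\<Union>j\<in>J2. S j) = {}"
        by (auto simp: J2_def J1_def)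
    qed
    also have "\<dots> \<le> p * G2"
      using p(1)[OF \<open>i \<in> I\<close>] G2 by (rule mult_right_mono)
    finally have le: "prob_sub \<Omega> (\<lambda>R. B i R \<and> good J R) \<le> p * G2" .
    \<comment> \<open>Given \<open>good J2\<close>, the induction hypothesis bounds each event of
      \<open>J1\<close> by \<open>2 * p\<close>, and there are at most \<open>d\<close> of them. It
      applies only to proper subsets of \<open>J\<close>, hence the case split.\<close>
    have half: "G2 / 2 \<le> prob_sub \<Omega> (good J)"
    proof (cases "J1 = {}")
      case True
      then have "J2 = J" by (simp add: J2_def)
      then show ?thesis using G2 by (simp add: G2_def)
    next
      case False
      then have lt: "J2 \<subset> J" by (auto simp: J2_def J1_def)
      have fJ1: "finite J1" using psubset.hyps by (simp add: J1_def)
      have "prob_sub \<Omega> (\<lambda>R. (\<exists>j\<in>J1. B j R) \<and> good J2 R)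
          = prob_sub \<Omega> (\<lambda>R. \<exists>j\<in>J1. B j R \<and> good J2 R)"
        by simp
      also have "\<dots> \<le> (\<Sum>j\<in>J1. prob_sub \<Omega> (\<lambda>R. B j R \<and> good J2 R))"
        by (rule prob_sub_Bex_le[OF fin(1) fJ1])
      also have "\<dots> \<le> (\<Sum>j\<in>J1. 2 * p * G2)"
        unfolding G2_def
        by (rule sum_mono, rule psubset.IH[OF lt J2(1)]) (use psubset.prems in \<open>auto simp: J1_def\<close>)
      also have "\<dots> = (2 * p * G2) * card J1"
        by simp
      also have "\<dots> \<le> (2 * p * G2) * d"
      proof (rule mult_left_mono)
        have "card J1 \<le> card {j \<in> I. S i \<inter> S j \<noteq> {}}"
          by (rule card_mono) (use psubset.prems fin in \<open>auto simp: J1_def\<close>)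
        with deg(1)[OF \<open>i \<in> I\<close>] show "real (card J1) \<le> real d" by simp
      qed (use G2 p in simp)
      also have "\<dots> \<le> G2 / 2"
        using mult_right_mono[OF deg(2) G2] by (simp add: mult_ac)
      finally have "prob_sub \<Omega> (\<lambda>R. (\<exists>j\<in>J1. B j R) \<and> good J2 R) \<le> G2 / 2" .
      moreover have "prob_sub \<Omega> (\<lambda>R. good J2 R \<and> \<not> (\<exists>j\<in>J1. B j R)) \<le> prob_sub \<Omega> (good J)"
        by (rule prob_sub_mono[OF fin(1)]) (auto simp: good_def J2_def)
      ultimately show ?thesis
        using prob_sub_diff[OF fin(1), of "good J2" "\<lambda>R. \<exists>j\<in>J1. B j R"] by (simp add: G2_def)
    qed
    have "p * G2 \<le> 2 * p * prob_sub \<Omega> (good J)"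
      using mult_left_mono[OF half p(2)] by simp
    with le show ?case by linarith
  qed
  have "0 < prob_sub \<Omega> (good J)" if "J \<subseteq> I" for J
    using finite_subset[OF that fin(2)] that
  proof (induction J)
    case empty
    then show ?case by (simp add: good_def[abs_def] prob_sub_True fin)
  next
    case (insert i J)
    have "prob_sub \<Omega> (good J) - 2 * p * prob_sub \<Omega> (good J)
        \<le> prob_sub \<Omega> (good J) - prob_sub \<Omega> (\<lambda>R. B i R \<and> good J R)"
      using claim[of J i] insert by simp
    also have "\<dots> \<le> prob_sub \<Omega> (\<lambda>R. good J R \<and> \<not> B i R)"
      by (rule prob_sub_diff[OF fin(1)])
    also have "\<dots> \<le> prob_sub \<Omega> (good (insert i J))"
      by (rule prob_sub_mono[OF fin(1)]) (auto simp: good_def)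
    finally have "prob_sub \<Omega> (good J) * (1 - 2 * p) \<le> prob_sub \<Omega> (good (insert i J))"
      by (simp add: algebra_simps)
    moreover have "0 < prob_sub \<Omega> (good J) * (1 - 2 * p)"
      using insert p by simp
    ultimately show ?case by linarith
  qed
  then have "0 < prob_sub \<Omega> (good I)" by blast
  then have "card {R \<in> Pow \<Omega>. good I R} \<noteq> 0"
    unfolding prob_sub_def by (simp only: zero_less_divide_iff) auto
  then obtain R where "R \<in> {R \<in> Pow \<Omega>. good I R}"
    by (metis (no_types, lifting) card.empty ex_in_conv)
  then show ?thesis by (auto simp: good_def)
qed

lemma one_minus_inverse_power2: "0 \<le> 1 - 1 / (2::real) ^ n" "1 - 1 / (2::real) ^ n < 1"
proof -
  have "(1::real) \<le> 2 ^ n" by (rule one_le_power) simp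
  then show "0 \<le> 1 - 1 / (2::real) ^ n" by (simp add: field_simps)
  have "0 < 1 / (2::real) ^ n" by (intro divide_pos_pos zero_less_power) simp_all
  then show "1 - 1 / (2::real) ^ n < 1" by simp
qed

text \<open>Disjoint windows make the trials independent, and each one succeeds with probability at
  least \<open>1 / 2 ^ \<beta>\<close>.\<close>

lemma prob_sub_all_traces_wrong:
  assumes fin: "finite \<Omega>" "finite Q"
    and S: "\<And>t. t \<in> Q \<Longrightarrow> S t \<subseteq> \<Omega>" "\<And>t. t \<in> Q \<Longrightarrow> A t \<subseteq> S t" "\<And>t. t \<in> Q \<Longrightarrow> card (S t) \<le> \<beta>"
    and disj: "\<And>t t'. t \<in> Q \<Longrightarrow> t' \<in> Q \<Longrightarrow> t \<noteq> t' \<Longrightarrow> S t \<inter> S t' = {}"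
  shows "prob_sub \<Omega> (\<lambda>R. \<forall>t\<in>Q. R \<inter> S t \<noteq> A t) \<le> (1 - 1 / 2 ^ \<beta>) ^ card Q"
  using fin(2) S disj
proof (induction Q)
  case empty
  then show ?case by (simp add: prob_sub_True fin)
next
  case (insert u Q)
  have d: "depends_on (\<lambda>R. R \<inter> S t \<noteq> A t) (S t)" for t
    by (simp add: depends_on_def)
  have "prob_sub \<Omega> (\<lambda>R. \<forall>t\<in>insert u Q. R \<inter> S t \<noteq> A t)
      = prob_sub \<Omega> (\<lambda>R. R \<inter> S u \<noteq> A u \<and> (\<forall>t\<in>Q. R \<inter> S t \<noteq> A t))"
    by simp
  also have "\<dots> = prob_sub \<Omega> (\<lambda>R. R \<inter> S u \<noteq> A u) * prob_sub \<Omega> (\<lambda>R. \<forall>t\<in>Q. R \<inter> S t \<noteq> A t)"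
  proof (rule prob_sub_indep[OF fin(1) d])
    show "depends_on (\<lambda>R. \<forall>t\<in>Q. R \<inter> S t \<noteq> A t) (\<Union>t\<in>Q. S t)"
      by (rule depends_on_Ball_not) (simp add: depends_on_def)
    show "S u \<inter> (\<Union>t\<in>Q. S t) = {}"
      using insert.prems(4)[of u] insert.hyps by auto
  qed
  also have "\<dots> \<le> (1 - 1 / 2 ^ \<beta>) * (1 - 1 / 2 ^ \<beta>) ^ card Q"
  proof (rule mult_mono)
    have "prob_sub \<Omega> (\<lambda>R. R \<inter> S u \<noteq> A u) + prob_sub \<Omega> (\<lambda>R. R \<inter> S u = A u) = 1"
    proof -
      have "card {R \<in> Pow \<Omega>. R \<inter> S u \<noteq> A u} + card {R \<in> Pow \<Omega>. R \<inter> S u = A u}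
          = card ({R \<in> Pow \<Omega>. R \<inter> S u \<noteq> A u} \<union> {R \<in> Pow \<Omega>. R \<inter> S u = A u})"
        by (rule card_Un_disjoint[symmetric]) (use fin in auto)
      also have "\<dots> = card (Pow \<Omega>)"
        by (rule arg_cong[where f = card]) auto
      finally have "card {R \<in> Pow \<Omega>. R \<inter> S u \<noteq> A u} + card {R \<in> Pow \<Omega>. R \<inter> S u = A u} = card (Pow \<Omega>)" .
      then show ?thesis
        unfolding prob_sub_def add_divide_distrib[symmetric] of_nat_add[symmetric] card_Pow[OF fin(1)]
        by simp
    qed
    moreover have "prob_sub \<Omega> (\<lambda>R. R \<inter> S u = A u) = 1 / 2 ^ card (S u)"
      by (intro prob_sub_fixed_trace fin(1) insert.prems insertI1)
    moreover have "(1::real) / 2 ^ \<beta> \<le> 1 / 2 ^ card (S u)"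
      by (intro divide_left_mono power_increasing insert.prems(3) mult_pos_pos zero_less_power insertI1) simp_all
    ultimately show "prob_sub \<Omega> (\<lambda>R. R \<inter> S u \<noteq> A u) \<le> 1 - 1 / 2 ^ \<beta>" by linarith
    show "prob_sub \<Omega> (\<lambda>R. \<forall>t\<in>Q. R \<inter> S t \<noteq> A t) \<le> (1 - 1 / 2 ^ \<beta>) ^ card Q"
      by (rule insert.IH) (simp_all add: insert.prems)
  qed (rule one_minus_inverse_power2 prob_sub_nonneg)+
  also have "\<dots> = (1 - 1 / 2 ^ \<beta>) ^ card (insert u Q)"
    by (simp only: card_insert_disjoint[OF insert.hyps] power_Suc)
  finally show ?case .
qed

text \<open>The bad event of \<open>i\<close> is that no trial \<open>t \<in> Q i\<close> shows its
  prescribed trace. Each \<open>Q i\<close> offers at least \<open>s\<close> independent trials, so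
  failure is exponentially unlikely in \<open>s\<close>.\<close>

lemma local_lemma_traces:
  assumes fin: "finite \<Omega>" "finite I" "\<And>i. i \<in> I \<Longrightarrow> finite (Q i)"
    and s: "\<And>i. i \<in> I \<Longrightarrow> s \<le> card (Q i)"
    and S: "\<And>i t. i \<in> I \<Longrightarrow> t \<in> Q i \<Longrightarrow> S t \<subseteq> \<Omega> \<and> A t \<subseteq> S t \<and> card (S t) \<le> \<beta>"
    and disj: "\<And>i t t'. i \<in> I \<Longrightarrow> t \<in> Q i \<Longrightarrow> t' \<in> Q i \<Longrightarrow> t \<noteq> t' \<Longrightarrow> S t \<inter> S t' = {}"
    and deg: "\<And>i. i \<in> I \<Longrightarrow> card {j \<in> I. \<exists>t\<in>Q i. \<exists>t'\<in>Q j. S t \<inter> S t' \<noteq> {}} \<le> d"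
    and num: "4 * (1 - 1 / 2 ^ \<beta>) ^ s \<le> (1::real)" "4 * (1 - 1 / 2 ^ \<beta>) ^ s * d \<le> (1::real)"
  shows "\<exists>R\<subseteq>\<Omega>. \<forall>i\<in>I. \<exists>t\<in>Q i. R \<inter> S t = A t"
proof -
  have "\<exists>R\<subseteq>\<Omega>. \<forall>i\<in>I. \<not> (\<forall>t\<in>Q i. R \<inter> S t \<noteq> A t)"
  proof (rule local_lemma[where S = "\<lambda>i. \<Union>t\<in>Q i. S t"])
    fix i assume i: "i \<in> I"
    show "depends_on (\<lambda>R. \<forall>t\<in>Q i. R \<inter> S t \<noteq> A t) (\<Union>t\<in>Q i. S t)"
      by (rule depends_on_Ball_not) (simp add: depends_on_def)
    have "prob_sub \<Omega> (\<lambda>R. \<forall>t\<in>Q i. R \<inter> S t \<noteq> A t) \<le> (1 - 1 / 2 ^ \<beta>) ^ card (Q i)"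
      using S[OF i] disj[OF i] by (intro prob_sub_all_traces_wrong fin(1) fin(3)[OF i]) auto
    also have "\<dots> \<le> (1 - 1 / 2 ^ \<beta>) ^ s"
      by (rule power_decreasing[OF s[OF i]]) (use one_minus_inverse_power2[of \<beta>] in linarith)+
    finally show "prob_sub \<Omega> (\<lambda>R. \<forall>t\<in>Q i. R \<inter> S t \<noteq> A t) \<le> (1 - 1 / 2 ^ \<beta>) ^ s" .
    have "{j \<in> I. (\<Union>t\<in>Q i. S t) \<inter> (\<Union>t\<in>Q j. S t) \<noteq> {}} = {j \<in> I. \<exists>t\<in>Q i. \<exists>t'\<in>Q j. S t \<inter> S t' \<noteq> {}}"
      by blast
    with deg[OF i] show "card {j \<in> I. (\<Union>t\<in>Q i. S t) \<inter> (\<Union>t\<in>Q j. S t) \<noteq> {}} \<le> d"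
      by simp
  next
    show "0 \<le> (1 - 1 / (2::real) ^ \<beta>) ^ s"
      by (rule zero_le_power) (rule one_minus_inverse_power2)
  qed (rule fin num)+
  then show ?thesis by auto
qed

lemma local_lemma_parameter:
  fixes \<beta> C k :: nat
  assumes k: "0 < k"
  shows "\<exists>s>1. 4 * (1 - 1 / 2 ^ \<beta>) ^ s \<le> (1::real) \<and> 4 * (1 - 1 / 2 ^ \<beta>) ^ s * real (C * s ^ k) \<le> 1"
proof -
  define x :: real where "x = 1 - 1 / 2 ^ \<beta>"
  have x: "0 \<le> x" "x < 1" by (simp_all only: x_def one_minus_inverse_power2)
  have "(\<lambda>s. x ^ s) \<longlonglongrightarrow> 0"
    using x by (intro LIMSEQ_realpow_zero) auto
  then have 1: "(\<lambda>s. 4 * x ^ s) \<longlonglongrightarrow> 0"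
    by (rule tendsto_mult_right_zero)
  \<comment> \<open>With \<open>y ^ k = x\<close> the sequence \<open>s ^ k * x ^ s\<close> is the
    \<open>k\<close>-th power of \<open>s * y ^ s\<close>.\<close>
  define y where "y = root k x"
  have y: "y ^ k = x" "norm y < 1" "0 \<le> y"
    using x k by (auto simp: y_def real_root_lt_1_iff)
  have "(\<lambda>s. (real s * y ^ s) ^ k) \<longlonglongrightarrow> 0 ^ k"
    by (intro tendsto_power powser_times_n_limit_0 y)
  moreover have "(real s * y ^ s) ^ k = real s ^ k * x ^ s" for s
    by (simp add: power_mult_distrib flip: y(1) power_mult) (simp add: mult.commute)
  ultimately have "(\<lambda>s. real s ^ k * x ^ s) \<longlonglongrightarrow> 0"
    by (simp add: zero_power[OF k])
  then have 2: "(\<lambda>s. (4 * real C) * (real s ^ k * x ^ s)) \<longlonglongrightarrow> 0"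
    by (rule tendsto_mult_right_zero)
  have "\<forall>\<^sub>F s in sequentially. 4 * x ^ s < 1 \<and> (4 * real C) * (real s ^ k * x ^ s) < 1 \<and> 1 < s"
    using order_tendstoD(2)[OF 1 zero_less_one] order_tendstoD(2)[OF 2 zero_less_one] eventually_gt_at_top[of "1::nat"]
    by eventually_elim auto
  then obtain s where "4 * x ^ s < 1" "(4 * real C) * (real s ^ k * x ^ s) < 1" "1 < s"
    by (auto dest: eventually_happens)
  then show ?thesis
    by (intro exI[of _ s]) (simp add: mult_ac flip: x_def)
qed

section \<open>Separating finite sets by conjugation\<close>

context group
begin

lemma mult_inv_cancel_left:
  assumes "x \<in> carrier G" "y \<in> carrier G"
  shows "x \<otimes> (inv x \<otimes> y) = y" "inv x \<otimes> (x \<otimes> y) = y"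
  using assms by (simp_all add: m_assoc[symmetric])

lemmas word_simps = m_assoc inv_mult_group mult_inv_cancel_left

text \<open>B. H. Neumann's lemma; \<open>inv a \<otimes> x \<in> H\<close> says that \<open>x\<close> lies in the coset \<open>a H\<close>.\<close>

lemma avoid_cosets:
  assumes "finite \<H>" and sub: "\<And>H. H \<in> \<H> \<Longrightarrow> subgroup H G"
    and inf: "\<And>H A. H \<in> \<H> \<Longrightarrow> finite A \<Longrightarrow> A \<subseteq> carrier G \<Longrightarrow>
      \<exists>x\<in>carrier G. \<forall>a\<in>A. inv a \<otimes> x \<notin> H"
    and "finite A" "A \<subseteq> carrier G"
  shows "\<exists>x\<in>carrier G. \<forall>H\<in>\<H>. \<forall>a\<in>A. inv a \<otimes> x \<notin> H"
  using assms
proof (induction \<H> arbitrary: A)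
  case empty
  then show ?case by auto
next
  case (insert H \<H>)
  interpret H: subgroup H G using insert.prems(1) by simp
  obtain x where x: "x \<in> carrier G" "\<And>a. a \<in> A \<Longrightarrow> inv a \<otimes> x \<notin> H"
    using insert.prems(2)[of H A] insert.prems(3,4) by auto
  \<comment> \<open>If \<open>y\<close> falls into a coset \<open>a0 H\<close>, it is moved to
    \<open>x \<otimes> (inv a0 \<otimes> y)\<close>, which lies in \<open>x H\<close> and so avoids
    every \<open>a H\<close>. The products \<open>a \<otimes> inv x \<otimes> b\<close> are what
    \<open>y\<close> must avoid for the moved element to stay off the cosets of the other
    subgroups.\<close>
  define B where "B = A \<union> (\<lambda>(a, b). a \<otimes> inv x \<otimes> b) ` (A \<times> A)"
  have B: "finite B" "B \<subseteq> carrier G"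
    using insert.prems(3,4) x by (auto simp: B_def)
  obtain y where y: "y \<in> carrier G" "\<And>K b. K \<in> \<H> \<Longrightarrow> b \<in> B \<Longrightarrow> inv b \<otimes> y \<notin> K"
    using insert.IH[of B] insert.prems(1,2) B by auto
  show ?case
  proof (cases "\<forall>a\<in>A. inv a \<otimes> y \<notin> H")
    case True
    with y show ?thesis by (auto simp: B_def)
  next
    case False
    then obtain a0 where a0: "a0 \<in> A" "inv a0 \<otimes> y \<in> H" by blast
    define z where "z = x \<otimes> (inv a0 \<otimes> y)"
    have a0c: "a0 \<in> carrier G" using a0 insert.prems by blast
    have zc: "z \<in> carrier G" using x y a0c by (simp add: z_def)
    have "inv a \<otimes> z \<notin> H" if a: "a \<in> A" for a
    proof
      assume "inv a \<otimes> z \<in> H"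
      then have "inv a \<otimes> z \<otimes> inv (inv a0 \<otimes> y) \<in> H"
        using a0(2) by simp
      moreover have "a \<in> carrier G" using a insert.prems by blast
      then have "inv a \<otimes> z \<otimes> inv (inv a0 \<otimes> y) = inv a \<otimes> x"
        using x(1) y(1) a0c by (simp add: z_def word_simps)
      ultimately show False using x(2)[OF a] by simp
    qed
    moreover have "inv b \<otimes> z \<notin> K" if K: "K \<in> \<H>" and b: "b \<in> A" for K b
    proof -
      have bc: "b \<in> carrier G" using b insert.prems by blast
      have "a0 \<otimes> inv x \<otimes> b \<in> B"
        using a0 b by (auto simp: B_def)
      then have "inv (a0 \<otimes> inv x \<otimes> b) \<otimes> y \<notin> K" using y(2) K by blast
      moreover have "inv (a0 \<otimes> inv x \<otimes> b) \<otimes> y = inv b \<otimes> z"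
        using a0c bc x y by (simp add: z_def word_simps)
      ultimately show ?thesis by simp
    qed
    ultimately show ?thesis using zc by blast
  qed
qed

lemma conj_eq_imp_centralizes:
  assumes "g \<in> carrier G" "c \<in> carrier G" "m \<in> carrier G"
    and eq: "c \<otimes> g \<otimes> inv c = m \<otimes> g \<otimes> inv m"
  shows "(inv c \<otimes> m) \<otimes> g = g \<otimes> (inv c \<otimes> m)"
proof -
  have "(inv c \<otimes> m) \<otimes> g = inv c \<otimes> (m \<otimes> g \<otimes> inv m) \<otimes> m"
    using assms(1-3) by (simp add: word_simps)
  also have "\<dots> = g \<otimes> (inv c \<otimes> m)"
    unfolding eq[symmetric] using assms(1-3) by (simp add: word_simps)
  finally show ?thesis .
qed

lemma centralizer_subgroup:
  assumes "S \<subseteq> carrier G"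
  shows "subgroup {c \<in> carrier G. \<forall>s\<in>S. c \<otimes> s = s \<otimes> c} G"
proof (rule subgroupI)
  fix c assume "c \<in> {c \<in> carrier G. \<forall>s\<in>S. c \<otimes> s = s \<otimes> c}"
  then have c: "c \<in> carrier G" "\<And>s. s \<in> S \<Longrightarrow> c \<otimes> s = s \<otimes> c" by auto
  have "inv c \<otimes> s = s \<otimes> inv c" if s: "s \<in> S" for s
  proof -
    have sc: "s \<in> carrier G" using s assms by blast
    have "inv c \<otimes> s = inv c \<otimes> (s \<otimes> c) \<otimes> inv c" using c(1) sc by (simp add: word_simps)
    also have "\<dots> = inv c \<otimes> (c \<otimes> s) \<otimes> inv c" using c(2)[OF s] by simp
    also have "\<dots> = s \<otimes> inv c" using c(1) sc by (simp add: word_simps)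
    finally show ?thesis .
  qed
  then show "inv c \<in> {c \<in> carrier G. \<forall>s\<in>S. c \<otimes> s = s \<otimes> c}" using c(1) by auto
  fix d assume "d \<in> {c \<in> carrier G. \<forall>s\<in>S. c \<otimes> s = s \<otimes> c}"
  then have d: "d \<in> carrier G" "\<And>s. s \<in> S \<Longrightarrow> d \<otimes> s = s \<otimes> d" by auto
  have "c \<otimes> d \<otimes> s = s \<otimes> (c \<otimes> d)" if s: "s \<in> S" for s
  proof -
    have "s \<in> carrier G" using s assms by blast
    then show ?thesis using c d s by (metis m_assoc)
  qed
  then show "c \<otimes> d \<in> {c \<in> carrier G. \<forall>s\<in>S. c \<otimes> s = s \<otimes> c}" using c(1) d(1) by auto
next
  have "\<one> \<in> {c \<in> carrier G. \<forall>s\<in>S. c \<otimes> s = s \<otimes> c}" using subsetD[OF assms] by simp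
  then show "{c \<in> carrier G. \<forall>s\<in>S. c \<otimes> s = s \<otimes> c} \<noteq> {}" by blast
qed auto

text \<open>The \<open>m\<close> with \<open>m \<otimes> g \<otimes> inv m = l\<close> form at most
  one left coset of the centralizer of \<open>g\<close>, which has infinite index because the class
  of \<open>g\<close> is infinite. Neumann's lemma avoids the finitely many cosets that arise; the
  trivial subgroup joins the list to take care of \<open>Z\<close>.\<close>

lemma conj_in_finite_avoid:
  assumes inf: "infinite (carrier G)"
    and S: "finite S" "S \<subseteq> carrier G" "\<And>g. g \<in> S \<Longrightarrow> infinite (conjugacy_class G g)"
    and "finite \<Lambda>" "finite Z"
  shows "\<exists>m\<in>carrier G. m \<notin> Z \<and> (\<forall>g\<in>S. m \<otimes> g \<otimes> inv m \<notin> \<Lambda>)"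
proof -
  define cent where "cent g = {c \<in> carrier G. c \<otimes> g = g \<otimes> c}" for g
  have sub: "subgroup (cent g) G" if g: "g \<in> carrier G" for g
    using centralizer_subgroup[of "{g}"] g by (simp add: cent_def)
  have inf_cent: "\<exists>x\<in>carrier G. \<forall>a\<in>A. inv a \<otimes> x \<notin> cent g"
    if g: "g \<in> S" and A: "finite A" "A \<subseteq> carrier G" for g A
  proof (rule ccontr)
    assume "\<not> ?thesis"
    then have cov: "\<exists>a\<in>A. inv a \<otimes> x \<in> cent g" if "x \<in> carrier G" for x using that by blast
    have gc: "g \<in> carrier G" using g S by blast
    have "conjugacy_class G g \<subseteq> (\<lambda>a. a \<otimes> g \<otimes> inv a) ` A"
    proof (clarsimp simp: conjugacy_class_def)
      fix x assume x: "x \<in> carrier G"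
      then obtain a where a: "a \<in> A" "inv a \<otimes> x \<in> cent g" using cov by blast
      then have ac: "a \<in> carrier G" using A by blast
      have "x \<otimes> g \<otimes> inv x = a \<otimes> ((inv a \<otimes> x) \<otimes> g) \<otimes> inv x"
        using x ac gc by (simp add: word_simps)
      also have "\<dots> = a \<otimes> (g \<otimes> (inv a \<otimes> x)) \<otimes> inv x"
        using a(2) by (simp add: cent_def)
      also have "\<dots> = a \<otimes> g \<otimes> inv a"
        using x ac gc by (simp add: word_simps)
      finally show "x \<otimes> g \<otimes> inv x \<in> (\<lambda>a. a \<otimes> g \<otimes> inv a) ` A" using a by blast
    qed
    with A(1) S(3)[OF g] show False by (meson finite_imageI finite_subset)
  qed
  have inf_one: "\<exists>x\<in>carrier G. \<forall>a\<in>A. inv a \<otimes> x \<notin> {\<one>}" if A: "finite A" "A \<subseteq> carrier G" for A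
  proof -
    obtain x where "x \<in> carrier G" "x \<notin> A"
      using inf A by (meson finite_subset subsetI)
    moreover have "a = x" if "a \<in> carrier G" "x \<in> carrier G" "inv a \<otimes> x = \<one>" for a x
      using inv_equality[OF that(3,2)] that by (metis inv_closed inv_inv)
    ultimately show ?thesis
      using A(2) by blast
  qed
  define rep where "rep g l = (SOME c. c \<in> carrier G \<and> c \<otimes> g \<otimes> inv c = l)" for g l
  \<comment> \<open>Where \<open>l\<close> is no conjugate of \<open>g\<close>,
    \<open>rep g l\<close> is an arbitrary element; intersecting with \<open>carrier G\<close> keeps
    \<open>A\<close> admissible, and an additional forbidden coset does no harm.\<close>
  define A where "A = ((\<lambda>(g, l). rep g l) ` (S \<times> \<Lambda>) \<union> Z) \<inter> carrier G"
  have "\<exists>x\<in>carrier G. \<forall>H\<in>insert {\<one>} (cent ` S). \<forall>a\<in>A. inv a \<otimes> x \<notin> H"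
  proof (rule avoid_cosets)
    show "finite A" "A \<subseteq> carrier G" using assms by (auto simp: A_def)
    show "subgroup H G" if "H \<in> insert {\<one>} (cent ` S)" for H
      using that sub S triv_subgroup by auto
    show "\<exists>x\<in>carrier G. \<forall>a\<in>B. inv a \<otimes> x \<notin> H"
      if "H \<in> insert {\<one>} (cent ` S)" "finite B" "B \<subseteq> carrier G" for H B
      using that inf_cent inf_one by auto
  qed (use S in auto)
  then obtain m where m: "m \<in> carrier G" "\<And>a. a \<in> A \<Longrightarrow> inv a \<otimes> m \<noteq> \<one>"
    "\<And>a g. g \<in> S \<Longrightarrow> a \<in> A \<Longrightarrow> inv a \<otimes> m \<notin> cent g" by auto
  have "m \<notin> Z"
    using m(1) m(2)[of m] by (auto simp: A_def)
  moreover have "m \<otimes> g \<otimes> inv m \<notin> \<Lambda>" if g: "g \<in> S" for g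
  proof
    assume l: "m \<otimes> g \<otimes> inv m \<in> \<Lambda>"
    define c where "c = rep g (m \<otimes> g \<otimes> inv m)"
    have c: "c \<in> carrier G" "c \<otimes> g \<otimes> inv c = m \<otimes> g \<otimes> inv m"
      using someI[of "\<lambda>c. c \<in> carrier G \<and> c \<otimes> g \<otimes> inv c = m \<otimes> g \<otimes> inv m" m] m(1)
      by (auto simp: c_def rep_def)
    moreover have "c \<in> (\<lambda>(g, l). rep g l) ` (S \<times> \<Lambda>)"
      using g l unfolding c_def by (intro image_eqI[where x = "(g, m \<otimes> g \<otimes> inv m)"]) auto
    ultimately have "c \<in> A" by (simp add: A_def)
    moreover have "inv c \<otimes> m \<in> cent g"
      using conj_eq_imp_centralizes[OF subsetD[OF S(2) g] c(1) m(1) c(2)] c(1) m(1)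
      unfolding cent_def by simp
    ultimately show False using m(3)[OF g] by simp
  qed
  ultimately show ?thesis using m(1) by (intro bexI[of _ m] conjI ballI)
qed

end

section \<open>Proper length functions on countable groups\<close>

locale proper_length = group G for G (structure) +
  fixes len :: "'a \<Rightarrow> nat"
  assumes len_one: "len \<one> = 0"
    and len_inv: "x \<in> carrier G \<Longrightarrow> len (inv x) = len x"
    and len_mult: "x \<in> carrier G \<Longrightarrow> y \<in> carrier G \<Longrightarrow> len (x \<otimes> y) \<le> len x + len y"
    and finite_len: "finite {x \<in> carrier G. len x \<le> r}"

text \<open>A word length with finite balls would need finite generation. Instead \<open>G\<close>
  is exhausted by finite symmetric sets \<open>U n\<close> with
  \<open>U n <#> U n \<subseteq> U (Suc n)\<close>, and the length is essentially the first index at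
  which an element appears.\<close>

lemma (in group) countable_imp_proper_length:
  assumes "countable (carrier G)"
  shows "\<exists>len. proper_length G len"
proof -
  obtain e :: "nat \<Rightarrow> 'a" where e: "range e = carrier G"
    using range_from_nat_into[OF _ assms] one_closed by (metis empty_iff)
  define U where "U = rec_nat {\<one>} (\<lambda>n U. (U <#> U) \<union> {e n, inv (e n)})"
  have U0: "U 0 = {\<one>}" and US: "U (Suc n) = (U n <#> U n) \<union> {e n, inv (e n)}" for n
    by (simp_all add: U_def)
  have ec: "e n \<in> carrier G" for n using e by blast
  have Uc: "U n \<subseteq> carrier G" for n
    by (induction n) (auto simp: U0 US ec set_mult_def)
  have fin: "finite (U n)" for n
    by (induction n) (auto simp: U0 US set_mult_def)
  have one: "\<one> \<in> U n" for n
    by (induction n) (force simp: U0 US set_mult_def)+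
  have invU: "inv x \<in> U n" if "x \<in> U n" for x n
    using that
  proof (induction n arbitrary: x)
    case 0
    then show ?case by (simp add: U0)
  next
    case (Suc n)
    show ?case
    proof (cases "x \<in> U n <#> U n")
      case True
      then obtain a b where ab: "a \<in> U n" "b \<in> U n" "x = a \<otimes> b" by (auto simp: set_mult_def)
      then have "inv x = inv b \<otimes> inv a" using Uc by (metis inv_mult_group subsetD)
      then show ?thesis using Suc.IH ab by (auto simp: US set_mult_def)
    next
      case False
      with Suc.prems show ?thesis using ec by (auto simp: US)
    qed
  qed
  have multU: "x \<otimes> y \<in> U (Suc n)" if "x \<in> U n" "y \<in> U n" for x y n
    using that by (auto simp: US set_mult_def)
  have mono: "U m \<subseteq> U n" if "m \<le> n" for m n
    using that
  proof (induction n rule: dec_induct)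
    case (step n)
    have "U n \<subseteq> U (Suc n)"
    proof
      fix x assume x: "x \<in> U n"
      then show "x \<in> U (Suc n)" using multU[OF x one] Uc by (metis r_one subsetD)
    qed
    with step show ?case by blast
  qed simp
  have all: "\<exists>n. x \<in> U n" if x: "x \<in> carrier G" for x
  proof -
    obtain n where "x = e n" using e x by blast
    then have "x \<in> U (Suc n)" by (simp add: US)
    then show ?thesis by blast
  qed
  define rk where "rk x = (LEAST n. x \<in> U n)" for x
  have rk: "x \<in> U (rk x)" if "x \<in> carrier G" for x
    unfolding rk_def using all[OF that] by (rule LeastI_ex)
  have rk_le: "rk x \<le> n" if "x \<in> U n" for x n
    unfolding rk_def using that by (rule Least_le)
  \<comment> \<open>The rank of a product exceeds the larger of the two ranks by at most 1; the
    \<open>Suc\<close> on both factors pays for this. The identity is treated apart because its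
    length must be 0.\<close>
  define len where "len x = (if x = \<one> then 0 else Suc (rk x))" for x
  have "proper_length G len"
  proof
    show "len \<one> = 0" by (simp add: len_def)
    have le: "rk (inv x) \<le> rk x" if "x \<in> carrier G" for x
      by (rule rk_le[OF invU[OF rk[OF that]]])
    show "len (inv x) = len x" if x: "x \<in> carrier G" for x
    proof -
      have "rk (inv x) = rk x" using le[of x] le[of "inv x"] x by simp
      then show ?thesis using x by (simp add: len_def inv_eq_1_iff)
    qed
    show "len (x \<otimes> y) \<le> len x + len y" if xy: "x \<in> carrier G" "y \<in> carrier G" for x y
    proof -
      have "x \<in> U (max (rk x) (rk y))" "y \<in> U (max (rk x) (rk y))"
        using rk[OF xy(1)] rk[OF xy(2)] mono[of "rk x" "max (rk x) (rk y)"]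
          mono[of "rk y" "max (rk x) (rk y)"] by auto
      then have "rk (x \<otimes> y) \<le> Suc (max (rk x) (rk y))" by (intro rk_le multU)
      then show ?thesis using xy by (auto simp: len_def)
    qed
    show "finite {x \<in> carrier G. len x \<le> r}" for r
    proof (rule finite_subset[OF _ fin[of r]])
      show "{x \<in> carrier G. len x \<le> r} \<subseteq> U r"
      proof clarify
        fix x assume x: "x \<in> carrier G" "len x \<le> r"
        show "x \<in> U r"
        proof (cases "x = \<one>")
          case False
          then have "rk x \<le> r" using x by (simp add: len_def)
          then show ?thesis using rk[OF x(1)] mono by blast
        qed (simp add: one)
      qed
    qed
  qed
  then show ?thesis by blast
qed

section \<open>Patterns on a group with a proper length function\<close>

context proper_length
begin

text \<open>A pseudometric for which right multiplication, by which patterns are moved, is an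
  isometry, while \<open>k \<otimes> t\<close> lies at distance \<open>len k\<close> from
  \<open>t\<close>.\<close>

definition wdist :: "'a \<Rightarrow> 'a \<Rightarrow> nat"
  where "wdist x y = len (y \<otimes> inv x)"

definition near :: "nat \<Rightarrow> 'a set \<Rightarrow> 'a set"
  where "near r U = {x \<in> carrier G. \<exists>u\<in>U. wdist u x \<le> r}"

definition vol :: "nat \<Rightarrow> nat"
  where "vol r = card {x \<in> carrier G. len x \<le> r}"

lemma wdist_self: "x \<in> carrier G \<Longrightarrow> wdist x x = 0"
  by (simp add: wdist_def len_one)

lemma wdist_sym:
  assumes "x \<in> carrier G" "y \<in> carrier G"
  shows "wdist x y = wdist y x"
proof -
  have "inv (y \<otimes> inv x) = x \<otimes> inv y" using assms by (simp add: word_simps)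
  then show ?thesis using len_inv[of "y \<otimes> inv x"] assms by (simp add: wdist_def)
qed

lemma wdist_triangle:
  assumes "x \<in> carrier G" "y \<in> carrier G" "z \<in> carrier G"
  shows "wdist x z \<le> wdist x y + wdist y z"
proof -
  have "z \<otimes> inv x = (z \<otimes> inv y) \<otimes> (y \<otimes> inv x)" using assms by (simp add: word_simps)
  then show ?thesis using len_mult[of "z \<otimes> inv y" "y \<otimes> inv x"] assms by (simp add: wdist_def)
qed

lemma wdist_right:
  assumes "x \<in> carrier G" "y \<in> carrier G" "g \<in> carrier G"
  shows "wdist (x \<otimes> g) (y \<otimes> g) = wdist x y"
proof -
  have "y \<otimes> g \<otimes> inv (x \<otimes> g) = y \<otimes> inv x" using assms by (simp add: word_simps)
  then show ?thesis by (simp add: wdist_def)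
qed

lemma wdist_left:
  assumes "k \<in> carrier G" "t \<in> carrier G"
  shows "wdist t (k \<otimes> t) = len k"
proof -
  have "k \<otimes> t \<otimes> inv t = k" using assms by (simp add: word_simps)
  then show ?thesis by (simp add: wdist_def)
qed

lemma near_ball_subset:
  assumes "t \<in> carrier G"
  shows "near r {t} \<subseteq> (\<lambda>k. k \<otimes> t) ` {k \<in> carrier G. len k \<le> r}"
proof
  fix x assume "x \<in> near r {t}"
  then have x: "x \<in> carrier G" "len (x \<otimes> inv t) \<le> r" by (auto simp: near_def wdist_def)
  show "x \<in> (\<lambda>k. k \<otimes> t) ` {k \<in> carrier G. len k \<le> r}"
    by (rule image_eqI[of _ _ "x \<otimes> inv t"]) (use x assms in \<open>simp_all add: m_assoc\<close>)
qed

lemma near_carrier: "near r U \<subseteq> carrier G"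
  by (auto simp: near_def)

lemma finite_near:
  assumes "finite U" "U \<subseteq> carrier G"
  shows "finite (near r U)"
proof -
  have "near r U = (\<Union>u\<in>U. near r {u})" by (auto simp: near_def)
  moreover have "finite (near r {u})" if "u \<in> U" for u
    using near_ball_subset[of u r] that assms(2) finite_len[of r]
    by (meson finite_imageI finite_subset subsetD)
  ultimately show ?thesis using assms(1) by simp
qed

lemma card_near_le:
  assumes "t \<in> carrier G"
  shows "card (near r {t}) \<le> vol r"
proof -
  have "card (near r {t}) \<le> card ((\<lambda>k. k \<otimes> t) ` {k \<in> carrier G. len k \<le> r})"
    by (rule card_mono[OF _ near_ball_subset[OF assms]]) (simp add: finite_len)
  also have "\<dots> \<le> vol r" unfolding vol_def by (rule card_image_le[OF finite_len])
  finally show ?thesis .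
qed

text \<open>A configuration is \<open>q :: 'a \<rightharpoonup> bool\<close>; its translate is \<open>shift q t\<close>, so that the copies of a
  pattern \<open>p\<close> occurring in \<open>q\<close> correspond to the sites \<open>t\<close> with \<open>shift p t \<subseteq>\<^sub>m q\<close>.\<close>

definition shift :: "('a \<rightharpoonup> bool) \<Rightarrow> 'a \<Rightarrow> ('a \<rightharpoonup> bool)"
  where "shift p t = (\<lambda>x. if x \<in> carrier G then p (x \<otimes> inv t) else None)"

lemma dom_shift:
  assumes "dom p \<subseteq> carrier G" "t \<in> carrier G"
  shows "dom (shift p t) = (\<lambda>k. k \<otimes> t) ` dom p"
proof (intro equalityI subsetI)
  fix x assume "x \<in> dom (shift p t)"
  then have x: "x \<in> carrier G" "x \<otimes> inv t \<in> dom p"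
    by (auto simp: shift_def split: if_splits)
  then show "x \<in> (\<lambda>k. k \<otimes> t) ` dom p"
    by (intro image_eqI[of _ _ "x \<otimes> inv t"]) (use assms in \<open>simp_all add: m_assoc\<close>)
next
  fix x assume "x \<in> (\<lambda>k. k \<otimes> t) ` dom p"
  then obtain k where k: "x = k \<otimes> t" "k \<in> dom p" by blast
  then have kc: "k \<in> carrier G" using assms by blast
  then have "x \<otimes> inv t = k" using k assms by (simp add: m_assoc)
  then show "x \<in> dom (shift p t)" using k kc assms by (auto simp: shift_def)
qed

lemma shift_apply:
  assumes "k \<in> carrier G" "t \<in> carrier G"
  shows "shift p t (k \<otimes> t) = p k"
proof -
  have "k \<otimes> t \<otimes> inv t = k" using assms by (simp add: m_assoc)
  then show ?thesis using assms by (simp add: shift_def)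
qed

lemma shift_shift:
  assumes "s \<in> carrier G" "t \<in> carrier G"
  shows "shift (shift p s) t = shift p (s \<otimes> t)"
proof
  fix x
  have "x \<otimes> inv t \<otimes> inv s = x \<otimes> inv (s \<otimes> t)" if "x \<in> carrier G"
    using that assms by (simp add: word_simps)
  then show "shift (shift p s) t x = shift p (s \<otimes> t) x"
    using assms by (simp add: shift_def)
qed

lemma shift_mono: "p \<subseteq>\<^sub>m q \<Longrightarrow> shift p t \<subseteq>\<^sub>m shift q t"
  by (auto simp: map_le_def shift_def dom_def)

text \<open>Hyperedges are indexed by a translate \<open>g\<close> and one of \<open>c\<close>
  labels, so that several subsets of the same \<open>M g\<close> can be treated. Sites of
  \<open>M\<close> are more than \<open>2 * \<sigma>\<close> apart, hence the balls of radius
  \<open>\<sigma>\<close> around them are disjoint windows. The degree bound counts pairs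
  \<open>m\<close>, \<open>m'\<close>, an offset in the ball of radius \<open>2 * \<sigma>\<close>
  and a label.\<close>

lemma local_lemma_sites:
  assumes M: "finite M" "M \<subseteq> carrier G" "card M \<le> n"
    and sep: "\<And>m m'. m \<in> M \<Longrightarrow> m' \<in> M \<Longrightarrow> m \<noteq> m' \<Longrightarrow> 2 * \<sigma> < wdist m m'"
    and I: "finite I" "I \<subseteq> carrier G \<times> {..<c}"
    and Q: "\<And>i. i \<in> I \<Longrightarrow> Q i \<subseteq> (\<lambda>m. m \<otimes> fst i) ` M" "\<And>i. i \<in> I \<Longrightarrow> s \<le> card (Q i)"
    and \<Omega>: "finite \<Omega>"
    and num: "4 * (1 - 1 / 2 ^ vol \<sigma>) ^ s \<le> (1::real)"
      "4 * (1 - 1 / 2 ^ vol \<sigma>) ^ s * real (n * n * vol (2 * \<sigma>) * c) \<le> 1"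
  shows "\<exists>R\<subseteq>\<Omega>. \<forall>i\<in>I. \<exists>t\<in>Q i. R \<inter> near \<sigma> {t} = a t \<inter> near \<sigma> {t} \<inter> \<Omega>"
proof -
  have ic: "fst i \<in> carrier G" if "i \<in> I" for i using I(2) that by auto
  have Qc: "t \<in> carrier G" if "i \<in> I" "t \<in> Q i" for i t
    using subsetD[OF Q(1)[OF that(1)] that(2)] ic[OF that(1)] M(2) by blast
  have "\<exists>R\<subseteq>\<Omega>. \<forall>i\<in>I. \<exists>t\<in>Q i. R \<inter> (near \<sigma> {t} \<inter> \<Omega>) = a t \<inter> near \<sigma> {t} \<inter> \<Omega>"
  proof (rule local_lemma_traces[OF \<Omega> I(1) _ Q(2) _ _ _ num])
    fix i assume i: "i \<in> I"
    show fQ: "finite (Q i)" using finite_subset[OF Q(1)[OF i]] M(1) by simp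
    show "near \<sigma> {t} \<inter> \<Omega> \<subseteq> \<Omega> \<and> a t \<inter> near \<sigma> {t} \<inter> \<Omega> \<subseteq> near \<sigma> {t} \<inter> \<Omega> \<and> card (near \<sigma> {t} \<inter> \<Omega>) \<le> vol \<sigma>"
      if "t \<in> Q i" for t
    proof -
      have "card (near \<sigma> {t} \<inter> \<Omega>) \<le> card (near \<sigma> {t})"
        by (rule card_mono) (use finite_near[of "{t}"] Qc[OF i that] in auto)
      then show ?thesis using card_near_le[OF Qc[OF i that], of \<sigma>] by auto
    qed
    show "near \<sigma> {t} \<inter> \<Omega> \<inter> (near \<sigma> {t'} \<inter> \<Omega>) = {}" if tt: "t \<in> Q i" "t' \<in> Q i" "t \<noteq> t'" for t t'
    proof (rule ccontr)
      assume "near \<sigma> {t} \<inter> \<Omega> \<inter> (near \<sigma> {t'} \<inter> \<Omega>) \<noteq> {}"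
      then obtain x where x: "x \<in> carrier G" "wdist t x \<le> \<sigma>" "wdist t' x \<le> \<sigma>" by (auto simp: near_def)
      obtain m m' where m: "m \<in> M" "m' \<in> M" "t = m \<otimes> fst i" "t' = m' \<otimes> fst i"
        using Q(1)[OF i] tt by blast
      then have "2 * \<sigma> < wdist t t'" 
        using sep[of m m'] tt(3) wdist_right[OF subsetD[OF M(2) m(1)] subsetD[OF M(2) m(2)] ic[OF i]]
        by auto
      moreover have "wdist t t' \<le> wdist t x + wdist x t'"
        using Qc[OF i] tt x by (intro wdist_triangle)
      moreover have "wdist x t' = wdist t' x" using Qc[OF i] tt x by (intro wdist_sym)
      ultimately show False using x by linarith
    qed
    let ?J = "{j \<in> I. \<exists>t\<in>Q i. \<exists>t'\<in>Q j. near \<sigma> {t} \<inter> \<Omega> \<inter> (near \<sigma> {t'} \<inter> \<Omega>) \<noteq> {}}"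
    let ?U = "{u \<in> carrier G. len u \<le> 2 * \<sigma>}"
    \<comment> \<open>Overlapping windows at \<open>t = m \<otimes> g\<close> and
      \<open>t' = m' \<otimes> g'\<close> mean \<open>t' = u \<otimes> t\<close> with
      \<open>u\<close> in a fixed ball, so \<open>g'\<close> can be recovered from \<open>m\<close>,
      \<open>m'\<close> and \<open>u\<close>.\<close>
    let ?f = "\<lambda>(m, m', u). inv m' \<otimes> (u \<otimes> (m \<otimes> fst i))"
    have "?J \<subseteq> (?f ` (M \<times> M \<times> ?U)) \<times> {..<c}"
    proof
      fix j assume "j \<in> ?J"
      then obtain t t' x where j: "j \<in> I" and t: "t \<in> Q i" "t' \<in> Q j" and x: "x \<in> near \<sigma> {t}" "x \<in> near \<sigma> {t'}"
        by blast
      obtain m m' where m: "m \<in> M" "m' \<in> M" "t = m \<otimes> fst i" "t' = m' \<otimes> fst j"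
        using Q(1)[OF i] Q(1)[OF j] t by blast
      have tc: "t \<in> carrier G" "t' \<in> carrier G" "x \<in> carrier G" "m' \<in> carrier G"
        using Qc i j t x m M(2) by (auto simp: near_def)
      have "wdist t t' \<le> wdist t x + wdist x t'" by (intro wdist_triangle tc)
      also have "\<dots> \<le> 2 * \<sigma>" using x wdist_sym[of x t'] tc by (auto simp: near_def)
      finally have "t' \<otimes> inv t \<in> ?U" using tc by (simp add: wdist_def)
      moreover have "fst j = ?f (m, m', t' \<otimes> inv t)"
      proof -
        have "t' \<otimes> inv t \<otimes> (m \<otimes> fst i) = t'"
          unfolding m(3)[symmetric] using tc by (simp add: m_assoc)
        moreover have "inv m' \<otimes> t' = fst j"
          unfolding m(4) using tc(4) ic[OF j] by (rule mult_inv_cancel_left(2))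
        ultimately show ?thesis by simp
      qed
      moreover have "(m, m', t' \<otimes> inv t) \<in> M \<times> M \<times> ?U"
        using m(1,2) calculation(1) by blast
      ultimately have "fst j \<in> ?f ` (M \<times> M \<times> ?U)"
        by (intro image_eqI)
      moreover have "snd j \<in> {..<c}" using subsetD[OF I(2) j] by (simp only: mem_Times_iff)
      ultimately show "j \<in> (?f ` (M \<times> M \<times> ?U)) \<times> {..<c}" unfolding mem_Times_iff by (rule conjI)
    qed
    moreover have "finite ((?f ` (M \<times> M \<times> ?U)) \<times> {..<c})"
      using M(1) finite_len by simp
    ultimately have "card ?J \<le> card ((?f ` (M \<times> M \<times> ?U)) \<times> {..<c})" by (rule card_mono[rotated])
    also have "\<dots> = card (?f ` (M \<times> M \<times> ?U)) * c"
      by (simp add: card_cartesian_product)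
    also have "\<dots> \<le> card (M \<times> M \<times> ?U) * c"
      by (intro mult_right_mono card_image_le) (use M(1) finite_len in simp_all)
    also have "\<dots> \<le> n * n * vol (2 * \<sigma>) * c"
      using mult_mono[OF M(3) M(3)] by (simp add: card_cartesian_product vol_def mult.assoc)
    finally show "card ?J \<le> n * n * vol (2 * \<sigma>) * c" .
  qed
  then obtain R where R: "R \<subseteq> \<Omega>"
    "\<forall>i\<in>I. \<exists>t\<in>Q i. R \<inter> (near \<sigma> {t} \<inter> \<Omega>) = a t \<inter> near \<sigma> {t} \<inter> \<Omega>"
    by blast
  have "R \<inter> (near \<sigma> {t} \<inter> \<Omega>) = R \<inter> near \<sigma> {t}" for t
    using R(1) by blast
  with R show ?thesis by auto
qed

end

section \<open>Hitting sets, collars and sets in generic position\<close>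

context proper_length
begin

lemma subset_near: "U \<subseteq> carrier G \<Longrightarrow> U \<subseteq> near r U"
  by (auto simp: near_def intro!: bexI wdist_self[THEN eq_refl, THEN order_trans])

lemma near_near_subset:
  assumes "U \<subseteq> carrier G"
  shows "near r (near s U) \<subseteq> near (r + s) U"
proof
  fix x assume "x \<in> near r (near s U)"
  then obtain y u where xy: "x \<in> carrier G" "y \<in> carrier G" "u \<in> U" "wdist u y \<le> s" "wdist y x \<le> r"
    by (auto simp: near_def)
  then have "wdist u x \<le> wdist u y + wdist y x" using assms by (intro wdist_triangle) auto
  with xy show "x \<in> near (r + s) U" by (force simp: near_def)
qed

text \<open>The translates \<open>M g\<close> are the hyperedges to which the local lemma is applied. The cardinality is
  that of \<open>2 \<rho>\<close> rows of \<open>\<rho>\<close> sites, so that a property holding at one site of each row of \<open>M g\<close> holds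
  at \<open>2 \<rho>\<close> sites.\<close>

definition grid :: "'a set \<Rightarrow> nat \<Rightarrow> nat \<Rightarrow> bool"
  where "grid M \<rho> \<tau> \<longleftrightarrow> M \<subseteq> carrier G \<and> finite M \<and> card M = 2 * \<rho> * \<rho> \<and> 1 < \<rho> \<and>
    (\<forall>m\<in>M. \<forall>m'\<in>M. m \<noteq> m' \<longrightarrow> 2 * \<tau> < wdist m m') \<and>
    4 * (1 - 1 / 2 ^ vol \<tau>) ^ \<rho> \<le> (1::real) \<and>
    4 * (1 - 1 / 2 ^ vol \<tau>) ^ \<rho> * real ((2 * \<rho> * \<rho>) * (2 * \<rho> * \<rho>) * vol (2 * \<tau>) * (2 * \<rho>)) \<le> 1"

lemma finite_translates_meeting:
  assumes "finite M" "M \<subseteq> carrier G" "finite Y"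
  shows "finite {g \<in> carrier G. \<exists>m\<in>M. m \<otimes> g \<in> Y}"
proof (rule finite_subset)
  show "{g \<in> carrier G. \<exists>m\<in>M. m \<otimes> g \<in> Y} \<subseteq> (\<lambda>(m, y). inv m \<otimes> y) ` (M \<times> Y)"
  proof
    fix g assume "g \<in> {g \<in> carrier G. \<exists>m\<in>M. m \<otimes> g \<in> Y}"
    then obtain m where m: "g \<in> carrier G" "m \<in> M" "m \<otimes> g \<in> Y" by blast
    then have "g = inv m \<otimes> (m \<otimes> g)" using assms(2) mult_inv_cancel_left(2)[of m g] by auto
    then show "g \<in> (\<lambda>(m, y). inv m \<otimes> y) ` (M \<times> Y)"
      by (intro image_eqI[of _ _ "(m, m \<otimes> g)"]) (use m in simp_all)
  qed
qed (use assms in simp)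

text \<open>\<open>T\<close> consists of the points of a random \<open>R \<subseteq> Y\<close> that
  are isolated at scale \<open>\<tau>\<close>, which gives the separation. The local lemma, with
  prescribed trace \<open>{t}\<close> on the window of \<open>t\<close>, makes some site isolated in
  each translate that has \<open>\<rho>\<close> candidates in \<open>Y\<close>.\<close>

lemma grid_hitting_set:
  assumes M: "grid M \<rho> \<tau>" and Y: "finite Y" "Y \<subseteq> carrier G"
  shows "\<exists>T\<subseteq>Y. (\<forall>t\<in>T. \<forall>t'\<in>T. t \<noteq> t' \<longrightarrow> \<tau> < wdist t t') \<and>
    (\<forall>g\<in>carrier G. \<rho> \<le> card {m \<in> M. m \<otimes> g \<in> Y} \<longrightarrow> (\<exists>m\<in>M. m \<otimes> g \<in> T))"
proof -
  have Mc: "M \<subseteq> carrier G" and Mf: "finite M" and \<rho>: "1 < \<rho>" using M by (auto simp: grid_def)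
  define I where "I = {g \<in> carrier G. \<rho> \<le> card {m \<in> M. m \<otimes> g \<in> Y}} \<times> {0::nat}"
  define Q where "Q i = (\<lambda>m. m \<otimes> fst i) ` {m \<in> M. m \<otimes> fst i \<in> Y}" for i :: "'a \<times> nat"
  have "\<exists>R\<subseteq>Y. \<forall>i\<in>I. \<exists>t\<in>Q i. R \<inter> near \<tau> {t} = {t} \<inter> near \<tau> {t} \<inter> Y"
  proof (rule local_lemma_sites)
    show "finite M" "M \<subseteq> carrier G" "card M \<le> 2 * \<rho> * \<rho>" "finite Y" using M Y by (auto simp: grid_def)
    show "2 * \<tau> < wdist m m'" if "m \<in> M" "m' \<in> M" "m \<noteq> m'" for m m'
      using M that by (auto simp: grid_def)
    have "{g \<in> carrier G. \<rho> \<le> card {m \<in> M. m \<otimes> g \<in> Y}} \<subseteq> {g \<in> carrier G. \<exists>m\<in>M. m \<otimes> g \<in> Y}"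
    proof clarify
      fix g assume g: "g \<in> carrier G" "\<rho> \<le> card {m \<in> M. m \<otimes> g \<in> Y}"
      then have "card {m \<in> M. m \<otimes> g \<in> Y} \<noteq> 0" using \<rho> by linarith
      then have "{m \<in> M. m \<otimes> g \<in> Y} \<noteq> {}" by (metis card.empty)
      then show "\<exists>m\<in>M. m \<otimes> g \<in> Y" by blast
    qed
    then show "finite I"
      using finite_subset[OF _ finite_translates_meeting[OF Mf Mc Y(1)]] by (simp add: I_def)
    show "I \<subseteq> carrier G \<times> {..<2 * \<rho>}" using \<rho> by (auto simp: I_def)
    fix i assume i: "i \<in> I"
    show "Q i \<subseteq> (\<lambda>m. m \<otimes> fst i) ` M" by (auto simp: Q_def)
    have "fst i \<in> carrier G" using i by (auto simp: I_def)
    then have "inj_on (\<lambda>m. m \<otimes> fst i) {m \<in> M. m \<otimes> fst i \<in> Y}"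
      using Mc by (intro inj_on_subset[OF inj_on_multc]) auto
    then show "\<rho> \<le> card (Q i)" using i by (auto simp: Q_def I_def card_image)
  next
    show "4 * (1 - 1 / 2 ^ vol \<tau>) ^ \<rho> \<le> (1::real)"
      "4 * (1 - 1 / 2 ^ vol \<tau>) ^ \<rho> * real ((2 * \<rho> * \<rho>) * (2 * \<rho> * \<rho>) * vol (2 * \<tau>) * (2 * \<rho>)) \<le> 1"
      using M unfolding grid_def by blast+
  qed
  then obtain R where R: "R \<subseteq> Y" "\<And>i. i \<in> I \<Longrightarrow> \<exists>t\<in>Q i. R \<inter> near \<tau> {t} = {t} \<inter> near \<tau> {t} \<inter> Y"
    by blast
  define T where "T = {t \<in> R. R \<inter> near \<tau> {t} \<subseteq> {t}}"
  have "\<tau> < wdist t t'" if "t \<in> T" "t' \<in> T" "t \<noteq> t'" for t t'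
  proof (rule ccontr)
    assume "\<not> \<tau> < wdist t t'"
    then have "t' \<in> R \<inter> near \<tau> {t}" using that R(1) Y(2) by (auto simp: T_def near_def)
    with that show False by (auto simp: T_def)
  qed
  moreover have "\<exists>m\<in>M. m \<otimes> g \<in> T" if g: "g \<in> carrier G" "\<rho> \<le> card {m \<in> M. m \<otimes> g \<in> Y}" for g
  proof -
    have "(g, 0) \<in> I" using g by (simp add: I_def)
    from R(2)[OF this] obtain t where t: "t \<in> Q (g, 0)" "R \<inter> near \<tau> {t} = {t} \<inter> near \<tau> {t} \<inter> Y"
      by blast
    then obtain m where m: "m \<in> M" "t = m \<otimes> g" "t \<in> Y" by (auto simp: Q_def)
    have "t \<in> near \<tau> {t}" using subset_near[of "{t}"] m(3) Y(2) by blast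
    then have "t \<in> T" using t(2) m(3) by (auto simp: T_def)
    with m show ?thesis by blast
  qed
  ultimately show ?thesis using R(1) by (intro exI[of _ T]) (auto simp: T_def)
qed

text \<open>The boundary of \<open>V\<close> is random: \<open>C\<close> is enlarged by a random
  part of the shell of width \<open>2 * \<tau>\<close>. For each row of each \<open>M g\<close> the
  local lemma yields a site whose window does not see the boundary; \<open>2 * \<rho>\<close> rows
  give \<open>2 * \<rho>\<close> such sites, and therefore at least \<open>\<rho>\<close> inside or
  at least \<open>\<rho>\<close> outside.\<close>

lemma grid_collar:
  assumes M: "grid M \<rho> \<tau>" and C: "finite C" "C \<subseteq> carrier G"
  shows "\<exists>V. C \<subseteq> V \<and> V \<subseteq> near (2 * \<tau>) C \<and> (\<forall>g\<in>carrier G.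
    2 * \<rho> \<le> card {m \<in> M. near \<tau> {m \<otimes> g} \<subseteq> V \<or> near \<tau> {m \<otimes> g} \<inter> V = {}})"
proof -
  have Mc: "M \<subseteq> carrier G" and Mf: "finite M" and \<rho>: "1 < \<rho>" using M by (auto simp: grid_def)
  have "card ({..<2 * \<rho>} \<times> {..<\<rho>}) = card M" using M by (simp add: grid_def card_cartesian_product)
  then obtain h where h: "bij_betw h ({..<2 * \<rho>} \<times> {..<\<rho>}) M"
    using finite_same_card_bij[of "{..<2 * \<rho>} \<times> {..<\<rho>}" M] Mf by blast
  have hM: "h (j, k) \<in> M" if "j < 2 * \<rho>" "k < \<rho>" for j k
    using bij_betw_apply[OF h, of "(j, k)"] that by simp
  have hc: "h (j, k) \<in> carrier G" if "j < 2 * \<rho>" "k < \<rho>" for j k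
    using hM[OF that] Mc by blast
  define \<Omega> where "\<Omega> = near (2 * \<tau>) C - C"
  \<comment> \<open>Windows at sites outside \<open>W\<close> miss the shell, so only the finitely
    many translates that meet \<open>W\<close> call for the local lemma.\<close>
  define W where "W = near \<tau> (near (2 * \<tau>) C)"
  define I where "I = {g \<in> carrier G. \<exists>m\<in>M. m \<otimes> g \<in> W} \<times> {..<2 * \<rho>}"
  define Q where "Q i = (\<lambda>k. h (snd i, k) \<otimes> fst i) ` {..<\<rho>}" for i :: "'a \<times> nat"
  \<comment> \<open>A window meeting \<open>C\<close> lies within \<open>2 * \<tau>\<close> of
    \<open>C\<close> and can be filled completely; any other window can be emptied.\<close>
  define a where "a t = (if near \<tau> {t} \<inter> C \<noteq> {} then \<Omega> else {})" for t
  have Wf: "finite W" unfolding W_def by (intro finite_near near_carrier C)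
  have "\<exists>R\<subseteq>\<Omega>. \<forall>i\<in>I. \<exists>t\<in>Q i. R \<inter> near \<tau> {t} = a t \<inter> near \<tau> {t} \<inter> \<Omega>"
  proof (rule local_lemma_sites)
    show "finite M" "M \<subseteq> carrier G" "card M \<le> 2 * \<rho> * \<rho>" using M by (auto simp: grid_def)
    show "finite \<Omega>" using finite_near[OF C] by (simp add: \<Omega>_def)
    show "2 * \<tau> < wdist m m'" if "m \<in> M" "m' \<in> M" "m \<noteq> m'" for m m'
      using M that by (auto simp: grid_def)
    show "finite I"
      using finite_translates_meeting[OF Mf Mc Wf] by (simp add: I_def)
    show "I \<subseteq> carrier G \<times> {..<2 * \<rho>}" by (auto simp: I_def)
    fix i assume i: "i \<in> I"
    then have j: "snd i < 2 * \<rho>" "fst i \<in> carrier G" by (auto simp: I_def)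
    show "Q i \<subseteq> (\<lambda>m. m \<otimes> fst i) ` M" using hM j by (auto simp: Q_def)
    have "inj_on (\<lambda>k. h (snd i, k) \<otimes> fst i) {..<\<rho>}"
    proof (rule inj_onI)
      fix k l assume kl: "k \<in> {..<\<rho>}" "l \<in> {..<\<rho>}" "h (snd i, k) \<otimes> fst i = h (snd i, l) \<otimes> fst i"
      then have "h (snd i, k) = h (snd i, l)" using hc j by simp
      then have "(snd i, k) = (snd i, l)"
        using kl j by (intro inj_onD[OF bij_betw_imp_inj_on[OF h]]) auto
      then show "k = l" by simp
    qed
    then show "\<rho> \<le> card (Q i)" by (simp add: Q_def card_image)
  next
    show "4 * (1 - 1 / 2 ^ vol \<tau>) ^ \<rho> \<le> (1::real)"
      "4 * (1 - 1 / 2 ^ vol \<tau>) ^ \<rho> * real ((2 * \<rho> * \<rho>) * (2 * \<rho> * \<rho>) * vol (2 * \<tau>) * (2 * \<rho>)) \<le> 1"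
      using M unfolding grid_def by blast+
  qed
  then obtain R where R: "R \<subseteq> \<Omega>" "\<And>i. i \<in> I \<Longrightarrow> \<exists>t\<in>Q i. R \<inter> near \<tau> {t} = a t \<inter> near \<tau> {t} \<inter> \<Omega>"
    by blast
  define V where "V = C \<union> R"
  have VC: "V \<subseteq> near (2 * \<tau>) C"
    using R(1) subset_near[OF C(2)] by (auto simp: V_def \<Omega>_def)
  define deep where "deep t \<longleftrightarrow> near \<tau> {t} \<subseteq> V \<or> near \<tau> {t} \<inter> V = {}" for t
  have ex: "\<exists>k<\<rho>. deep (h (j, k) \<otimes> g)" if g: "g \<in> carrier G" and j: "j < 2 * \<rho>" for g j
  proof (cases "(g, j) \<in> I")
    case True
    from R(2)[OF this] obtain k where k: "k < \<rho>"
      and eq: "R \<inter> near \<tau> {h (j, k) \<otimes> g} = a (h (j, k) \<otimes> g) \<inter> near \<tau> {h (j, k) \<otimes> g} \<inter> \<Omega>"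
      by (auto simp: Q_def)
    define t where "t = h (j, k) \<otimes> g"
    have tc: "t \<in> carrier G" using hc[OF j k] g by (simp add: t_def)
    have "deep t"
    proof (cases "near \<tau> {t} \<inter> C = {}")
      case True
      then have "R \<inter> near \<tau> {t} = {}" using eq by (simp add: a_def t_def)
      with True show ?thesis by (auto simp: deep_def V_def)
    next
      case False
      then obtain c where c: "c \<in> C" "c \<in> carrier G" "wdist t c \<le> \<tau>" by (auto simp: near_def)
      have "near \<tau> {t} \<subseteq> V"
      proof
        fix x assume x: "x \<in> near \<tau> {t}"
        then have xc: "x \<in> carrier G" "wdist t x \<le> \<tau>" by (auto simp: near_def)
        have "wdist c x \<le> wdist c t + wdist t x" using c tc xc by (intro wdist_triangle)
        then have "x \<in> near (2 * \<tau>) C"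
          using c tc xc wdist_sym[of c t] by (force simp: near_def)
        moreover have "x \<in> R" if "x \<in> \<Omega>"
          using eq False x that unfolding t_def[symmetric] a_def by auto
        ultimately show "x \<in> V" by (auto simp: V_def \<Omega>_def)
      qed
      then show ?thesis by (simp add: deep_def)
    qed
    with k show ?thesis by (auto simp: t_def)
  next
    case False
    have k: "0 < \<rho>" using \<rho> by simp
    define t where "t = h (j, 0) \<otimes> g"
    have tc: "t \<in> carrier G" using hc[OF j k] g by (simp add: t_def)
    have "t \<notin> W" using False g j hM[OF j k] by (auto simp: I_def t_def)
    have "near \<tau> {t} \<inter> near (2 * \<tau>) C = {}"
    proof (rule ccontr)
      assume "\<not> ?thesis"
      then obtain x where x: "x \<in> near (2 * \<tau>) C" "x \<in> carrier G" "wdist t x \<le> \<tau>"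
        by (auto simp: near_def)
      then have "t \<in> W" unfolding W_def near_def[of \<tau>] using tc wdist_sym[of t x] by auto
      with \<open>t \<notin> W\<close> show False ..
    qed
    then have "deep t" using VC by (auto simp: deep_def)
    then show ?thesis using k by (auto simp: t_def)
  qed
  have "2 * \<rho> \<le> card {m \<in> M. deep (m \<otimes> g)}" if g: "g \<in> carrier G" for g
  proof -
    obtain k where k: "\<And>j. j < 2 * \<rho> \<Longrightarrow> k j < \<rho> \<and> deep (h (j, k j) \<otimes> g)"
      using ex[OF g] by metis
    have "inj_on (\<lambda>j. h (j, k j)) {..<2 * \<rho>}"
    proof (rule inj_onI)
      fix i j assume ij: "i \<in> {..<2 * \<rho>}" "j \<in> {..<2 * \<rho>}" "h (i, k i) = h (j, k j)"
      then have "(i, k i) = (j, k j)"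
        using k by (intro inj_onD[OF bij_betw_imp_inj_on[OF h]]) auto
      then show "i = j" by simp
    qed
    moreover have "(\<lambda>j. h (j, k j)) ` {..<2 * \<rho>} \<subseteq> {m \<in> M. deep (m \<otimes> g)}"
      using k hM by auto
    ultimately show ?thesis
      using card_inj_on_le[of "\<lambda>j. h (j, k j)" "{..<2 * \<rho>}" "{m \<in> M. deep (m \<otimes> g)}"] Mf by simp
  qed
  then show ?thesis
    using VC by (intro exI[of _ V]) (auto simp: deep_def V_def)
qed

text \<open>Points are added one at a time. Let \<open>S\<close> be the finite set of nontrivial
  \<open>g\<close> for which \<open>M g\<close> already comes within \<open>r\<close> of
  \<open>M\<close>. The new \<open>m\<close> creates no incidence for \<open>g \<in> S\<close>; for
  \<open>g \<notin> S\<close> every incidence involves \<open>m\<close>, leaving \<open>m\<close>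
  itself and, by the separation \<open>2 * r\<close>, at most one \<open>a \<in> M\<close> with
  \<open>a \<otimes> g\<close> near \<open>m\<close>. This is the origin of the bound 2.\<close>

lemma exists_generic_set:
  assumes inf: "infinite (carrier G)" and icc: "icc G"
  shows "\<exists>M. M \<subseteq> carrier G \<and> finite M \<and> card M = n \<and>
    (\<forall>m\<in>M. \<forall>m'\<in>M. m \<noteq> m' \<longrightarrow> 2 * r < wdist m m') \<and>
    (\<forall>g\<in>carrier G. g \<noteq> \<one> \<longrightarrow> card {m \<in> M. \<exists>m'\<in>M. wdist (m \<otimes> g) m' \<le> r} \<le> 2)"
proof (induction n)
  case 0
  show ?case by (intro exI[of _ "{}"]) auto
next
  case (Suc n)
  obtain M where H: "M \<subseteq> carrier G \<and> finite M \<and> card M = n \<and>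
    (\<forall>m\<in>M. \<forall>m'\<in>M. m \<noteq> m' \<longrightarrow> 2 * r < wdist m m') \<and>
    (\<forall>g\<in>carrier G. g \<noteq> \<one> \<longrightarrow> card {m \<in> M. \<exists>m'\<in>M. wdist (m \<otimes> g) m' \<le> r} \<le> 2)"
    using Suc by (rule exE) (rule that)
  note M = conjunct1[OF H] conjunct1[OF conjunct2[OF H]] conjunct1[OF conjunct2[OF conjunct2[OF H]]]
  note H' = conjunct2[OF conjunct2[OF conjunct2[OF H]]]
  note sep = conjunct1[OF H', rule_format] and two = conjunct2[OF H', rule_format]
  have mc: "m \<in> carrier G" if "m \<in> M" for m using M(1) that by blast
  define S where "S = {g \<in> carrier G. g \<noteq> \<one> \<and> (\<exists>a\<in>M. \<exists>b\<in>M. wdist (a \<otimes> g) b \<le> r)}"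
  define \<Lambda> where "\<Lambda> = {x \<in> carrier G. len x \<le> r}"
  \<comment> \<open>The three parts keep \<open>m\<close> at distance more than \<open>2 * r\<close>
    from \<open>M\<close>, keep \<open>m\<close> more than \<open>r\<close> away from
    \<open>M S\<close>, and keep \<open>m \<otimes> g\<close> more than \<open>r\<close> away from
    \<open>M\<close>.\<close>
  define Z where "Z = near (2 * r) M \<union> near r ((\<lambda>(a, g). a \<otimes> g) ` (M \<times> S))
    \<union> (\<lambda>(x, g). x \<otimes> inv g) ` (near r M \<times> S)"
  have "S \<subseteq> {g \<in> carrier G. \<exists>a\<in>M. a \<otimes> g \<in> near r M}"
  proof clarify
    fix g assume "g \<in> S"
    then obtain a b where ab: "g \<in> carrier G" "a \<in> M" "b \<in> M" "wdist (a \<otimes> g) b \<le> r" by (auto simp: S_def)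
    then have "wdist b (a \<otimes> g) \<le> r" using wdist_sym[of b "a \<otimes> g"] mc by simp
    then show "g \<in> carrier G \<and> (\<exists>a\<in>M. a \<otimes> g \<in> near r M)" using ab mc by (auto simp: near_def)
  qed
  then have Sf: "finite S"
    by (rule finite_subset) (intro finite_translates_meeting M finite_near)
  have "\<exists>m\<in>carrier G. m \<notin> Z \<and> (\<forall>g\<in>S. m \<otimes> g \<otimes> inv m \<notin> \<Lambda>)"
  proof (rule conj_in_finite_avoid[OF inf Sf])
    show "S \<subseteq> carrier G" by (auto simp: S_def)
    show "infinite (conjugacy_class G g)" if "g \<in> S" for g
      using that icc by (auto simp: S_def icc_def)
    show "finite \<Lambda>" by (simp add: \<Lambda>_def finite_len)
    have "(\<lambda>(a, g). a \<otimes> g) ` (M \<times> S) \<subseteq> carrier G" using mc by (auto simp: S_def)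
    then show "finite Z"
      unfolding Z_def using M Sf by (intro finite_UnI finite_near finite_imageI finite_cartesian_product)
  qed
  then obtain m where m: "m \<in> carrier G" "m \<notin> Z" "\<And>g. g \<in> S \<Longrightarrow> m \<otimes> g \<otimes> inv m \<notin> \<Lambda>" by blast
  have far: "2 * r < wdist a m" if "a \<in> M" for a
    using m(1,2) that by (force simp: Z_def near_def)
  then have mM: "m \<notin> M" using wdist_self m(1) by fastforce
  have far1: "r < wdist (a \<otimes> g) m" if "a \<in> M" "g \<in> S" for a g
    using m(1,2) that by (force simp: Z_def near_def)
  have far2: "r < wdist (m \<otimes> g) a" if a: "a \<in> M" and g: "g \<in> S" for a g
  proof (rule ccontr)
    have gc: "g \<in> carrier G" using g by (simp add: S_def)
    assume "\<not> r < wdist (m \<otimes> g) a"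
    then have "m \<otimes> g \<in> near r M"
      using a mc[OF a] gc m(1) wdist_sym[of a "m \<otimes> g"]
      by (auto simp: near_def intro!: bexI[of _ a])
    moreover have "m = m \<otimes> g \<otimes> inv g" using gc m(1) by (simp add: m_assoc)
    ultimately have "m \<in> (\<lambda>(x, g). x \<otimes> inv g) ` (near r M \<times> S)"
      using g by (intro image_eqI[of _ _ "(m \<otimes> g, g)"]) auto
    with m(2) show False by (simp add: Z_def)
  qed
  \<comment> \<open>Here the ICC property enters: \<open>wdist m (m \<otimes> g)\<close> is the
    length of the conjugate \<open>m \<otimes> g \<otimes> inv m\<close>, which was chosen outside
    the ball \<open>\<Lambda>\<close>.\<close>
  have far3: "r < wdist (m \<otimes> g) m" if g: "g \<in> S" for g
  proof -
    have gc: "g \<in> carrier G" using g by (simp add: S_def)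
    have "wdist (m \<otimes> g) m = wdist m (m \<otimes> g)" using gc m(1) by (intro wdist_sym) auto
    moreover have "m \<otimes> g \<otimes> inv m \<in> carrier G" using gc m(1) by simp
    ultimately show ?thesis using m(3)[OF g] by (auto simp: \<Lambda>_def wdist_def)
  qed
  let ?M = "insert m M"
  have "2 * r < wdist a b" if "a \<in> ?M" "b \<in> ?M" "a \<noteq> b" for a b
    using that far sep wdist_sym[OF m(1) mc] by auto
  moreover have "card {a \<in> ?M. \<exists>b\<in>?M. wdist (a \<otimes> g) b \<le> r} \<le> 2" if g: "g \<in> carrier G" "g \<noteq> \<one>" for g
  proof (cases "g \<in> S")
    case True
    have "{a \<in> ?M. \<exists>b\<in>?M. wdist (a \<otimes> g) b \<le> r} = {a \<in> M. \<exists>b\<in>M. wdist (a \<otimes> g) b \<le> r}"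
      using far1[OF _ True] far2[OF _ True] far3[OF True] by (auto simp: not_le[symmetric])
    then show ?thesis using two[OF g] by simp
  next
    case False
    define B where "B = {a \<in> M. wdist (a \<otimes> g) m \<le> r}"
    have "a = a'" if aa: "a \<in> B" "a' \<in> B" for a a'
    proof (rule ccontr)
      assume ne: "a \<noteq> a'"
      have c: "a \<in> carrier G" "a' \<in> carrier G" using aa mc by (auto simp: B_def)
      have "wdist a a' = wdist (a \<otimes> g) (a' \<otimes> g)" using wdist_right c g by simp
      also have "\<dots> \<le> wdist (a \<otimes> g) m + wdist m (a' \<otimes> g)" using c g m(1) by (intro wdist_triangle) auto
      also have "\<dots> \<le> 2 * r" using aa wdist_sym[of m "a' \<otimes> g"] c g m(1) by (simp add: B_def)
      finally show False using sep[of a a'] aa ne by (auto simp: B_def)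
    qed
    moreover have Bf: "finite B" using M(2) by (simp add: B_def)
    ultimately have "card B \<le> 1" using card_le_Suc0_iff_eq[OF Bf] by auto
    moreover have "{a \<in> ?M. \<exists>b\<in>?M. wdist (a \<otimes> g) b \<le> r} \<subseteq> insert m B"
      using False g by (auto simp: S_def B_def)
    then have "card {a \<in> ?M. \<exists>b\<in>?M. wdist (a \<otimes> g) b \<le> r} \<le> card (insert m B)"
      by (rule card_mono[rotated]) (simp add: B_def M(2))
    moreover have "card (insert m B) \<le> Suc (card B)"
      using card_insert_if[OF Bf, of m] by simp
    ultimately show ?thesis by linarith
  qed
  ultimately show ?case
    using M m(1) mM by (intro exI[of _ ?M]) auto
qed

end

section \<open>Extendable systems of patches\<close>

context proper_length
begin

definition apart :: "nat \<Rightarrow> ('a \<rightharpoonup> bool) \<Rightarrow> ('a \<rightharpoonup> bool) \<Rightarrow> bool"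
  where "apart w f f' \<longleftrightarrow> (\<forall>a\<in>dom f. \<forall>b\<in>dom f'. w < wdist a b)"

lemma apart_mono: "apart w' f f' \<Longrightarrow> w \<le> w' \<Longrightarrow> apart w f f'"
  unfolding apart_def by (meson le_less_trans)

text \<open>A translation-invariant set of finite legal patches that can be glued as soon as they
  are more than \<open>w\<close> apart, a strong irreducibility condition. With empty
  \<open>F\<close> the last clause provides legal patches on any finite set. The radius
  \<open>\<nu>\<close> controls how far a gluing spills over; the next refinement reserves room
  accordingly.\<close>

definition patch_system :: "('a \<rightharpoonup> bool) set \<Rightarrow> nat \<Rightarrow> nat \<Rightarrow> bool"
  where "patch_system A w \<nu> \<longleftrightarrow>
    (\<forall>q\<in>A. finite (dom q) \<and> dom q \<subseteq> carrier G) \<and>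
    (\<forall>q\<in>A. \<forall>t\<in>carrier G. shift q t \<in> A) \<and>
    (\<forall>F C. finite F \<and> F \<subseteq> A \<and> pairwise (apart w) F \<and> finite C \<and> C \<subseteq> carrier G \<longrightarrow>
      (\<exists>q\<in>A. (\<forall>f\<in>F. f \<subseteq>\<^sub>m q) \<and> C \<subseteq> dom q \<and> dom q \<subseteq> near \<nu> (C \<union> (\<Union>f\<in>F. dom f))))"

lemma patch_systemD:
  assumes "patch_system A w \<nu>"
  shows "\<And>q. q \<in> A \<Longrightarrow> finite (dom q)" "\<And>q. q \<in> A \<Longrightarrow> dom q \<subseteq> carrier G"
    "\<And>q t. q \<in> A \<Longrightarrow> t \<in> carrier G \<Longrightarrow> shift q t \<in> A"
  using assms by (simp_all add: patch_system_def)

lemma patch_system_extend: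
  assumes "patch_system A w \<nu>" "finite F" "F \<subseteq> A" "pairwise (apart w) F"
    "finite C" "C \<subseteq> carrier G"
  obtains q where "q \<in> A" "\<And>f. f \<in> F \<Longrightarrow> f \<subseteq>\<^sub>m q" "C \<subseteq> dom q"
    "dom q \<subseteq> near \<nu> (C \<union> (\<Union>f\<in>F. dom f))"
proof -
  from assms(1) have "finite F \<and> F \<subseteq> A \<and> pairwise (apart w) F \<and> finite C \<and> C \<subseteq> carrier G \<longrightarrow>
      (\<exists>q\<in>A. (\<forall>f\<in>F. f \<subseteq>\<^sub>m q) \<and> C \<subseteq> dom q \<and> dom q \<subseteq> near \<nu> (C \<union> (\<Union>f\<in>F. dom f)))"
    by (simp add: patch_system_def)
  with assms(2-6) show ?thesis using that by auto
qed

text \<open>The full shift is the start of the refinements; \<open>apart 0\<close> makes domains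
  disjoint since a point has distance 0 from itself.\<close>

lemma patch_system_all: "patch_system {q. finite (dom q) \<and> dom q \<subseteq> carrier G} 0 0"
  unfolding patch_system_def
proof (intro conjI allI impI ballI)
  fix q t assume q: "q \<in> {q :: 'a \<rightharpoonup> bool. finite (dom q) \<and> dom q \<subseteq> carrier G}" and t: "t \<in> carrier G"
  then have "dom (shift q t) = (\<lambda>k. k \<otimes> t) ` dom q" by (intro dom_shift) auto
  with q t show "shift q t \<in> {q. finite (dom q) \<and> dom q \<subseteq> carrier G}" by auto
next
  fix F :: "('a \<rightharpoonup> bool) set" and C
  assume H: "finite F \<and> F \<subseteq> {q. finite (dom q) \<and> dom q \<subseteq> carrier G} \<and> pairwise (apart 0) F
    \<and> finite C \<and> C \<subseteq> carrier G"
  have uniq: "f = f'" if "f \<in> F" "f' \<in> F" "x \<in> dom f" "x \<in> dom f'" for f f' x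
  proof (rule ccontr)
    assume "f \<noteq> f'"
    then have "0 < wdist x x" using H that unfolding pairwise_def apart_def by blast
    moreover have "x \<in> carrier G" using H that by blast
    ultimately show False by (simp add: wdist_self)
  qed
  \<comment> \<open>\<open>Some False\<close> is an arbitrary filling of the points of
    \<open>C\<close> that no patch of \<open>F\<close> prescribes.\<close>
  define q where "q x = (if \<exists>f\<in>F. x \<in> dom f then (SOME f. f \<in> F \<and> x \<in> dom f) x
    else if x \<in> C then Some False else None)" for x
  have qF: "q x = f x" if f: "f \<in> F" "x \<in> dom f" for f x
  proof -
    have "(SOME f. f \<in> F \<and> x \<in> dom f) = f"
      by (rule some_equality) (use f uniq in blast)+
    then show ?thesis unfolding q_def using f by auto
  qed
  have dq: "dom q = C \<union> (\<Union>f\<in>F. dom f)"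
  proof (intro equalityI subsetI)
    fix x assume "x \<in> C \<union> (\<Union>f\<in>F. dom f)"
    then show "x \<in> dom q"
    proof (cases "\<exists>f\<in>F. x \<in> dom f")
      case True
      then obtain f where "f \<in> F" "x \<in> dom f" by blast
      then show ?thesis using qF[of f x] by auto
    qed (auto simp: q_def dom_def)
  qed (auto simp: q_def dom_def split: if_splits)
  have sub: "C \<union> (\<Union>f\<in>F. dom f) \<subseteq> carrier G" using H by auto
  have "finite (C \<union> (\<Union>f\<in>F. dom f))" using H by auto
  then have "q \<in> {q. finite (dom q) \<and> dom q \<subseteq> carrier G}" using sub dq by simp
  moreover have "f \<subseteq>\<^sub>m q" if "f \<in> F" for f
    unfolding map_le_def using qF[OF that] by auto
  moreover have "dom q \<subseteq> near 0 (C \<union> (\<Union>f\<in>F. dom f))"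
    unfolding dq by (rule subset_near[OF sub])
  ultimately show "\<exists>q\<in>{q. finite (dom q) \<and> dom q \<subseteq> carrier G}. (\<forall>f\<in>F. f \<subseteq>\<^sub>m q) \<and> C \<subseteq> dom q \<and>
      dom q \<subseteq> near 0 (C \<union> (\<Union>f\<in>F. dom f))"
    using dq by (intro bexI[of _ q]) auto
qed auto

text \<open>The patches all of whose translates \<open>M g\<close> either already contain an occurrence of \<open>p\<close> or
  still have many sites at distance more than \<open>R\<close> from the patch, where an occurrence can be
  created later.\<close>

definition hit_patches :: "('a \<rightharpoonup> bool) set \<Rightarrow> ('a \<rightharpoonup> bool) \<Rightarrow> 'a set \<Rightarrow> nat \<Rightarrow> nat \<Rightarrow> ('a \<rightharpoonup> bool) set"
  where "hit_patches A p M R \<rho> = {q \<in> A. \<forall>g\<in>carrier G. (\<exists>m\<in>M. shift p (m \<otimes> g) \<subseteq>\<^sub>m q) \<or>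
    \<rho> \<le> card {m \<in> M. \<forall>b\<in>dom q. R < wdist (m \<otimes> g) b}}"

lemma wdist_grid_le:
  assumes "M \<subseteq> carrier G" "\<And>m. m \<in> M \<Longrightarrow> len m \<le> \<mu>" "m \<in> M" "m' \<in> M" "g \<in> carrier G"
  shows "wdist (m \<otimes> g) (m' \<otimes> g) \<le> 2 * \<mu>"
proof -
  have c: "m \<in> carrier G" "m' \<in> carrier G" using assms by auto
  then have "wdist (m \<otimes> g) (m' \<otimes> g) = len (m' \<otimes> inv m)"
    using wdist_right[OF c assms(5)] by (simp add: wdist_def)
  also have "\<dots> \<le> len m' + len m" using len_mult[of m' "inv m"] c by (simp add: len_inv)
  also have "\<dots> \<le> 2 * \<mu>" using assms(2)[OF assms(3)] assms(2)[OF assms(4)] by linarith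
  finally show ?thesis .
qed

lemma wdist_dom_shift:
  assumes "dom p \<subseteq> carrier G" "\<And>k. k \<in> dom p \<Longrightarrow> len k \<le> \<kappa>" "t \<in> carrier G" "x \<in> dom (shift p t)"
  shows "x \<in> carrier G" "wdist t x \<le> \<kappa>"
proof -
  obtain k where k: "x = k \<otimes> t" "k \<in> dom p" using dom_shift[OF assms(1,3)] assms(4) by auto
  then have "k \<in> carrier G" using assms(1) by blast
  then show "x \<in> carrier G" "wdist t x \<le> \<kappa>"
    using k assms(2)[of k] wdist_left[of k t] assms(3) by simp_all
qed

lemma shift_hit_patches:
  assumes A: "patch_system A w \<nu>" and p: "dom p \<subseteq> carrier G" and M: "M \<subseteq> carrier G" "finite M"
    and q: "q \<in> hit_patches A p M R \<rho>" and t: "t \<in> carrier G"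
  shows "shift q t \<in> hit_patches A p M R \<rho>"
proof -
  have qA: "q \<in> A" using q by (simp add: hit_patches_def)
  have "(\<exists>m\<in>M. shift p (m \<otimes> g) \<subseteq>\<^sub>m shift q t) \<or>
    \<rho> \<le> card {m \<in> M. \<forall>b\<in>dom (shift q t). R < wdist (m \<otimes> g) b}" if g: "g \<in> carrier G" for g
  proof -
    define g' where "g' = g \<otimes> inv t"
    have g': "g' \<in> carrier G" using g t by (simp add: g'_def)
    have mg: "m \<otimes> g = m \<otimes> g' \<otimes> t" "m \<otimes> g' \<in> carrier G" if "m \<in> M" for m
      using subsetD[OF M(1) that] g t by (simp_all add: g'_def m_assoc)
    from q g' consider m where "m \<in> M" "shift p (m \<otimes> g') \<subseteq>\<^sub>m q"
      | "\<rho> \<le> card {m \<in> M. \<forall>b\<in>dom q. R < wdist (m \<otimes> g') b}"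
      unfolding hit_patches_def by blast
    then show ?thesis
    proof cases
      case 1
      then have "shift p (m \<otimes> g) \<subseteq>\<^sub>m shift q t"
        using shift_mono[OF 1(2), of t] shift_shift[OF mg(2)[OF 1(1)] t, of p] mg(1)[OF 1(1)] by simp
      with 1 show ?thesis by blast
    next
      case 2
      have "{m \<in> M. \<forall>b\<in>dom q. R < wdist (m \<otimes> g') b}
          \<subseteq> {m \<in> M. \<forall>b\<in>dom (shift q t). R < wdist (m \<otimes> g) b}"
      proof clarify
        fix m b assume m: "m \<in> M" "\<forall>b\<in>dom q. R < wdist (m \<otimes> g') b"
        fix y assume b: "shift q t b = Some y"
        then have "b \<in> (\<lambda>k. k \<otimes> t) ` dom q"
          using dom_shift[OF patch_systemD(2)[OF A qA] t] by blast
        then obtain k where k: "b = k \<otimes> t" "k \<in> dom q" by blast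
        then have "k \<in> carrier G" using patch_systemD(2)[OF A qA] by blast
        then have "wdist (m \<otimes> g) b = wdist (m \<otimes> g') k"
          using wdist_right[OF mg(2)[OF m(1)] _ t] mg(1)[OF m(1)] k by simp
        with m k show "R < wdist (m \<otimes> g) b" by simp
      qed
      then have "card {m \<in> M. \<forall>b\<in>dom q. R < wdist (m \<otimes> g') b}
          \<le> card {m \<in> M. \<forall>b\<in>dom (shift q t). R < wdist (m \<otimes> g) b}"
        by (rule card_mono[rotated]) (simp add: M)
      with 2 show ?thesis by linarith
    qed
  qed
  then show ?thesis
    using patch_systemD(3)[OF A qA t] by (simp add: hit_patches_def)
qed

text \<open>The new occurrences of \<open>p\<close> are put at a hitting set inside a collar \<open>V\<close> of the given
  patches. The collar is chosen such that every translate \<open>M g\<close> has many sites deep inside or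
  deep outside \<open>V\<close>; the latter remain available.\<close>

lemma patch_system_hit_patches:
  assumes A: "patch_system A w \<nu>" and p: "p \<in> A" "\<And>k. k \<in> dom p \<Longrightarrow> len k \<le> \<kappa>"
    and R: "R = w + 2 * \<kappa>" and \<tau>: "\<tau> = R + \<nu>" and M: "grid M \<rho> \<tau>" "\<And>m. m \<in> M \<Longrightarrow> len m \<le> \<mu>"
  shows "patch_system (hit_patches A p M R \<rho>) (2 * R + 2 * \<mu>) (R + 2 * \<mu> + \<tau> + \<nu> + 2 * \<tau>)"
proof -
  \<comment> \<open>\<open>R + 2 * \<mu> + \<tau>\<close> catches the windows of all sites of a
    translate \<open>M g\<close> that has a site within \<open>R\<close> of the old patches, because
    \<open>M g\<close> has diameter at most \<open>2 * \<mu>\<close>; \<open>\<nu>\<close> covers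
    the spill-over of the gluing around \<open>C \<union> U\<close>.\<close>
  define a1 where "a1 = R + 2 * \<mu> + \<tau> + \<nu>"
  have Mc: "M \<subseteq> carrier G" and Mf: "finite M" using M by (auto simp: grid_def)
  note fin = patch_systemD(1)[OF A] and dc = patch_systemD(2)[OF A]
  have mg: "m \<otimes> g \<in> carrier G" if "m \<in> M" "g \<in> carrier G" for m g using that Mc by auto
  have ext: "\<exists>q\<in>hit_patches A p M R \<rho>. (\<forall>f\<in>F. f \<subseteq>\<^sub>m q) \<and> C \<subseteq> dom q \<and>
      dom q \<subseteq> near (a1 + 2 * \<tau>) (C \<union> (\<Union>f\<in>F. dom f))"
    if F: "finite F" "F \<subseteq> hit_patches A p M R \<rho>" "pairwise (apart (2 * R + 2 * \<mu>)) F"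
      and C: "finite C" "C \<subseteq> carrier G" for F C
  proof -
    define U where "U = (\<Union>f\<in>F. dom f)"
    have FA: "F \<subseteq> A" using F(2) by (auto simp: hit_patches_def)
    have Fd: "finite (dom f)" "dom f \<subseteq> carrier G" if "f \<in> F" for f
      using fin dc subsetD[OF FA that] by simp_all
    have U: "finite U" "U \<subseteq> carrier G"
      unfolding U_def using F(1) Fd(1) by simp (use Fd(2) in \<open>rule UN_least\<close>)
    define C1 where "C1 = near a1 (C \<union> U)"
    have CU: "finite (C \<union> U)" "C \<union> U \<subseteq> carrier G" using C U by auto
    have C1: "finite C1" "C1 \<subseteq> carrier G"
      unfolding C1_def using finite_near[OF CU] near_carrier by auto
    obtain V where V: "C1 \<subseteq> V" "V \<subseteq> near (2 * \<tau>) C1" and deep: "\<And>g. g \<in> carrier G \<Longrightarrow>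
        2 * \<rho> \<le> card {m \<in> M. near \<tau> {m \<otimes> g} \<subseteq> V \<or> near \<tau> {m \<otimes> g} \<inter> V = {}}"
      using grid_collar[OF M(1) C1] by blast
    have Vf: "finite V" "V \<subseteq> carrier G"
      using V(2) finite_near[OF C1] near_carrier finite_subset by blast+
    \<comment> \<open>Admissible places for new occurrences: far from the old patches, and with a
      window of radius \<open>\<tau> = R + \<nu>\<close> inside \<open>V\<close>, which holds the
      occurrence together with the spill-over of the gluing. The glued patch then stays inside
      \<open>V\<close>.\<close>
    define Y where "Y = {t \<in> carrier G. near \<tau> {t} \<subseteq> V \<and> (\<forall>b\<in>U. R < wdist t b)}"
    have Yc: "Y \<subseteq> carrier G" by (auto simp: Y_def)
    have "Y \<subseteq> V" using subset_near[of "{t}" \<tau> for t] by (auto simp: Y_def)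
    then have Yf: "finite Y" using Vf finite_subset by blast
    obtain T where T: "T \<subseteq> Y" "\<And>t t'. t \<in> T \<Longrightarrow> t' \<in> T \<Longrightarrow> t \<noteq> t' \<Longrightarrow> \<tau> < wdist t t'"
      and hit: "\<And>g. g \<in> carrier G \<Longrightarrow> \<rho> \<le> card {m \<in> M. m \<otimes> g \<in> Y} \<Longrightarrow> \<exists>m\<in>M. m \<otimes> g \<in> T"
      using grid_hitting_set[OF M(1) Yf Yc] by blast
    have Tc: "t \<in> carrier G" if "t \<in> T" for t using that T(1) Yc by blast
    note ds = wdist_dom_shift[OF dc[OF p(1)] p(2)]
    define F' where "F' = F \<union> shift p ` T"
    have F'1: "apart w f (shift p t)" "apart w (shift p t) f" if f: "f \<in> F" and t: "t \<in> T" for f t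
    proof -
      have "w < wdist a b" if a: "a \<in> dom (shift p t)" and b: "b \<in> dom f" for a b
      proof -
        have ac: "a \<in> carrier G" "wdist t a \<le> \<kappa>" using ds[OF _ Tc[OF t] a] by auto
        have bU: "b \<in> U" "b \<in> carrier G" using b f U by (auto simp: U_def)
        have "R < wdist t b" using t T(1) bU by (auto simp: Y_def)
        also have "wdist t b \<le> wdist t a + wdist a b" using Tc[OF t] ac bU by (intro wdist_triangle)
        finally show ?thesis using ac R by linarith
      qed
      moreover have "wdist a b = wdist b a" if "a \<in> dom (shift p t)" "b \<in> dom f" for a b
        using ds(1)[OF _ Tc[OF t] that(1)] subsetD[OF Fd(2)[OF f] that(2)] by (intro wdist_sym) auto
      ultimately show "apart w f (shift p t)" "apart w (shift p t) f"
        unfolding apart_def by metis+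
    qed
    have F'2: "apart w (shift p t) (shift p t')" if t: "t \<in> T" "t' \<in> T" "t \<noteq> t'" for t t'
      unfolding apart_def
    proof (intro ballI)
      fix a b assume a: "a \<in> dom (shift p t)" and b: "b \<in> dom (shift p t')"
      have ac: "a \<in> carrier G" "wdist t a \<le> \<kappa>" using ds[OF _ Tc[OF t(1)] a] by auto
      have bc: "b \<in> carrier G" "wdist t' b \<le> \<kappa>" using ds[OF _ Tc[OF t(2)] b] by auto
      have "\<tau> < wdist t t'" using T(2) t by blast
      also have "wdist t t' \<le> wdist t a + wdist a t'" using Tc t ac by (intro wdist_triangle) auto
      also have "wdist a t' \<le> wdist a b + wdist b t'" using Tc t ac bc by (intro wdist_triangle) auto
      also have "wdist b t' = wdist t' b" using Tc t bc by (intro wdist_sym) auto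
      finally show "w < wdist a b" using ac bc R \<tau> by linarith
    qed
    have "pairwise (apart w) F'"
      unfolding pairwise_def
    proof (intro ballI impI)
      fix f f' assume ff: "f \<in> F'" "f' \<in> F'" "f \<noteq> f'"
      consider "f \<in> F" "f' \<in> F" | t where "f \<in> F" "t \<in> T" "f' = shift p t"
        | t where "t \<in> T" "f = shift p t" "f' \<in> F"
        | t t' where "t \<in> T" "f = shift p t" "t' \<in> T" "f' = shift p t'"
        using ff unfolding F'_def by blast
      then show "apart w f f'"
      proof cases
        case 1
        then have "apart (2 * R + 2 * \<mu>) f f'" using F(3) ff by (auto simp: pairwise_def)
        moreover have "w \<le> 2 * R + 2 * \<mu>" using R by simp
        ultimately show ?thesis by (rule apart_mono)
      next
        case 4
        then have "t \<noteq> t'" using ff by blast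
        with 4 show ?thesis using F'2 by blast
      qed (use F'1 in blast)+
    qed
    moreover have "finite F'" using F(1) finite_subset[OF T(1) Yf] by (simp add: F'_def)
    moreover have "F' \<subseteq> A" using FA patch_systemD(3)[OF A p(1)] Tc by (auto simp: F'_def)
    ultimately obtain q where q: "q \<in> A" "\<And>f. f \<in> F' \<Longrightarrow> f \<subseteq>\<^sub>m q" "C \<subseteq> dom q"
      "dom q \<subseteq> near \<nu> (C \<union> (\<Union>f\<in>F'. dom f))"
      using patch_system_extend[OF A _ _ _ C] by metis
    have qV: "dom q \<subseteq> V"
    proof
      fix b assume "b \<in> dom q"
      then have "b \<in> near \<nu> (C \<union> (\<Union>f\<in>F'. dom f))" using q(4) by (rule subsetD[rotated])
      then obtain c where b: "b \<in> carrier G" and c: "c \<in> C \<union> (\<Union>f\<in>F'. dom f)" "wdist c b \<le> \<nu>"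
        unfolding near_def by blast
      show "b \<in> V"
      proof (cases "c \<in> C \<union> U")
        case True
        then have "b \<in> C1" using b c unfolding C1_def near_def a1_def by (auto intro!: bexI[of _ c])
        then show ?thesis using V(1) by blast
      next
        case False
        then obtain t where t: "t \<in> T" "c \<in> dom (shift p t)" using c by (auto simp: F'_def U_def)
        have cc: "c \<in> carrier G" "wdist t c \<le> \<kappa>" using ds[OF _ Tc[OF t(1)] t(2)] by auto
        have "wdist t b \<le> wdist t c + wdist c b" using Tc t cc b by (intro wdist_triangle) auto
        then have "b \<in> near \<tau> {t}" using cc c b R \<tau> by (auto simp: near_def)
        then show ?thesis using t T(1) by (auto simp: Y_def)
      qed
    qed
    \<comment> \<open>Three kinds of translates: those that an old patch already serves, those with
      a site within \<open>R\<close> of an old patch, and those far from all old patches.\<close>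
    have "(\<exists>m\<in>M. shift p (m \<otimes> g) \<subseteq>\<^sub>m q) \<or> \<rho> \<le> card {m \<in> M. \<forall>b\<in>dom q. R < wdist (m \<otimes> g) b}"
      if g: "g \<in> carrier G" for g
    proof (cases "\<exists>f\<in>F. \<exists>m\<in>M. shift p (m \<otimes> g) \<subseteq>\<^sub>m f")
      case True
      then obtain f m where "f \<in> F" "m \<in> M" "shift p (m \<otimes> g) \<subseteq>\<^sub>m f" by blast
      moreover from this have "f \<subseteq>\<^sub>m q" using q(2) by (simp add: F'_def)
      ultimately show ?thesis by (meson map_le_trans)
    next
      case unhit: False
      have placed: ?thesis if Yg: "\<rho> \<le> card {m \<in> M. m \<otimes> g \<in> Y}"
      proof -
        obtain m where "m \<in> M" "m \<otimes> g \<in> T" using hit[OF g Yg] by blast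
        then show ?thesis using q(2) by (auto simp: F'_def)
      qed
      show ?thesis
      proof (cases "\<exists>m\<in>M. \<exists>b\<in>U. wdist (m \<otimes> g) b \<le> R")
        case True
        then obtain m0 b0 f0 where m0: "m0 \<in> M" "f0 \<in> F" "b0 \<in> dom f0" "wdist (m0 \<otimes> g) b0 \<le> R"
          by (auto simp: U_def)
        have b0: "b0 \<in> U" "b0 \<in> carrier G" using m0 U by (auto simp: U_def)
        have b0m: "wdist b0 (m \<otimes> g) \<le> R + 2 * \<mu>" if m: "m \<in> M" for m
        proof -
          have "wdist b0 (m \<otimes> g) \<le> wdist b0 (m0 \<otimes> g) + wdist (m0 \<otimes> g) (m \<otimes> g)"
            using b0 mg m m0 g by (intro wdist_triangle) auto
          also have "wdist b0 (m0 \<otimes> g) = wdist (m0 \<otimes> g) b0" using b0 mg m0 g by (intro wdist_sym) auto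
          finally show ?thesis using wdist_grid_le[OF Mc M(2) m0(1) m g] m0 by linarith
        qed
        \<comment> \<open>Old patches are more than \<open>2 * R + 2 * \<mu>\<close> apart, so
          \<open>M g\<close> comes within \<open>R\<close> of \<open>f0\<close> alone. The sites
          that the legal patch \<open>f0\<close> leaves free are hence free for all of
          \<open>F\<close>, and \<open>C1\<close> was taken large enough to contain their
          windows.\<close>
        have "{m \<in> M. \<forall>b\<in>dom f0. R < wdist (m \<otimes> g) b} \<subseteq> {m \<in> M. m \<otimes> g \<in> Y}"
        proof clarify
          fix m assume m: "m \<in> M" "\<forall>b\<in>dom f0. R < wdist (m \<otimes> g) b"
          have "R < wdist (m \<otimes> g) b" if b: "b \<in> U" for b
          proof (rule ccontr)
            assume nb: "\<not> R < wdist (m \<otimes> g) b"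
            obtain f where f: "f \<in> F" "b \<in> dom f" using b by (auto simp: U_def)
            have bc: "b \<in> carrier G" using b U by blast
            have "wdist b0 b \<le> wdist b0 (m \<otimes> g) + wdist (m \<otimes> g) b"
              using b0 bc mg m g by (intro wdist_triangle) auto
            then have le: "wdist b0 b \<le> 2 * R + 2 * \<mu>" using b0m[OF m(1)] nb by linarith
            have "f = f0"
            proof (rule ccontr)
              assume "f \<noteq> f0"
              then have "apart (2 * R + 2 * \<mu>) f0 f" using F(3) f m0 by (auto simp: pairwise_def)
              then show False using le f m0 unfolding apart_def by (meson leD)
            qed
            with m(2) f nb show False by blast
          qed
          moreover have "near \<tau> {m \<otimes> g} \<subseteq> V"
          proof
            fix x assume "x \<in> near \<tau> {m \<otimes> g}"
            then have x: "x \<in> carrier G" "wdist (m \<otimes> g) x \<le> \<tau>" by (auto simp: near_def)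
            have "wdist b0 x \<le> wdist b0 (m \<otimes> g) + wdist (m \<otimes> g) x"
              using b0 x mg m g by (intro wdist_triangle) auto
            then have "wdist b0 x \<le> a1" using b0m[OF m(1)] x by (simp add: a1_def)
            then have "x \<in> C1" using b0 x unfolding C1_def near_def by auto
            then show "x \<in> V" using V(1) by blast
          qed
          ultimately show "m \<otimes> g \<in> Y" using mg[OF m(1) g] by (simp add: Y_def)
        qed
        then have "card {m \<in> M. \<forall>b\<in>dom f0. R < wdist (m \<otimes> g) b} \<le> card {m \<in> M. m \<otimes> g \<in> Y}"
          by (rule card_mono[rotated]) (simp add: Mf)
        moreover have "\<rho> \<le> card {m \<in> M. \<forall>b\<in>dom f0. R < wdist (m \<otimes> g) b}"
        proof -
          have "f0 \<in> hit_patches A p M R \<rho>" using F(2) m0 by blast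
          then show ?thesis using g unhit m0(2) unfolding hit_patches_def by blast
        qed
        ultimately show ?thesis by (intro placed) linarith
      next
        case far: False
        \<comment> \<open>Of the \<open>2 * \<rho>\<close> deep sites at least \<open>\<rho>\<close>
          are inside \<open>V\<close>, where an occurrence is placed now, or at least
          \<open>\<rho>\<close> are outside, where the room is kept for later.\<close>
        define In where "In = {m \<in> M. near \<tau> {m \<otimes> g} \<subseteq> V}"
        define Out where "Out = {m \<in> M. near \<tau> {m \<otimes> g} \<inter> V = {}}"
        have "{m \<in> M. near \<tau> {m \<otimes> g} \<subseteq> V \<or> near \<tau> {m \<otimes> g} \<inter> V = {}} = In \<union> Out"
          by (auto simp: In_def Out_def)
        then have "2 * \<rho> \<le> card In + card Out" using deep[OF g] card_Un_le[of In Out] by simp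
        then consider "\<rho> \<le> card In" | "\<rho> \<le> card Out" by linarith
        then show ?thesis
        proof cases
          case 1
          have "In \<subseteq> {m \<in> M. m \<otimes> g \<in> Y}" using far mg g by (auto simp: In_def Y_def not_le)
          then have "card In \<le> card {m \<in> M. m \<otimes> g \<in> Y}" by (rule card_mono[rotated]) (simp add: Mf)
          with 1 show ?thesis by (intro placed) linarith
        next
          case 2
          have "Out \<subseteq> {m \<in> M. \<forall>b\<in>dom q. R < wdist (m \<otimes> g) b}"
          proof (intro subsetI CollectI conjI ballI)
            fix m b assume m: "m \<in> Out" and b: "b \<in> dom q"
            have "b \<in> V" using b qV by blast
            then have "b \<notin> near \<tau> {m \<otimes> g}" "b \<in> carrier G" using m Vf by (auto simp: Out_def)
            then have "\<tau> < wdist (m \<otimes> g) b" by (auto simp: near_def)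
            then show "R < wdist (m \<otimes> g) b" using \<tau> by linarith
          qed (simp add: Out_def)
          then have "card Out \<le> card {m \<in> M. \<forall>b\<in>dom q. R < wdist (m \<otimes> g) b}"
            by (rule card_mono[rotated]) (simp add: Mf)
          with 2 show ?thesis by linarith
        qed
      qed
    qed
    then have "q \<in> hit_patches A p M R \<rho>" using q(1) by (simp add: hit_patches_def)
    moreover have "dom q \<subseteq> near (a1 + 2 * \<tau>) (C \<union> U)"
    proof -
      have "near (2 * \<tau>) C1 \<subseteq> near (2 * \<tau> + a1) (C \<union> U)"
        unfolding C1_def by (rule near_near_subset[OF CU(2)])
      then show ?thesis using qV V(2) by (auto simp: add.commute)
    qed
    ultimately show ?thesis
      using q(2,3) by (intro bexI[of _ q]) (auto simp: F'_def U_def)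
  qed
  show ?thesis
    unfolding patch_system_def
  proof (intro conjI allI impI ballI)
    fix q assume "q \<in> hit_patches A p M R \<rho>"
    then show "finite (dom q)" "dom q \<subseteq> carrier G" using fin dc by (auto simp: hit_patches_def)
  next
    fix q t assume "q \<in> hit_patches A p M R \<rho>" "t \<in> carrier G"
    then show "shift q t \<in> hit_patches A p M R \<rho>"
      by (intro shift_hit_patches[OF A dc[OF p(1)] Mc Mf])
  next
    fix F C assume "finite F \<and> F \<subseteq> hit_patches A p M R \<rho> \<and> pairwise (apart (2 * R + 2 * \<mu>)) F \<and>
      finite C \<and> C \<subseteq> carrier G"
    then show "\<exists>q\<in>hit_patches A p M R \<rho>. (\<forall>f\<in>F. f \<subseteq>\<^sub>m q) \<and> C \<subseteq> dom q \<and>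
        dom q \<subseteq> near (R + 2 * \<mu> + \<tau> + \<nu> + 2 * \<tau>) (C \<union> (\<Union>f\<in>F. dom f))"
      using ext[of F C] unfolding a1_def by blast
  qed
qed

end

section \<open>Recurrent patterns and the proximal refinement\<close>

context proper_length
begin

text \<open>The order of the choices matters: \<open>\<tau>\<close> depends only on \<open>p\<close>
  and the given system, \<open>\<rho>\<close> on \<open>\<tau>\<close>, and \<open>M\<close> on
  both. \<open>P\<close> carries \<open>p\<close> at all sites of \<open>M\<close> and is legal: the
  translate at \<open>\<one>\<close> is served, and any other \<open>M g\<close> has at most two
  sites near \<open>M\<close>, so that \<open>2 * \<rho> * \<rho> - 2 \<ge> \<rho>\<close> of its
  sites are far from \<open>P\<close>. A patch that covers all candidate occurrences along
  \<open>M g\<close> leaves no site free there, which forces \<open>p\<close> to occur.\<close>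

lemma exists_hit_patches:
  assumes inf: "infinite (carrier G)" and icc: "icc G"
    and A: "patch_system A w \<nu>" and p: "p \<in> A" "dom p \<noteq> {}"
  obtains M A' w' \<nu>' P where "finite M" "M \<subseteq> carrier G" "A' \<subseteq> A" "patch_system A' w' \<nu>'"
    "P \<in> A'" "\<And>m. m \<in> M \<Longrightarrow> shift p m \<subseteq>\<^sub>m P"
    "\<And>q g. q \<in> A' \<Longrightarrow> g \<in> carrier G \<Longrightarrow> (\<And>m. m \<in> M \<Longrightarrow> dom (shift p (m \<otimes> g)) \<subseteq> dom q) \<Longrightarrow>
      \<exists>m\<in>M. shift p (m \<otimes> g) \<subseteq>\<^sub>m q"
proof -
  note dp = patch_systemD(2)[OF A p(1)]
  define \<kappa> where "\<kappa> = Max (len ` dom p)"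
  have \<kappa>: "len k \<le> \<kappa>" if "k \<in> dom p" for k
    unfolding \<kappa>_def using that patch_systemD(1)[OF A p(1)] by (intro Max_ge) auto
  define R where "R = w + 2 * \<kappa>"
  define \<tau> where "\<tau> = R + \<nu>"
  \<comment> \<open>A site farther than \<open>r\<close> from \<open>M\<close> is farther than
    \<open>R\<close> from \<open>P\<close>, whose domain lies within \<open>\<kappa> + \<nu>\<close>
    of \<open>M\<close>; the summand \<open>\<tau>\<close> yields the separation required by
    \<open>grid\<close>.\<close>
  define r where "r = R + \<nu> + \<kappa> + \<tau>"
  \<comment> \<open>The degree \<open>(2 * \<rho> * \<rho>) * (2 * \<rho> * \<rho>) * vol (2 *
    \<tau>) * (2 * \<rho>)\<close> equals \<open>8 * vol (2 * \<tau>) * \<rho> ^ 5\<close>, whence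
    the exponent 5.\<close>
  obtain \<rho> where \<rho>: "1 < \<rho>" "4 * (1 - 1 / 2 ^ vol \<tau>) ^ \<rho> \<le> (1::real)"
    "4 * (1 - 1 / 2 ^ vol \<tau>) ^ \<rho> * real (8 * vol (2 * \<tau>) * \<rho> ^ 5) \<le> 1"
    using local_lemma_parameter[of 5 "vol \<tau>" "8 * vol (2 * \<tau>)"] by auto
  obtain M where M: "M \<subseteq> carrier G" "finite M" "card M = 2 * \<rho> * \<rho>"
    and sep: "\<And>m m'. m \<in> M \<Longrightarrow> m' \<in> M \<Longrightarrow> m \<noteq> m' \<Longrightarrow> 2 * r < wdist m m'"
    and two: "\<And>g. g \<in> carrier G \<Longrightarrow> g \<noteq> \<one> \<Longrightarrow> card {m \<in> M. \<exists>m'\<in>M. wdist (m \<otimes> g) m' \<le> r} \<le> 2"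
    using exists_generic_set[OF inf icc, of "2 * \<rho> * \<rho>" r] by blast
  have mc: "m \<in> carrier G" if "m \<in> M" for m using M(1) that by blast
  have Mne: "M \<noteq> {}" using M(3) \<rho>(1) by auto
  have eq: "(2 * \<rho> * \<rho>) * (2 * \<rho> * \<rho>) * vol (2 * \<tau>) * (2 * \<rho>) = 8 * vol (2 * \<tau>) * \<rho> ^ 5"
  proof -
    have "\<rho> ^ 5 = \<rho> * \<rho> * \<rho> * \<rho> * \<rho>" by (simp add: eval_nat_numeral)
    then show ?thesis by simp
  qed
  have "2 * \<tau> < wdist m m'" if "m \<in> M" "m' \<in> M" "m \<noteq> m'" for m m'
    using sep[OF that] by (simp add: r_def)
  then have grid: "grid M \<rho> \<tau>"
    unfolding grid_def eq using M \<rho> by blast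
  define \<mu> where "\<mu> = Max (len ` M)"
  have \<mu>: "len m \<le> \<mu>" if "m \<in> M" for m
    unfolding \<mu>_def using that M by (intro Max_ge) auto
  define A' where "A' = hit_patches A p M R \<rho>"
  have A': "patch_system A' (2 * R + 2 * \<mu>) (R + 2 * \<mu> + \<tau> + \<nu> + 2 * \<tau>)"
    unfolding A'_def by (rule patch_system_hit_patches[OF A p(1) \<kappa> R_def \<tau>_def grid \<mu>])
  note ds = wdist_dom_shift[OF dp \<kappa>]
  have hits: "\<exists>m\<in>M. shift p (m \<otimes> g) \<subseteq>\<^sub>m q"
    if q: "q \<in> A'" and g: "g \<in> carrier G" and d: "\<And>m. m \<in> M \<Longrightarrow> dom (shift p (m \<otimes> g)) \<subseteq> dom q" for q g
  proof (rule ccontr)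
    assume "\<not> ?thesis"
    then have "\<rho> \<le> card {m \<in> M. \<forall>b\<in>dom q. R < wdist (m \<otimes> g) b}"
      using q g unfolding A'_def hit_patches_def by blast
    then have "card {m \<in> M. \<forall>b\<in>dom q. R < wdist (m \<otimes> g) b} \<noteq> 0" using \<rho> by linarith
    then have "{m \<in> M. \<forall>b\<in>dom q. R < wdist (m \<otimes> g) b} \<noteq> {}" by (metis card.empty)
    then obtain m where m: "m \<in> M" "\<forall>b\<in>dom q. R < wdist (m \<otimes> g) b" by blast
    obtain k where k: "k \<in> dom p" using p(2) by blast
    have mg: "m \<otimes> g \<in> carrier G" using mc[OF m(1)] g by simp
    have b: "k \<otimes> (m \<otimes> g) \<in> dom (shift p (m \<otimes> g))" unfolding dom_shift[OF dp mg] using k by blast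
    then have "R < wdist (m \<otimes> g) (k \<otimes> (m \<otimes> g))" using m d by blast
    moreover have "wdist (m \<otimes> g) (k \<otimes> (m \<otimes> g)) \<le> \<kappa>" by (rule ds(2)[OF _ mg b])
    ultimately show False by (simp add: R_def)
  qed
  have "pairwise (apart w) (shift p ` M)"
    unfolding pairwise_def
  proof (intro ballI impI)
    fix f f' assume "f \<in> shift p ` M" "f' \<in> shift p ` M" "f \<noteq> f'"
    then obtain m m' where m: "m \<in> M" "m' \<in> M" "f = shift p m" "f' = shift p m'" "m \<noteq> m'" by blast
    show "apart w f f'"
      unfolding apart_def
    proof (intro ballI)
      fix a b assume a: "a \<in> dom f" and b: "b \<in> dom f'"
      have ac: "a \<in> carrier G" "wdist m a \<le> \<kappa>" using ds[OF _ mc[OF m(1)]] a m(3) by auto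
      have bc: "b \<in> carrier G" "wdist m' b \<le> \<kappa>" using ds[OF _ mc[OF m(2)]] b m(4) by auto
      have "2 * r < wdist m m'" using sep m by blast
      moreover have "wdist m m' \<le> wdist m a + wdist a m'" using mc m ac by (intro wdist_triangle) auto
      moreover have "wdist a m' \<le> wdist a b + wdist b m'" using mc m ac bc by (intro wdist_triangle) auto
      moreover have "wdist b m' = wdist m' b" using mc m bc by (intro wdist_sym) auto
      moreover have "w + 2 * \<kappa> \<le> r" by (simp add: r_def R_def)
      ultimately show "w < wdist a b" using ac(2) bc(2) by linarith
    qed
  qed
  moreover have "shift p ` M \<subseteq> A" using patch_systemD(3)[OF A p(1)] mc by blast
  ultimately obtain P where P: "P \<in> A" "\<And>f. f \<in> shift p ` M \<Longrightarrow> f \<subseteq>\<^sub>m P"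
    "dom P \<subseteq> near \<nu> ({} \<union> (\<Union>f\<in>shift p ` M. dom f))"
    using patch_system_extend[OF A, of "shift p ` M" "{}"] M(2) by auto
  have "(\<exists>m\<in>M. shift p (m \<otimes> g) \<subseteq>\<^sub>m P) \<or> \<rho> \<le> card {m \<in> M. \<forall>b\<in>dom P. R < wdist (m \<otimes> g) b}"
    if g: "g \<in> carrier G" for g
  proof (cases "g = \<one>")
    case True
    obtain m where "m \<in> M" using Mne by blast
    then show ?thesis using P(2) True mc by auto
  next
    case False
    let ?B = "{m \<in> M. \<exists>m'\<in>M. wdist (m \<otimes> g) m' \<le> r}"
    have "M - ?B \<subseteq> {m \<in> M. \<forall>b\<in>dom P. R < wdist (m \<otimes> g) b}"
    proof (intro subsetI CollectI conjI ballI)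
      fix m b assume m: "m \<in> M - ?B" and b: "b \<in> dom P"
      have "b \<in> near \<nu> ({} \<union> (\<Union>f\<in>shift p ` M. dom f))" using b P(3) by blast
      then obtain m' c where c: "b \<in> carrier G" "m' \<in> M" "c \<in> dom (shift p m')" "wdist c b \<le> \<nu>"
        by (auto simp: near_def)
      have cc: "c \<in> carrier G" "wdist m' c \<le> \<kappa>" using ds[OF _ mc[OF c(2)] c(3)] by auto
      have mm: "m \<in> M" "m \<otimes> g \<in> carrier G" using m mc g by auto
      have "r < wdist (m \<otimes> g) m'" using m c(2) by (auto simp: not_le)
      moreover have "wdist (m \<otimes> g) m' \<le> wdist (m \<otimes> g) b + wdist b m'"
        using mm c mc by (intro wdist_triangle) auto
      moreover have "wdist b m' \<le> wdist b c + wdist c m'" using cc c mc by (intro wdist_triangle) auto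
      moreover have "wdist b c = wdist c b" using cc c by (intro wdist_sym) auto
      moreover have "wdist c m' = wdist m' c" using cc c mc by (intro wdist_sym) auto
      moreover have "R + \<nu> + \<kappa> \<le> r" by (simp add: r_def)
      ultimately show "R < wdist (m \<otimes> g) b" using cc(2) c(4) by linarith
    qed simp
    then have "card (M - ?B) \<le> card {m \<in> M. \<forall>b\<in>dom P. R < wdist (m \<otimes> g) b}"
      by (rule card_mono[rotated]) (simp add: M)
    moreover have "card M - card ?B \<le> card (M - ?B)"
      by (rule diff_card_le_card_Diff) (simp add: M)
    moreover have "2 * \<rho> \<le> \<rho> * \<rho>" using \<rho>(1) by simp
    ultimately show ?thesis using two[OF g False] M(3) \<rho>(1) by linarith
  qed
  then have "P \<in> A'" using P(1) by (simp add: A'_def hit_patches_def)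
  moreover have "A' \<subseteq> A" by (auto simp: A'_def hit_patches_def)
  ultimately show ?thesis using that[OF M(2,1) _ A' _ _ hits] P(2) by blast
qed

text \<open>A condition on the total configuration \<open>x\<close> that looks only at the window
  \<open>C\<close>; the witnessing patch may be larger than \<open>C\<close> and need not agree with
  \<open>x\<close> beyond it.\<close>

definition accepted :: "('a \<rightharpoonup> bool) set \<Rightarrow> 'a set \<Rightarrow> ('a \<Rightarrow> bool) \<Rightarrow> bool"
  where "accepted A C x \<longleftrightarrow> (\<exists>q\<in>A. C \<subseteq> dom q \<and> (\<forall>c\<in>C. q c = Some (x c)))"

lemma accepted_mono: "accepted A' C' x \<Longrightarrow> A' \<subseteq> A \<Longrightarrow> C \<subseteq> C' \<Longrightarrow> accepted A C x"
  unfolding accepted_def by blast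

lemma map_le_accepted:
  assumes "p \<subseteq>\<^sub>m q" "dom p \<subseteq> C" "\<forall>c\<in>C. q c = Some (x c)" "b \<in> dom p"
  shows "p b = Some (x b)"
  using assms by (metis map_le_def subsetD)

text \<open>\<open>A1\<close> is the round for \<open>p\<close>, \<open>A2\<close> the round for
  \<open>P\<close>. Of the two points, \<open>x\<close> is searched for \<open>P\<close>, and
  \<open>y\<close> for \<open>p\<close> along the copy of \<open>P\<close> found in
  \<open>x\<close>.\<close>

lemma exists_proximal_refinement:
  assumes inf: "infinite (carrier G)" and icc: "icc G"
    and A: "patch_system A w \<nu>" and C: "finite C" "C \<subseteq> carrier G"
  shows "\<exists>A' w' \<nu>' D. patch_system A' w' \<nu>' \<and> A' \<subseteq> A \<and> finite D \<and> D \<subseteq> carrier G \<and>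
    (\<forall>x y. accepted A' D x \<longrightarrow> accepted A' D y \<longrightarrow> (\<exists>t\<in>carrier G. \<forall>c\<in>C. x (c \<otimes> t) = y (c \<otimes> t)))"
proof -
  \<comment> \<open>\<open>\<one>\<close> is added to the window because both rounds start from a
    nonempty pattern and \<open>C\<close> may be empty.\<close>
  obtain p where p: "p \<in> A" "insert \<one> C \<subseteq> dom p"
    by (rule patch_system_extend[OF A, of "{}" "insert \<one> C"]) (use C in \<open>auto simp: pairwise_def\<close>)
  have pne: "dom p \<noteq> {}" using p(2) by blast
  obtain M A1 w1 \<nu>1 P where M: "finite M" "M \<subseteq> carrier G" and A1: "A1 \<subseteq> A" "patch_system A1 w1 \<nu>1"
    and P: "P \<in> A1" "\<And>m. m \<in> M \<Longrightarrow> shift p m \<subseteq>\<^sub>m P"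
    and hit1: "\<And>q g. q \<in> A1 \<Longrightarrow> g \<in> carrier G \<Longrightarrow> (\<And>m. m \<in> M \<Longrightarrow> dom (shift p (m \<otimes> g)) \<subseteq> dom q) \<Longrightarrow>
      \<exists>m\<in>M. shift p (m \<otimes> g) \<subseteq>\<^sub>m q"
    by (fact exists_hit_patches[OF inf icc A p(1) pne])
  have Mne: "M \<noteq> {}" using hit1[OF P(1) one_closed] by auto
  have dp: "dom p \<subseteq> carrier G" and dP: "dom P \<subseteq> carrier G" "finite (dom P)"
    using patch_systemD[OF A] patch_systemD[OF A1(2)] p P by simp_all
  have mc: "m \<in> carrier G" if "m \<in> M" for m using M that by blast
  have Pne: "dom P \<noteq> {}"
  proof -
    obtain m where m: "m \<in> M" using Mne by blast
    have "dom (shift p m) \<noteq> {}" using dom_shift[OF dp mc[OF m]] p(2) by auto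
    then show ?thesis using map_le_implies_dom_le[OF P(2)[OF m]] by blast
  qed
  obtain M2 A2 w2 \<nu>2 P2 where M2: "finite M2" "M2 \<subseteq> carrier G" and A2: "A2 \<subseteq> A1" "patch_system A2 w2 \<nu>2"
    and "P2 \<in> A2" and "\<And>m. m \<in> M2 \<Longrightarrow> shift P m \<subseteq>\<^sub>m P2" and hit2: "\<And>q g. q \<in> A2 \<Longrightarrow> g \<in> carrier G \<Longrightarrow>
      (\<And>m. m \<in> M2 \<Longrightarrow> dom (shift P (m \<otimes> g)) \<subseteq> dom q) \<Longrightarrow> \<exists>m\<in>M2. shift P (m \<otimes> g) \<subseteq>\<^sub>m q"
    by (fact exists_hit_patches[OF inf icc A1(2) P(1) Pne])
  have m2c: "m \<in> carrier G" if "m \<in> M2" for m using M2 that by blast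
  \<comment> \<open>Large enough to contain the domains of all candidate occurrences of
    \<open>P\<close> along \<open>M2\<close>, and with them those of \<open>p\<close> inside, so
    that both searches are decided within \<open>D\<close>.\<close>
  define D where "D = (\<Union>m\<in>M2. dom (shift P m))"
  have dsP: "dom (shift P m) = (\<lambda>k. k \<otimes> m) ` dom P" if "m \<in> M2" for m
    by (rule dom_shift[OF dP(1) m2c[OF that]])
  have D: "finite D" "D \<subseteq> carrier G"
    using M2 dP dsP m2c by (auto simp: D_def)
  have sub: "shift p (m \<otimes> m2) \<subseteq>\<^sub>m shift P m2" if "m \<in> M" "m2 \<in> M2" for m m2
    using shift_mono[OF P(2)[OF that(1)], of m2] shift_shift[OF mc[OF that(1)] m2c[OF that(2)]] by simp
  have "\<exists>t\<in>carrier G. \<forall>c\<in>C. x (c \<otimes> t) = y (c \<otimes> t)" if x: "accepted A2 D x" and y: "accepted A2 D y" for x y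
  proof -
    obtain q where q: "q \<in> A2" "D \<subseteq> dom q" "\<forall>c\<in>D. q c = Some (x c)" using x by (auto simp: accepted_def)
    obtain q' where q': "q' \<in> A2" "D \<subseteq> dom q'" "\<forall>c\<in>D. q' c = Some (y c)" using y by (auto simp: accepted_def)
    have "\<exists>m2\<in>M2. shift P (m2 \<otimes> \<one>) \<subseteq>\<^sub>m q"
      by (rule hit2[OF q(1) one_closed]) (use q(2) m2c in \<open>auto simp: D_def\<close>)
    then obtain m2 where m2: "m2 \<in> M2" "shift P m2 \<subseteq>\<^sub>m q" using m2c by auto
    have DP: "dom (shift P m2) \<subseteq> D" using m2 by (auto simp: D_def)
    have DM: "dom (shift p (m \<otimes> m2)) \<subseteq> D" if "m \<in> M" for m
      using map_le_implies_dom_le[OF sub[OF that m2(1)]] DP by blast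
    obtain m where m: "m \<in> M" "shift p (m \<otimes> m2) \<subseteq>\<^sub>m q'"
      using hit1[of q' m2] q' A2(1) m2c[OF m2(1)] DM by blast
    have tc: "m \<otimes> m2 \<in> carrier G" using mc m m2c m2 by simp
    have xq: "shift p (m \<otimes> m2) \<subseteq>\<^sub>m q" using sub[OF m(1) m2(1)] m2(2) by (rule map_le_trans)
    have "x (c \<otimes> (m \<otimes> m2)) = y (c \<otimes> (m \<otimes> m2))" if c: "c \<in> C" for c
    proof -
      have b: "c \<otimes> (m \<otimes> m2) \<in> dom (shift p (m \<otimes> m2))"
        unfolding dom_shift[OF dp tc] using p(2) c by blast
      show ?thesis
        using map_le_accepted[OF xq DM[OF m(1)] q(3) b] map_le_accepted[OF m(2) DM[OF m(1)] q'(3) b] by simp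
    qed
    with tc show ?thesis by blast
  qed
  moreover have "A2 \<subseteq> A" using A1 A2 by blast
  ultimately show ?thesis using A2(2) D by blast
qed

text \<open>A recurrent pattern with two different values excludes constant configurations, and a
  configuration fixed by all translations is constant.\<close>

lemma exists_nonconstant_system:
  assumes inf: "infinite (carrier G)" and icc: "icc G"
  shows "\<exists>A w \<nu> D. patch_system A w \<nu> \<and> finite D \<and> D \<subseteq> carrier G \<and>
    (\<forall>x. accepted A D x \<longrightarrow> (\<exists>c\<in>carrier G. \<exists>d\<in>carrier G. x c \<noteq> x d))"
proof -
  obtain a where a: "a \<in> carrier G" "a \<noteq> \<one>" using inf infinite_imp_nonempty
    by (metis finite.emptyI finite_insert finite_subset insertI1 subsetI)
  define p where "p = [\<one> \<mapsto> True, a \<mapsto> False]"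
  have dp: "dom p = {a, \<one>}" by (auto simp: p_def)
  have pA: "p \<in> {q. finite (dom q) \<and> dom q \<subseteq> carrier G}" using a by (simp add: dp)
  have pne: "dom p \<noteq> {}" by (simp add: dp)
  obtain M A w \<nu> P where M: "finite M" "M \<subseteq> carrier G"
    and "A \<subseteq> {q. finite (dom q) \<and> dom q \<subseteq> carrier G}" and A: "patch_system A w \<nu>" and "P \<in> A"
    and "\<And>m. m \<in> M \<Longrightarrow> shift p m \<subseteq>\<^sub>m P"
    and hit: "\<And>q g. q \<in> A \<Longrightarrow> g \<in> carrier G \<Longrightarrow> (\<And>m. m \<in> M \<Longrightarrow> dom (shift p (m \<otimes> g)) \<subseteq> dom q) \<Longrightarrow>
      \<exists>m\<in>M. shift p (m \<otimes> g) \<subseteq>\<^sub>m q"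
    by (fact exists_hit_patches[OF inf icc patch_system_all pA pne])
  have mc: "m \<in> carrier G" if "m \<in> M" for m using M that by blast
  have dpc: "dom p \<subseteq> carrier G" using a by (simp add: dp)
  define D where "D = (\<Union>m\<in>M. dom (shift p m))"
  have ds: "dom (shift p m) = {a \<otimes> m, m}" if "m \<in> M" for m
    using dom_shift[OF dpc mc[OF that]] mc[OF that] by (simp add: dp)
  have "\<exists>c\<in>carrier G. \<exists>d\<in>carrier G. x c \<noteq> x d" if x: "accepted A D x" for x
  proof -
    obtain q where q: "q \<in> A" "D \<subseteq> dom q" "\<forall>c\<in>D. q c = Some (x c)"
      using x by (auto simp: accepted_def)
    have "\<exists>m\<in>M. shift p (m \<otimes> \<one>) \<subseteq>\<^sub>m q"
      by (rule hit[OF q(1) one_closed]) (use q(2) mc in \<open>auto simp: D_def\<close>)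
    then obtain m where m: "m \<in> M" "shift p m \<subseteq>\<^sub>m q" using mc by auto
    have dD: "dom (shift p m) \<subseteq> D" using m by (auto simp: D_def)
    have "shift p m (a \<otimes> m) = Some (x (a \<otimes> m))" "shift p m m = Some (x m)"
      by (rule map_le_accepted[OF m(2) dD q(3)], simp add: ds[OF m(1)])+
    moreover have "shift p m (a \<otimes> m) = p a" by (rule shift_apply[OF a(1) mc[OF m(1)]])
    moreover have "shift p m m = p \<one>" using shift_apply[OF one_closed mc[OF m(1)], of p] mc[OF m(1)] by simp
    ultimately have "x (a \<otimes> m) \<noteq> x m" using a(2) by (auto simp: p_def)
    then show ?thesis using mc[OF m(1)] a(1) by blast
  qed
  moreover have "finite D" "D \<subseteq> carrier G" using M mc a by (auto simp: D_def ds)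
  ultimately show ?thesis using A by blast
qed

text \<open>The subshift is \<open>{x. \<forall>n. Ac n x}\<close>.\<close>

lemma exists_proximal_subshift:
  assumes inf: "infinite (carrier G)" and icc: "icc G"
  obtains D :: "nat \<Rightarrow> 'a set" and Ac :: "nat \<Rightarrow> ('a \<Rightarrow> bool) \<Rightarrow> bool"
  where "\<And>n. finite (D n)" "\<And>n. D n \<subseteq> carrier G"
    "\<And>n x y. Ac n x \<Longrightarrow> (\<And>c. c \<in> D n \<Longrightarrow> x c = y c) \<Longrightarrow> Ac n y"
    "\<And>n x. Ac (Suc n) x \<Longrightarrow> Ac n x"
    "\<And>n. \<exists>x. Ac n x"
    "\<And>x. Ac 0 x \<Longrightarrow> \<exists>c\<in>carrier G. \<exists>d\<in>carrier G. x c \<noteq> x d"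
    "\<And>x t n. (\<And>n. Ac n x) \<Longrightarrow> t \<in> carrier G \<Longrightarrow> Ac n (\<lambda>c. x (c \<otimes> t))"
    "\<And>x y C. (\<And>n. Ac n x) \<Longrightarrow> (\<And>n. Ac n y) \<Longrightarrow> finite C \<Longrightarrow> C \<subseteq> carrier G \<Longrightarrow>
      \<exists>t\<in>carrier G. \<forall>c\<in>C. x (c \<otimes> t) = y (c \<otimes> t)"
proof -
  define B where "B n = {x \<in> carrier G. len x \<le> n}" for n
  have Bf: "finite (B n)" "B n \<subseteq> carrier G" for n by (auto simp: B_def finite_len)
  define good where "good n S \<longleftrightarrow> (case S of (A, D) \<Rightarrow> (\<exists>w \<nu>. patch_system A w \<nu>) \<and> finite D \<and>
    D \<subseteq> carrier G \<and> (n = (0::nat) \<longrightarrow> (\<forall>x. accepted A D x \<longrightarrow> (\<exists>c\<in>carrier G. \<exists>d\<in>carrier G. x c \<noteq> x d))))"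
    for n and S :: "('a \<rightharpoonup> bool) set \<times> 'a set"
  \<comment> \<open>The windows grow: \<open>D'\<close> contains \<open>D\<close> and the ball
    \<open>B n\<close>. Acceptance thereby becomes more restrictive from one stage to the next, and
    the windows exhaust \<open>G\<close>.\<close>
  define succ where "succ n S S' \<longleftrightarrow> (case S of (A, D) \<Rightarrow> case S' of (A', D') \<Rightarrow> A' \<subseteq> A \<and> D \<subseteq> D' \<and>
    B n \<subseteq> D' \<and> (\<forall>x y. accepted A' D' x \<longrightarrow> accepted A' D' y \<longrightarrow>
      (\<exists>t\<in>carrier G. \<forall>c\<in>B n. x (c \<otimes> t) = y (c \<otimes> t))))"
    for n and S S' :: "('a \<rightharpoonup> bool) set \<times> 'a set"
  have "\<exists>S. good 0 S"
  proof -
    obtain A w \<nu> D where "patch_system A w \<nu>" "finite D" "D \<subseteq> carrier G"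
      "\<forall>x. accepted A D x \<longrightarrow> (\<exists>c\<in>carrier G. \<exists>d\<in>carrier G. x c \<noteq> x d)"
      using exists_nonconstant_system[OF inf icc] by blast
    then have "good 0 (A, D)" unfolding good_def by auto
    then show ?thesis ..
  qed
  moreover have "\<exists>S'. good (Suc n) S' \<and> succ n S S'" if S: "good n S" for n S
  proof -
    obtain A D w \<nu> where AD: "S = (A, D)" "patch_system A w \<nu>" "finite D" "D \<subseteq> carrier G"
      using S by (cases S) (auto simp: good_def)
    obtain A' w' \<nu>' D' where A': "patch_system A' w' \<nu>'" "A' \<subseteq> A" "finite D'" "D' \<subseteq> carrier G"
      and pr: "\<And>x y. accepted A' D' x \<Longrightarrow> accepted A' D' y \<Longrightarrow> \<exists>t\<in>carrier G. \<forall>c\<in>B n. x (c \<otimes> t) = y (c \<otimes> t)"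
      using exists_proximal_refinement[OF inf icc AD(2) Bf[of n]] by blast
    have "good (Suc n) (A', D \<union> D' \<union> B n)" using A' AD Bf by (auto simp: good_def)
    moreover have "accepted A' D' x" if "accepted A' (D \<union> D' \<union> B n) x" for x
      using that by (rule accepted_mono) auto
    then have "succ n S (A', D \<union> D' \<union> B n)" using A' AD pr by (auto simp: succ_def)
    ultimately show ?thesis by blast
  qed
  ultimately obtain S where S: "\<And>n. good n (S n)" "\<And>n. succ n (S n) (S (Suc n))"
    using dependent_nat_choice[of good succ] by blast
  define A where "A n = fst (S n)" for n
  define D where "D n = snd (S n)" for n
  have Sn: "S n = (A n, D n)" for n by (simp add: A_def D_def)
  have g: "\<exists>w \<nu>. patch_system (A n) w \<nu>" "finite (D n)" "D n \<subseteq> carrier G" for n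
    using S(1)[of n] unfolding Sn good_def by auto
  have nonconst: "\<exists>c\<in>carrier G. \<exists>d\<in>carrier G. x c \<noteq> x d" if "accepted (A 0) (D 0) x" for x
    using S(1)[of 0] that unfolding Sn good_def by auto
  have s: "A (Suc n) \<subseteq> A n" "D n \<subseteq> D (Suc n)" "B n \<subseteq> D (Suc n)" for n
    using S(2)[of n] unfolding Sn succ_def by auto
  have pr: "\<exists>t\<in>carrier G. \<forall>c\<in>B n. x (c \<otimes> t) = y (c \<otimes> t)"
    if "accepted (A (Suc n)) (D (Suc n)) x" "accepted (A (Suc n)) (D (Suc n)) y" for n x y
    using S(2)[of n] that unfolding Sn succ_def by auto
  have Amono: "A n \<subseteq> A m" if "m \<le> n" for m n by (rule lift_Suc_antimono_le[of A, OF s(1) that])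
  have Dmono: "D m \<subseteq> D n" if "m \<le> n" for m n by (rule lift_Suc_mono_le[of D, OF s(2) that])
  have BD: "\<exists>N\<ge>n. C \<subseteq> B N" if C: "finite C" "C \<subseteq> carrier G" for C n
  proof (intro exI conjI)
    show "n \<le> max n (Max (len ` C))" by simp
    show "C \<subseteq> B (max n (Max (len ` C)))"
    proof
      fix c assume c: "c \<in> C"
      then have le: "len c \<le> Max (len ` C)" using C by simp
      show "c \<in> B (max n (Max (len ` C)))"
        using subsetD[OF C(2) c] max.coboundedI2[OF le] unfolding B_def by blast
    qed
  qed
  show ?thesis
  proof (rule that[where D = D and Ac = "\<lambda>n. accepted (A n) (D n)"])
    show "finite (D n)" "D n \<subseteq> carrier G" for n by (rule g)+
    show "accepted (A n) (D n) y" if "accepted (A n) (D n) x" "\<And>c. c \<in> D n \<Longrightarrow> x c = y c" for n x y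
      using that unfolding accepted_def by auto
    show "accepted (A n) (D n) x" if "accepted (A (Suc n)) (D (Suc n)) x" for n x
      using that s(1,2) by (rule accepted_mono)
    show "\<exists>x. accepted (A n) (D n) x" for n
    proof -
      obtain w \<nu> where "patch_system (A n) w \<nu>" using g(1) by blast
      then obtain q where q: "q \<in> A n" "D n \<subseteq> dom q"
        by (rule patch_system_extend[of "A n" w \<nu> "{}" "D n"]) (use g in \<open>auto simp: pairwise_def\<close>)
      have "q c = Some (the (q c))" if "c \<in> D n" for c
        using q(2) that by (metis domD option.sel subsetD)
      then have "accepted (A n) (D n) (\<lambda>c. the (q c))"
        unfolding accepted_def using q by (intro bexI[OF _ q(1)] conjI ballI)
      then show ?thesis by blast
    qed
    show "\<exists>c\<in>carrier G. \<exists>d\<in>carrier G. x c \<noteq> x d" if "accepted (A 0) (D 0) x" for x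
      using that by (rule nonconst)
    \<comment> \<open>Stage \<open>n\<close> for the translate of \<open>x\<close> is read off a
      later stage for \<open>x\<close>, whose window contains \<open>D n\<close> translated by
      \<open>t\<close>; translation invariance of \<open>A n\<close> moves the witnessing patch
      back.\<close>
    show "accepted (A n) (D n) (\<lambda>c. x (c \<otimes> t))" if x: "\<And>n. accepted (A n) (D n) x" and t: "t \<in> carrier G" for x t n
    proof -
      have "finite ((\<lambda>c. c \<otimes> t) ` D n)" "(\<lambda>c. c \<otimes> t) ` D n \<subseteq> carrier G" using g[of n] t by auto
      then obtain N where N: "n \<le> N" "(\<lambda>c. c \<otimes> t) ` D n \<subseteq> B N" using BD by blast
      obtain q where q: "q \<in> A (Suc N)" "\<forall>c\<in>D (Suc N). q c = Some (x c)"
        using x[of "Suc N"] unfolding accepted_def by blast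
      obtain w \<nu> where "patch_system (A n) w \<nu>" using g(1) by blast
      moreover have "q \<in> A n" using q(1) Amono[of n "Suc N"] N(1) by auto
      ultimately have "shift q (inv t) \<in> A n" using t by (intro patch_systemD(3)) auto
      moreover have "shift q (inv t) c = Some (x (c \<otimes> t))" if c: "c \<in> D n" for c
      proof -
        have "c \<in> carrier G" using c g by blast
        then have "shift q (inv t) c = q (c \<otimes> t)" using t by (simp add: shift_def)
        moreover have "c \<otimes> t \<in> D (Suc N)" using N(2) c s(3)[of N] by blast
        ultimately show ?thesis using q(2) by simp
      qed
      ultimately show ?thesis unfolding accepted_def by (intro bexI[of _ "shift q (inv t)"]) auto
    qed
    show "\<exists>t\<in>carrier G. \<forall>c\<in>C. x (c \<otimes> t) = y (c \<otimes> t)"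
      if x: "\<And>n. accepted (A n) (D n) x" and y: "\<And>n. accepted (A n) (D n) y"
        and C: "finite C" "C \<subseteq> carrier G" for x y C
    proof -
      obtain N where "C \<subseteq> B N" using BD[OF C] by blast
      with pr[OF x y, of N] show ?thesis by blast
    qed
  qed
qed

end

section \<open>The subshift of an ICC group\<close>

lemma closedin_product_discrete_finite:
  assumes fin: "finite D" "D \<subseteq> I"
    and dep: "\<And>x y. Pr x \<Longrightarrow> (\<And>i. i \<in> D \<Longrightarrow> x i = y i) \<Longrightarrow> Pr y"
  shows "closedin (product_topology (\<lambda>_. discrete_topology UNIV) I) {x \<in> extensional I. Pr x}"
proof -
  let ?T = "product_topology (\<lambda>_. discrete_topology UNIV) I"
  have top: "topspace ?T = extensional I" by (simp add: PiE_UNIV_domain PiE_def)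
  have "openin ?T (topspace ?T - {x \<in> extensional I. Pr x})"
  proof (subst openin_subopen, intro ballI)
    fix x assume x: "x \<in> topspace ?T - {x \<in> extensional I. Pr x}"
    define W where "W = PiE I (\<lambda>i. if i \<in> D then {x i} else UNIV)"
    have "openin ?T W"
      unfolding W_def
    proof (rule product_topology_basis)
      show "finite {i. (if i \<in> D then {x i} else UNIV) \<noteq> topspace (discrete_topology UNIV)}"
        by (rule finite_subset[OF _ fin(1)]) auto
    qed auto
    moreover have "x \<in> W" using x unfolding top W_def by (auto simp: PiE_def)
    moreover have "W \<subseteq> topspace ?T - {x \<in> extensional I. Pr x}"
    proof
      fix y assume y: "y \<in> W"
      then have ye: "y \<in> extensional I" by (auto simp: W_def PiE_def)
      have "y i = x i" if "i \<in> D" for i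
        using y that fin(2) by (auto simp: W_def PiE_def Pi_def dest!: bspec split: if_splits)
      then have "\<not> Pr y" using dep[of y x] x unfolding top by blast
      with ye show "y \<in> topspace ?T - {x \<in> extensional I. Pr x}" unfolding top by blast
    qed
    ultimately show "\<exists>W. openin ?T W \<and> x \<in> W \<and> W \<subseteq> topspace ?T - {x \<in> extensional I. Pr x}" by blast
  qed
  then show ?thesis unfolding closedin_def top by blast
qed

text \<open>Points of the subshift are functions made \<open>extensional\<close> on
  \<open>carrier G\<close>, so that they are points of the product topology; the group acts by right
  translation of the argument. A fixed point would be constant on \<open>carrier G\<close>.\<close>

theorem (in group) icc_not_strongly_amenable_on:
  assumes cnt: "countable (carrier G)" and inf: "infinite (carrier G)" and icc: "icc G"
  shows "\<not> strongly_amenable_on TYPE('a \<Rightarrow> bool) G"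
proof
  assume sa: "strongly_amenable_on TYPE('a \<Rightarrow> bool) G"
  obtain len where "proper_length G len" using countable_imp_proper_length[OF cnt] by blast
  then interpret L: proper_length G len .
  obtain D :: "nat \<Rightarrow> 'a set" and Ac :: "nat \<Rightarrow> ('a \<Rightarrow> bool) \<Rightarrow> bool"
    where D: "\<And>n. finite (D n)" "\<And>n. D n \<subseteq> carrier G"
    and dep: "\<And>n x y. Ac n x \<Longrightarrow> (\<And>c. c \<in> D n \<Longrightarrow> x c = y c) \<Longrightarrow> Ac n y"
    and dec: "\<And>n x. Ac (Suc n) x \<Longrightarrow> Ac n x"
    and ne: "\<And>n. \<exists>x. Ac n x"
    and nonconst: "\<And>x. Ac 0 x \<Longrightarrow> \<exists>c\<in>carrier G. \<exists>d\<in>carrier G. x c \<noteq> x d"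
    and sh: "\<And>x t n. (\<And>n. Ac n x) \<Longrightarrow> t \<in> carrier G \<Longrightarrow> Ac n (\<lambda>c. x (c \<otimes> t))"
    and prox: "\<And>x y C. (\<And>n. Ac n x) \<Longrightarrow> (\<And>n. Ac n y) \<Longrightarrow> finite C \<Longrightarrow> C \<subseteq> carrier G \<Longrightarrow>
      \<exists>t\<in>carrier G. \<forall>c\<in>C. x (c \<otimes> t) = y (c \<otimes> t)"
    by (fact L.exists_proximal_subshift[OF inf icc])
  define T where "T = product_topology (\<lambda>_. discrete_topology (UNIV :: bool set)) (carrier G)"
  define X where "X = {x \<in> extensional (carrier G). \<forall>n. Ac n x}"
  define E where "E = subtopology T X"
  have topT: "topspace T = extensional (carrier G)" by (simp add: T_def PiE_UNIV_domain PiE_def)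
  have topE: "topspace E = X" by (auto simp: E_def topT X_def)
  have Tc: "compact_space T"
    unfolding T_def by (simp add: compact_space_product_topology compact_space_discrete_topology)
  have Th: "Hausdorff_space T"
    unfolding T_def by (simp add: Hausdorff_space_product_topology)
  have clopen: "closedin T {x \<in> extensional (carrier G). Pr x}"
    if "finite C" "C \<subseteq> carrier G" "\<And>x y. Pr x \<Longrightarrow> (\<And>i. i \<in> C \<Longrightarrow> x i = y i) \<Longrightarrow> Pr y" for C Pr
    unfolding T_def by (rule closedin_product_discrete_finite[OF that])
  have clAc: "closedin T {x \<in> extensional (carrier G). Ac n x}" for n
    by (rule clopen[OF D(1) D(2)]) (rule dep)
  have "X = (\<Inter>n. {x \<in> extensional (carrier G). Ac n x})" by (auto simp: X_def)
  moreover have "closedin T (\<Inter>n. {x \<in> extensional (carrier G). Ac n x})"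
    by (rule closedin_INT) (use clAc in auto)
  moreover have "(\<Inter>n. {x \<in> extensional (carrier G). Ac n x}) \<noteq> {}"
  proof (rule compact_space_imp_nest[OF Tc clAc])
    show "{x \<in> extensional (carrier G). Ac n x} \<noteq> {}" for n
    proof -
      obtain x where "Ac n x" using ne by blast
      then have "Ac n (restrict x (carrier G))" by (rule dep) (use D(2)[of n] in auto)
      then show ?thesis using restrict_extensional by blast
    qed
    show "decseq (\<lambda>n. {x \<in> extensional (carrier G). Ac n x})"
      using dec by (intro decseq_SucI) auto
  qed
  ultimately have X: "closedin T X" "X \<noteq> {}" by simp_all
  have Ec: "compact_space E" and Eh: "Hausdorff_space E"
    unfolding E_def using Tc Th X closedin_compact_space compact_space_subtopology
      Hausdorff_space_subtopology by blast+
  \<comment> \<open>Multiplying the argument on the right is what makes this a left action.\<close>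
  define \<alpha> where "\<alpha> t = (\<lambda>x\<in>X. \<lambda>c\<in>carrier G. x (c \<otimes> t))" for t
  have \<alpha>_in: "\<alpha> t x \<in> X" if x: "x \<in> X" and t: "t \<in> carrier G" for t x
  proof -
    have "Ac n (\<lambda>c\<in>carrier G. x (c \<otimes> t))" for n
      by (rule dep[OF sh[of x t n]]) (use x t D(2) in \<open>auto simp: X_def\<close>)
    then show ?thesis using x by (auto simp: \<alpha>_def X_def)
  qed
  have \<alpha>_mult: "\<alpha> (s \<otimes> t) x = \<alpha> s (\<alpha> t x)" if "x \<in> X" "s \<in> carrier G" "t \<in> carrier G" for s t x
    using \<alpha>_in[OF that(1,3)] that by (auto simp: \<alpha>_def m_assoc restrict_def fun_eq_iff)
  have \<alpha>_one: "\<alpha> \<one> x = x" if "x \<in> X" for x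
    using that by (auto simp: \<alpha>_def X_def restrict_def extensional_def fun_eq_iff)
  have \<alpha>_Bij: "\<alpha> g \<in> Bij X" if g: "g \<in> carrier G" for g
  proof -
    have "bij_betw (\<alpha> g) X X"
      by (rule bij_betw_byWitness[where f' = "\<alpha> (inv g)"])
        (use g \<alpha>_in in \<open>auto simp: \<alpha>_mult[symmetric] \<alpha>_one\<close>)
    then show ?thesis by (auto simp: Bij_def \<alpha>_def)
  qed
  have "group_hom G (BijGroup X) \<alpha>"
  proof (intro group_hom.intro group_hom_axioms.intro homI)
    fix s t assume st: "s \<in> carrier G" "t \<in> carrier G"
    show "\<alpha> (s \<otimes> t) = \<alpha> s \<otimes>\<^bsub>BijGroup X\<^esub> \<alpha> t"
    proof
      fix x
      show "\<alpha> (s \<otimes> t) x = (\<alpha> s \<otimes>\<^bsub>BijGroup X\<^esub> \<alpha> t) x"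
      proof (cases "x \<in> X")
        case True
        then show ?thesis
          using st \<alpha>_Bij \<alpha>_mult by (simp add: BijGroup_def compose_def)
      next
        case False
        then show ?thesis using st \<alpha>_Bij by (simp add: BijGroup_def compose_def) (simp add: \<alpha>_def)
      qed
    qed
  qed (use \<alpha>_Bij group_BijGroup group_axioms in \<open>auto simp: BijGroup_def\<close>)
  then have ga: "group_action G (topspace E) \<alpha>" by (simp add: group_action_def topE)
  have cont: "continuous_map E E (\<alpha> t)" if t: "t \<in> carrier G" for t
  proof -
    have "continuous_map E T (\<alpha> t)"
      unfolding T_def continuous_map_componentwise
    proof (intro conjI ballI)
      show "\<alpha> t ` topspace E \<subseteq> extensional (carrier G)"
        using \<alpha>_in[OF _ t] by (auto simp: topE X_def)
      fix c assume c: "c \<in> carrier G"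
      have "continuous_map T (discrete_topology UNIV) (\<lambda>x. x (c \<otimes> t))"
        unfolding T_def by (rule continuous_map_product_projection) (use c t in simp)
      then have "continuous_map E (discrete_topology UNIV) (\<lambda>x. x (c \<otimes> t))"
        unfolding E_def by (rule continuous_map_from_subtopology)
      then show "continuous_map E (discrete_topology UNIV) (\<lambda>x. \<alpha> t x c)"
        by (rule continuous_map_eq) (use c in \<open>simp add: topE \<alpha>_def\<close>)
    qed
    then show ?thesis
      using \<alpha>_in[OF _ t] unfolding E_def by (auto simp: continuous_map_in_subtopology topE[unfolded E_def])
  qed
  have "proximal_action G E \<alpha>"
    unfolding proximal_action_def topE
  proof (intro ballI)
    fix x y assume x: "x \<in> X" and y: "y \<in> X"
    define B where "B n = {c \<in> carrier G. len c \<le> n}" for n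
    have B: "finite (B n)" "B n \<subseteq> carrier G" for n by (auto simp: B_def L.finite_len)
    \<comment> \<open>\<open>Z n z\<close> says that one element of \<open>G\<close> carries both
      \<open>x\<close> and \<open>y\<close> to \<open>z\<close> on the ball \<open>B n\<close>.
      Compactness gives a \<open>z\<close> in the subshift that is good for all \<open>n\<close>,
      and the elements for the successive \<open>n\<close> form the net.\<close>
    define Z where "Z n z \<longleftrightarrow> (\<exists>g\<in>carrier G. \<forall>c\<in>B n. x (c \<otimes> g) = z c \<and> y (c \<otimes> g) = z c)" for n z
    have clZ: "closedin T {z \<in> extensional (carrier G). Z n z}" for n
      by (rule clopen[OF B]) (auto simp: Z_def)
    have "(\<Inter>n. X \<inter> {z \<in> extensional (carrier G). Z n z}) \<noteq> {}"
    proof (rule compact_space_imp_nest[OF Tc])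
      show "closedin T (X \<inter> {z \<in> extensional (carrier G). Z n z})" for n
        by (intro closedin_Int X clZ)
      show "X \<inter> {z \<in> extensional (carrier G). Z n z} \<noteq> {}" for n
      proof -
        obtain t where t: "t \<in> carrier G" "\<And>c. c \<in> B n \<Longrightarrow> x (c \<otimes> t) = y (c \<otimes> t)"
          using prox[of x y "B n"] x y B by (auto simp: X_def)
        then have "Z n (\<alpha> t x)" unfolding Z_def using x B(2)[of n] by (intro bexI[of _ t]) (auto simp: \<alpha>_def)
        then show ?thesis using \<alpha>_in[OF x t(1)] by (auto simp: X_def)
      qed
      show "decseq (\<lambda>n. X \<inter> {z \<in> extensional (carrier G). Z n z})"
        by (intro decseq_SucI) (force simp: Z_def B_def)
    qed
    then obtain z where z: "z \<in> X" "\<And>n. Z n z" by blast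
    then obtain g where g: "\<And>n. g n \<in> carrier G"
      "\<And>n c. c \<in> B n \<Longrightarrow> x (c \<otimes> g n) = z c \<and> y (c \<otimes> g n) = z c"
      unfolding Z_def by metis
    define F where "F = filtermap g sequentially"
    have evF: "eventually P F \<longleftrightarrow> (\<forall>\<^sub>F n in sequentially. P (g n))" for P
      by (simp add: F_def eventually_filtermap)
    have lim: "limitin E (\<lambda>g. \<alpha> g w) z F"
      if w: "w \<in> X" and wz: "\<And>n c. c \<in> B n \<Longrightarrow> w (c \<otimes> g n) = z c" for w
    proof -
      have "limitin (discrete_topology UNIV) (\<lambda>g. \<alpha> g w c) (z c) F" if c: "c \<in> carrier G" for c
      proof -
        have "\<forall>\<^sub>F n in sequentially. \<alpha> (g n) w c = z c"
          using eventually_ge_at_top[of "len c"]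
          by eventually_elim (use c w wz in \<open>auto simp: \<alpha>_def B_def\<close>)
        then have "\<forall>\<^sub>F g in F. \<alpha> g w c = z c" by (simp add: evF)
        then show ?thesis unfolding limitin_def by (auto elim: eventually_mono)
      qed
      then have "limitin T (\<lambda>g. \<alpha> g w) z F"
        unfolding T_def limitin_componentwise topT[unfolded T_def]
        using z(1) \<alpha>_in[OF w] g(1) by (auto simp: X_def evF)
      then show ?thesis
        unfolding E_def limitin_subtopology using z(1) \<alpha>_in[OF w] g(1) by (auto simp: evF)
    qed
    have "F \<noteq> bot" by (simp add: F_def filtermap_bot_iff)
    moreover have "\<forall>\<^sub>F g in F. g \<in> carrier G" by (simp add: evF g(1))
    ultimately show "\<exists>F z. F \<noteq> bot \<and> (\<forall>\<^sub>F g in F. g \<in> carrier G) \<and>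
       limitin E (\<lambda>g. \<alpha> g x) z F \<and> limitin E (\<lambda>g. \<alpha> g y) z F"
      using lim[OF x] lim[OF y] g(2) by blast
  qed
  moreover have "continuous_action G E \<alpha>" using ga cont by (simp add: continuous_action_def)
  ultimately have "compact_space E \<and> Hausdorff_space E \<and> topspace E \<noteq> {} \<and>
      continuous_action G E \<alpha> \<and> proximal_action G E \<alpha>"
    using Ec Eh X(2) unfolding topE by blast
  then have "\<exists>x\<in>topspace E. \<forall>g\<in>carrier G. \<alpha> g x = x"
    by (rule mp[OF sa[unfolded strongly_amenable_on_def, THEN spec, THEN spec]])
  then obtain x where x: "x \<in> X" "\<forall>g\<in>carrier G. \<alpha> g x = x" unfolding topE by blast
  have "x c = x \<one>" if c: "c \<in> carrier G" for c
  proof -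
    have "\<alpha> c x \<one> = x \<one>" using x c by simp
    then show ?thesis using x(1) c by (simp add: \<alpha>_def)
  qed
  moreover have "Ac 0 x" using x(1) by (simp add: X_def)
  ultimately show False using nonconst by metis
qed

section \<open>Finite index and nilpotency modulo a normal subgroup\<close>

context group
begin

lemma comm_eq_one_iff:
  assumes "x \<in> carrier G" "y \<in> carrier G"
  shows "x \<otimes> y \<otimes> inv x \<otimes> inv y = \<one> \<longleftrightarrow> x \<otimes> y = y \<otimes> x"
proof -
  have "x \<otimes> y \<otimes> inv x \<otimes> inv y = (x \<otimes> y) \<otimes> inv (y \<otimes> x)"
    using assms by (simp add: word_simps)
  then show ?thesis
    using assms by (metis inv_closed inv_equality inv_inv m_closed r_inv)
qed

lemma finite_index_iff:
  assumes "subgroup H G"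
  shows "finite (rcosets H) \<longleftrightarrow>
    (\<exists>T. finite T \<and> T \<subseteq> carrier G \<and> (\<forall>g\<in>carrier G. \<exists>t\<in>T. g \<otimes> inv t \<in> H))"
proof
  interpret H: subgroup H G by (rule assms)
  assume fin: "finite (rcosets H)"
  define rep where "rep C = (SOME t. t \<in> carrier G \<and> H #> t = C)" for C
  have rep: "rep C \<in> carrier G" "H #> rep C = C" if "C \<in> rcosets H" for C
    using someI_ex[of "\<lambda>t. t \<in> carrier G \<and> H #> t = C"] that by (auto simp: rep_def RCOSETS_def)
  have "\<exists>t\<in>rep ` (rcosets H). g \<otimes> inv t \<in> H" if g: "g \<in> carrier G" for g
  proof -
    have C: "H #> g \<in> rcosets H" using g by (auto simp: RCOSETS_def)
    have "g \<in> H #> rep (H #> g)" using rcos_self[OF g assms] rep(2)[OF C] by simp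
    then obtain h where h: "h \<in> H" "g = h \<otimes> rep (H #> g)" by (auto simp: r_coset_def)
    then have "g \<otimes> inv (rep (H #> g)) = h"
      using rep(1)[OF C] H.mem_carrier by (metis inv_solve_right' m_closed)
    then show ?thesis using h C by auto
  qed
  then show "\<exists>T. finite T \<and> T \<subseteq> carrier G \<and> (\<forall>g\<in>carrier G. \<exists>t\<in>T. g \<otimes> inv t \<in> H)"
    using fin rep(1) by (intro exI[of _ "rep ` (rcosets H)"]) auto
next
  interpret H: subgroup H G by (rule assms)
  assume "\<exists>T. finite T \<and> T \<subseteq> carrier G \<and> (\<forall>g\<in>carrier G. \<exists>t\<in>T. g \<otimes> inv t \<in> H)"
  then obtain T where T: "finite T" "T \<subseteq> carrier G" "\<And>g. g \<in> carrier G \<Longrightarrow> \<exists>t\<in>T. g \<otimes> inv t \<in> H"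
    by blast
  have "rcosets H \<subseteq> (\<lambda>t. H #> t) ` T"
  proof
    fix C assume "C \<in> rcosets H"
    then obtain g where g: "g \<in> carrier G" "C = H #> g" by (auto simp: RCOSETS_def)
    obtain t where t: "t \<in> T" "g \<otimes> inv t \<in> H" using T(3)[OF g(1)] by blast
    have tc: "t \<in> carrier G" using t T by blast
    have "g = (g \<otimes> inv t) \<otimes> t" using g tc by (simp add: m_assoc)
    then have "g \<in> H #> t" using t(2) unfolding r_coset_def by blast
    then have "H #> t = H #> g" by (rule repr_independence[OF _ tc assms])
    with g t show "C \<in> (\<lambda>t. H #> t) ` T" by blast
  qed
  with T(1) show "finite (rcosets H)" by (meson finite_imageI finite_subset)
qed

text \<open>Representatives of the finitely many fibres of \<open>f\<close> meet every coset: finite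
  index is read off any finite invariant that separates cosets.\<close>

lemma finite_index_of_finite_range:
  assumes H: "subgroup H G" and fin: "finite (f ` carrier G)"
    and f: "\<And>g g'. g \<in> carrier G \<Longrightarrow> g' \<in> carrier G \<Longrightarrow> f g = f g' \<Longrightarrow> g \<otimes> inv g' \<in> H"
  shows "finite (rcosets H)"
proof -
  define rep where "rep v = (SOME t. t \<in> carrier G \<and> f t = v)" for v
  have rep: "rep v \<in> carrier G" "f (rep v) = v" if "v \<in> f ` carrier G" for v
    using someI_ex[of "\<lambda>t. t \<in> carrier G \<and> f t = v"] that by (auto simp: rep_def)
  show ?thesis
    unfolding finite_index_iff[OF H]
  proof (intro exI conjI ballI)
    show "finite (rep ` f ` carrier G)" using fin by simp
    show "rep ` f ` carrier G \<subseteq> carrier G" using rep(1) by blast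
    fix g assume g: "g \<in> carrier G"
    then have "g \<otimes> inv (rep (f g)) \<in> H" using rep[of "f g"] by (intro f) auto
    then show "\<exists>t\<in>rep ` f ` carrier G. g \<otimes> inv t \<in> H" using g by blast
  qed
qed

lemma finite_index_Int:
  assumes H: "subgroup H G" "finite (rcosets H)" and K: "subgroup K G" "finite (rcosets K)"
  shows "finite (rcosets (H \<inter> K))"
proof (rule finite_index_of_finite_range[where f = "\<lambda>g. (H #> g, K #> g)"])
  show "subgroup (H \<inter> K) G" using H K by (intro subgroups_Inter_pair)
  have "(\<lambda>g. (H #> g, K #> g)) ` carrier G \<subseteq> (rcosets H) \<times> (rcosets K)"
    by (auto simp: RCOSETS_def)
  then show "finite ((\<lambda>g. (H #> g, K #> g)) ` carrier G)"
    using H(2) K(2) by (meson finite_SigmaI finite_subset)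
  fix g g' assume g: "g \<in> carrier G" "g' \<in> carrier G" "(H #> g, K #> g) = (H #> g', K #> g')"
  have "g \<otimes> inv g' \<in> L" if L: "subgroup L G" "L #> g = L #> g'" for L
  proof -
    interpret L: subgroup L G by (rule L)
    have "g \<in> L #> g'" using rcos_self[OF g(1) L(1)] L(2) by simp
    then obtain l where l: "l \<in> L" "g = l \<otimes> g'" by (auto simp: r_coset_def)
    then have "g \<otimes> inv g' = l" using g(2) L.mem_carrier[OF l(1)] by (simp add: m_assoc)
    with l show ?thesis by simp
  qed
  then show "g \<otimes> inv g' \<in> H \<inter> K" using g H K by auto
qed

text \<open>Schreier's argument: the generators are the products
  \<open>t \<otimes> s \<otimes> inv t'\<close>, with \<open>t\<close> and \<open>t'\<close>
  representatives, that lie in \<open>H\<close>. The union of the cosets \<open>K t\<close> is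
  closed under right multiplication by the generators of \<open>G\<close>, so every
  \<open>h \<in> H\<close> has the form \<open>k \<otimes> t\<close>, and then
  \<open>t \<in> H\<close>. \<open>T \<inter> H\<close> joins the generators because
  \<open>\<one>\<close> need not be the representative of its own coset.\<close>

lemma finite_index_subgroup_finitely_generated:
  assumes S: "finite S" "S \<subseteq> carrier G" "generate G S = carrier G"
    and H: "subgroup H G" "finite (rcosets H)"
  shows "\<exists>S'. finite S' \<and> S' \<subseteq> H \<and> generate G S' = H"
proof -
  interpret H: subgroup H G by (rule H)
  obtain T where T: "finite T" "T \<subseteq> carrier G" and cov: "\<And>g. g \<in> carrier G \<Longrightarrow> \<exists>t\<in>T. g \<otimes> inv t \<in> H"
    using finite_index_iff[OF H(1)] H(2) by blast
  have Tc: "t \<in> carrier G" if "t \<in> T" for t using that T by blast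
  define S2 where "S2 = S \<union> (\<lambda>s. inv s) ` S"
  define S' where "S' = ((\<lambda>(t, s, t'). t \<otimes> s \<otimes> inv t') ` (T \<times> S2 \<times> T) \<inter> H) \<union> (T \<inter> H)"
  define K where "K = generate G S'"
  have S': "finite S'" "S' \<subseteq> H" using S T by (auto simp: S'_def S2_def)
  have S2c: "s \<in> carrier G" if "s \<in> S2" for s using that S by (auto simp: S2_def)
  have KH: "K \<subseteq> H" unfolding K_def by (rule generate_subgroup_incl[OF S'(2) H(1)])
  interpret K: subgroup K G unfolding K_def by (rule generate_is_subgroup) (use S' H.subset in blast)
  have S'K: "s \<in> K" if "s \<in> S'" for s unfolding K_def using that by (rule generate.incl)
  have step: "\<exists>t\<in>T. y \<otimes> s \<otimes> inv t \<in> K"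
    if y: "y \<in> carrier G" "\<exists>t\<in>T. y \<otimes> inv t \<in> K" and s: "s \<in> S2" for y s
  proof -
    obtain t where t: "t \<in> T" "y \<otimes> inv t \<in> K" using y by blast
    obtain t' where t': "t' \<in> T" "t \<otimes> s \<otimes> inv t' \<in> H" using cov[of "t \<otimes> s"] Tc[OF t(1)] S2c[OF s] by auto
    have "t \<otimes> s \<otimes> inv t' \<in> (\<lambda>(t, s, t'). t \<otimes> s \<otimes> inv t') ` (T \<times> S2 \<times> T)"
      using t t' s by (intro image_eqI[of _ _ "(t, s, t')"]) auto
    then have "t \<otimes> s \<otimes> inv t' \<in> K" using t' by (intro S'K) (simp add: S'_def)
    then have "(y \<otimes> inv t) \<otimes> (t \<otimes> s \<otimes> inv t') \<in> K" using t by simp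
    moreover have "(y \<otimes> inv t) \<otimes> (t \<otimes> s \<otimes> inv t') = y \<otimes> s \<otimes> inv t'"
      using y(1) Tc[OF t(1)] Tc[OF t'(1)] S2c[OF s] by (simp add: word_simps)
    ultimately show ?thesis using t' by auto
  qed
  have gen: "g \<in> carrier G \<and> (\<forall>y\<in>carrier G. (\<exists>t\<in>T. y \<otimes> inv t \<in> K) \<longrightarrow> (\<exists>t\<in>T. y \<otimes> g \<otimes> inv t \<in> K))"
    if "g \<in> generate G S" for g
    using that
  proof induction
    case (incl s)
    then show ?case using step S2c by (auto simp: S2_def)
  next
    case (inv s)
    then show ?case using step S2c by (auto simp: S2_def)
  next
    case (eng g h)
    have "\<exists>t\<in>T. y \<otimes> (g \<otimes> h) \<otimes> inv t \<in> K" if y: "y \<in> carrier G" "\<exists>t\<in>T. y \<otimes> inv t \<in> K" for y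
    proof -
      have "\<exists>t\<in>T. y \<otimes> g \<otimes> inv t \<in> K" using eng y by blast
      then have "\<exists>t\<in>T. y \<otimes> g \<otimes> h \<otimes> inv t \<in> K" using eng y(1) by (metis m_closed)
      moreover have "y \<otimes> g \<otimes> h = y \<otimes> (g \<otimes> h)" using eng y(1) by (simp add: m_assoc)
      ultimately show ?thesis by simp
    qed
    with eng show ?case by auto
  qed auto
  have "H \<subseteq> K"
  proof
    fix h assume h: "h \<in> H"
    obtain t0 where t0: "t0 \<in> T" "\<one> \<otimes> inv t0 \<in> H" using cov[OF one_closed] by blast
    then have "inv t0 \<in> H" using Tc[OF t0(1)] by simp
    then have "t0 \<in> H" using H.m_inv_closed[of "inv t0"] Tc[OF t0(1)] by simp
    then have "t0 \<in> K" using t0 by (intro S'K) (simp add: S'_def)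
    then have "\<exists>t\<in>T. \<one> \<otimes> inv t \<in> K" using t0 Tc by (intro bexI[of _ t0]) auto
    moreover have "h \<in> generate G S" using h S(3) by simp
    ultimately obtain t where t: "t \<in> T" "\<one> \<otimes> h \<otimes> inv t \<in> K" using gen by blast
    then have tK: "h \<otimes> inv t \<in> K" using h by simp
    then have "inv (h \<otimes> inv t) \<otimes> h \<in> H" using KH h by blast
    moreover have "inv (h \<otimes> inv t) \<otimes> h = t" using h Tc[OF t(1)] by (simp add: word_simps)
    ultimately have "t \<in> K" using t(1) by (intro S'K) (simp add: S'_def)
    then have "h \<otimes> inv t \<otimes> t \<in> K" using tK by simp
    then show "h \<in> K" using h Tc[OF t(1)] by (simp add: m_assoc)
  qed
  with KH S' show ?thesis by (auto simp: K_def)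
qed

lemma countable_generate:
  assumes "countable S" "S \<subseteq> carrier G"
  shows "countable (generate G S)"
proof -
  define S2 where "S2 = S \<union> (\<lambda>s. inv s) ` S"
  define pr where "pr xs = foldr (\<otimes>) xs \<one>" for xs
  have S2c: "S2 \<subseteq> carrier G" using assms(2) by (auto simp: S2_def)
  have prc: "pr xs \<in> carrier G" if "xs \<in> lists S2" for xs
    using that S2c by (induction xs) (auto simp: pr_def)
  have app: "pr (xs @ ys) = pr xs \<otimes> pr ys" if xs: "xs \<in> lists S2" and ys: "ys \<in> lists S2" for xs ys
    using xs
  proof (induction xs)
    case Nil
    then show ?case using prc[OF ys] by (simp add: pr_def)
  next
    case (Cons x xs)
    then have "pr (xs @ ys) = pr xs \<otimes> pr ys" by simp
    then show ?case using Cons prc[of xs] prc[OF ys] S2c by (auto simp: pr_def m_assoc subsetD)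
  qed
  have "generate G S \<subseteq> pr ` lists S2"
  proof
    fix g assume "g \<in> generate G S"
    then show "g \<in> pr ` lists S2"
    proof induction
      case one
      show ?case by (rule image_eqI[of _ _ "[]"]) (auto simp: pr_def)
    next
      case (incl s)
      then show ?case using assms(2) by (intro image_eqI[of _ _ "[s]"]) (auto simp: pr_def S2_def)
    next
      case (inv s)
      then show ?case using assms(2) by (intro image_eqI[of _ _ "[inv s]"]) (auto simp: pr_def S2_def)
    next
      case (eng g h)
      then obtain xs ys where "xs \<in> lists S2" "ys \<in> lists S2" "g = pr xs" "h = pr ys" by blast
      then show ?case using app by (intro image_eqI[of _ _ "xs @ ys"]) auto
    qed
  qed
  moreover have "countable (pr ` lists S2)" using assms(1) by (simp add: S2_def countable_lists)
  ultimately show ?thesis by (rule countable_subset)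
qed

end

section \<open>Commutators modulo a normal subgroup\<close>

lemma (in normal) rcos_eq_iff:
  assumes "x \<in> carrier G"
  shows "H #> x = H \<longleftrightarrow> x \<in> H"
  using coset_join1[OF _ assms subgroup_axioms] coset_join2[OF assms subgroup_axioms] by blast

lemma (in normal) group_hom_Mod: "group_hom G (G Mod H) ((#>) H)"
  using r_coset_hom_Mod factorgroup_is_group by (intro group_hom.intro group_hom_axioms.intro is_group)

lemma (in normal) comm_mem_iff:
  assumes "x \<in> carrier G" "y \<in> carrier G"
  shows "x \<otimes> y \<otimes> inv x \<otimes> inv y \<in> H \<longleftrightarrow>
    (H #> x) \<otimes>\<^bsub>G Mod H\<^esub> (H #> y) = (H #> y) \<otimes>\<^bsub>G Mod H\<^esub> (H #> x)"
proof -
  interpret h: group_hom G "G Mod H" "(#>) H" by (rule group_hom_Mod)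
  have "x \<otimes> y \<otimes> inv x \<otimes> inv y \<in> H \<longleftrightarrow> H #> (x \<otimes> y \<otimes> inv x \<otimes> inv y) = \<one>\<^bsub>G Mod H\<^esub>"
    using rcos_eq_iff[of "x \<otimes> y \<otimes> inv x \<otimes> inv y"] assms by simp
  also have "H #> (x \<otimes> y \<otimes> inv x \<otimes> inv y)
      = (H #> x) \<otimes>\<^bsub>G Mod H\<^esub> (H #> y) \<otimes>\<^bsub>G Mod H\<^esub> inv\<^bsub>G Mod H\<^esub> (H #> x) \<otimes>\<^bsub>G Mod H\<^esub> inv\<^bsub>G Mod H\<^esub> (H #> y)"
    by (simp only: h.hom_mult h.hom_inv assms m_closed inv_closed)
  also have "\<dots> = \<one>\<^bsub>G Mod H\<^esub> \<longleftrightarrow>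
      (H #> x) \<otimes>\<^bsub>G Mod H\<^esub> (H #> y) = (H #> y) \<otimes>\<^bsub>G Mod H\<^esub> (H #> x)"
    by (rule h.H.comm_eq_one_iff) (simp_all add: assms)
  finally show ?thesis .
qed

text \<open>The set is the preimage of the centralizer of the image of \<open>S\<close> in the
  quotient.\<close>

lemma (in normal) subgroup_centralizer_mod:
  assumes "S \<subseteq> carrier G"
  shows "subgroup {c \<in> carrier G. \<forall>s\<in>S. c \<otimes> s \<otimes> inv c \<otimes> inv s \<in> H} G"
proof -
  interpret h: group_hom G "G Mod H" "(#>) H" by (rule group_hom_Mod)
  let ?C = "{C \<in> carrier (G Mod H). \<forall>s\<in>(#>) H ` S. C \<otimes>\<^bsub>G Mod H\<^esub> s = s \<otimes>\<^bsub>G Mod H\<^esub> C}"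
  have sub: "subgroup ?C (G Mod H)"
    by (rule h.H.centralizer_subgroup) (use assms h.hom_closed in blast)
  have eq: "{c \<in> carrier G. \<forall>s\<in>S. c \<otimes> s \<otimes> inv c \<otimes> inv s \<in> H} = {c \<in> carrier G. H #> c \<in> ?C}"
  proof (rule Collect_cong, rule conj_cong[OF refl])
    fix c assume c: "c \<in> carrier G"
    have "(\<forall>s\<in>S. c \<otimes> s \<otimes> inv c \<otimes> inv s \<in> H) \<longleftrightarrow>
        (\<forall>s\<in>S. (H #> c) \<otimes>\<^bsub>G Mod H\<^esub> (H #> s) = (H #> s) \<otimes>\<^bsub>G Mod H\<^esub> (H #> c))"
      by (rule ball_cong[OF refl], rule comm_mem_iff[OF c]) (rule subsetD[OF assms])
    then show "(\<forall>s\<in>S. c \<otimes> s \<otimes> inv c \<otimes> inv s \<in> H) \<longleftrightarrow> H #> c \<in> ?C"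
      by (simp only: mem_Collect_eq ball_simps h.hom_closed[OF c] simp_thms)
  qed
  define C where "C = ?C"
  interpret C: subgroup C "G Mod H" unfolding C_def by (rule sub)
  have "subgroup {c \<in> carrier G. H #> c \<in> C} G"
  proof (rule subgroupI)
    have "H #> \<one> \<in> C" unfolding h.hom_one by (rule C.one_closed)
    then show "{c \<in> carrier G. H #> c \<in> C} \<noteq> {}" using one_closed by blast
    show "inv c \<in> {c \<in> carrier G. H #> c \<in> C}" if "c \<in> {c \<in> carrier G. H #> c \<in> C}" for c
      using that C.m_inv_closed[of "H #> c"] h.hom_inv[of c] by simp
    show "c \<otimes> d \<in> {c \<in> carrier G. H #> c \<in> C}"
      if "c \<in> {c \<in> carrier G. H #> c \<in> C}" "d \<in> {c \<in> carrier G. H #> c \<in> C}" for c d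
      using that C.m_closed[of "H #> c" "H #> d"] h.hom_mult[of c d] by simp
  qed auto
  then show ?thesis by (simp only: eq C_def)
qed

section \<open>Lower central series and virtual nilpotency modulo a normal subgroup\<close>

context group
begin

lemma subgroup_group: "subgroup H G \<Longrightarrow> group (G\<lparr>carrier := H\<rparr>)"
  by (rule subgroup.subgroup_is_group[OF _ is_group])

text \<open>Rewrites the series of the restricted group with the operations of \<open>G\<close>, so
  that the series of different subgroups can be compared.\<close>

lemma lower_central_series_Suc_subgroup:
  assumes H: "subgroup H G"
  shows "lower_central_series (G\<lparr>carrier := H\<rparr>) n \<subseteq> H"
    and "lower_central_series (G\<lparr>carrier := H\<rparr>) (Suc n) = generate G {x \<otimes> y \<otimes> inv x \<otimes> inv y | x y.
      x \<in> lower_central_series (G\<lparr>carrier := H\<rparr>) n \<and> y \<in> H}"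
proof -
  interpret H: subgroup H G by (rule H)
  let ?L = "lower_central_series (G\<lparr>carrier := H\<rparr>)"
  have LSuc: "?L (Suc n) = generate G {x \<otimes> y \<otimes> inv x \<otimes> inv y | x y. x \<in> ?L n \<and> y \<in> H}"
    and sub: "{x \<otimes> y \<otimes> inv x \<otimes> inv y | x y. x \<in> ?L n \<and> y \<in> H} \<subseteq> H" if L: "?L n \<subseteq> H" for n
  proof -
    show sub: "{x \<otimes> y \<otimes> inv x \<otimes> inv y | x y. x \<in> ?L n \<and> y \<in> H} \<subseteq> H" using L by auto
    have "{x \<otimes>\<^bsub>G\<lparr>carrier := H\<rparr>\<^esub> y \<otimes>\<^bsub>G\<lparr>carrier := H\<rparr>\<^esub> inv\<^bsub>G\<lparr>carrier := H\<rparr>\<^esub> x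
          \<otimes>\<^bsub>G\<lparr>carrier := H\<rparr>\<^esub> inv\<^bsub>G\<lparr>carrier := H\<rparr>\<^esub> y | x y. x \<in> ?L n \<and> y \<in> carrier (G\<lparr>carrier := H\<rparr>)}
        = {x \<otimes> y \<otimes> inv x \<otimes> inv y | x y. x \<in> ?L n \<and> y \<in> H}"
    proof (intro Collect_cong ex_cong1)
      fix z x y
      show "(z = x \<otimes>\<^bsub>G\<lparr>carrier := H\<rparr>\<^esub> y \<otimes>\<^bsub>G\<lparr>carrier := H\<rparr>\<^esub> inv\<^bsub>G\<lparr>carrier := H\<rparr>\<^esub> x
          \<otimes>\<^bsub>G\<lparr>carrier := H\<rparr>\<^esub> inv\<^bsub>G\<lparr>carrier := H\<rparr>\<^esub> y \<and> x \<in> ?L n \<and> y \<in> carrier (G\<lparr>carrier := H\<rparr>))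
          \<longleftrightarrow> (z = x \<otimes> y \<otimes> inv x \<otimes> inv y \<and> x \<in> ?L n \<and> y \<in> H)"
        using subsetD[OF L] m_inv_consistent[OF H] by (cases "x \<in> ?L n \<and> y \<in> H") auto
    qed
    then show "?L (Suc n) = generate G {x \<otimes> y \<otimes> inv x \<otimes> inv y | x y. x \<in> ?L n \<and> y \<in> H}"
      using generate_consistent[OF sub H] by simp
  qed
  have L: "?L n \<subseteq> H" for n
  proof (induction n)
    case (Suc n)
    show ?case unfolding LSuc[OF Suc.IH] by (rule generate_subgroup_incl[OF sub[OF Suc.IH] H])
  qed simp
  show "?L n \<subseteq> H" by (rule L)
  show "?L (Suc n) = generate G {x \<otimes> y \<otimes> inv x \<otimes> inv y | x y. x \<in> ?L n \<and> y \<in> H}"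
    by (rule LSuc[OF L])
qed

lemma lower_central_series_mono:
  assumes H: "subgroup H G" and K: "subgroup K G" and HK: "H \<subseteq> K"
  shows "lower_central_series (G\<lparr>carrier := H\<rparr>) n \<subseteq> lower_central_series (G\<lparr>carrier := K\<rparr>) n"
proof (induction n)
  case (Suc n)
  show ?case
    unfolding lower_central_series_Suc_subgroup(2)[OF H] lower_central_series_Suc_subgroup(2)[OF K]
  proof (rule mono_generate)
    show "{x \<otimes> y \<otimes> inv x \<otimes> inv y | x y. x \<in> lower_central_series (G\<lparr>carrier := H\<rparr>) n \<and> y \<in> H}
        \<subseteq> {x \<otimes> y \<otimes> inv x \<otimes> inv y | x y. x \<in> lower_central_series (G\<lparr>carrier := K\<rparr>) n \<and> y \<in> K}"
      using Suc.IH HK by blast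
  qed
qed (use HK in simp)

text \<open>Left-normed commutators of \<open>n + 1\<close> elements of \<open>S\<close>. For finite
  \<open>S\<close> there are finitely many, and for a generating set they decide whether a term of
  the lower central series lies in a normal subgroup; this makes nilpotency of bounded class a
  finitary condition.\<close>

primrec simple_commutators :: "'a set \<Rightarrow> nat \<Rightarrow> 'a set"
  where
    "simple_commutators S 0 = S"
  | "simple_commutators S (Suc n) =
      (\<lambda>(x, y). x \<otimes> y \<otimes> inv x \<otimes> inv y) ` (simple_commutators S n \<times> S)"

lemma finite_simple_commutators: "finite S \<Longrightarrow> finite (simple_commutators S n)"
  by (induction n) auto

lemma simple_commutators_subset:
  assumes H: "subgroup H G" and S: "S \<subseteq> H"
  shows "simple_commutators S n \<subseteq> lower_central_series (G\<lparr>carrier := H\<rparr>) n"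
proof (induction n)
  case (Suc n)
  show ?case
  proof
    fix z assume "z \<in> simple_commutators S (Suc n)"
    then obtain x y where "x \<in> simple_commutators S n" "y \<in> S" "z = x \<otimes> y \<otimes> inv x \<otimes> inv y" by auto
    then have "z \<in> {x \<otimes> y \<otimes> inv x \<otimes> inv y | x y. x \<in> lower_central_series (G\<lparr>carrier := H\<rparr>) n \<and> y \<in> H}"
      using Suc.IH S by blast
    then show "z \<in> lower_central_series (G\<lparr>carrier := H\<rparr>) (Suc n)"
      unfolding lower_central_series_Suc_subgroup(2)[OF H] by (rule generate.incl)
  qed
qed (use S in simp)

text \<open>Induction on the class: if the simple commutators of weight \<open>n + 1\<close> in the generators
  vanish modulo \<open>N\<close>, those of weight \<open>n\<close> are central modulo \<open>N\<close>.\<close>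

lemma lower_central_series_subset_normal:
  assumes S: "S \<subseteq> carrier G" "generate G S = carrier G" and N: "N \<lhd> G"
    and sc: "simple_commutators S n \<subseteq> N"
  shows "lower_central_series G n \<subseteq> N"
  using N sc
proof (induction n arbitrary: N)
  case 0
  then show ?case using generate_subgroup_incl[of S N] S(2) normal_imp_subgroup by auto
next
  case (Suc n)
  interpret N: normal N G by (rule Suc.prems)
  interpret h: group_hom G "G Mod N" "(#>) N" by (rule N.group_hom_Mod)
  have symm: "x \<otimes> y \<otimes> inv x \<otimes> inv y \<in> N \<longleftrightarrow> y \<otimes> x \<otimes> inv y \<otimes> inv x \<in> N"
    if "x \<in> carrier G" "y \<in> carrier G" for x y
    using N.comm_mem_iff[OF that] N.comm_mem_iff[OF that(2,1)] by auto
  \<comment> \<open>The preimage of the centre of \<open>G Mod N\<close>, which takes the place of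
    \<open>N\<close> in the induction.\<close>
  define Z where "Z = {z \<in> carrier G. \<forall>g\<in>carrier G. z \<otimes> g \<otimes> inv z \<otimes> inv g \<in> N}"
  have Zsub: "subgroup Z G" unfolding Z_def by (rule N.subgroup_centralizer_mod) simp
  have Z: "Z \<lhd> G"
    unfolding normal_inv_iff
  proof (intro conjI ballI Zsub)
    fix g z assume g: "g \<in> carrier G" and z: "z \<in> Z"
    have zc: "z \<in> carrier G" using z by (simp add: Z_def)
    have "g \<otimes> z \<otimes> inv g \<otimes> inv z \<in> N" using z symm[OF zc g] g by (simp add: Z_def)
    moreover have "N \<subseteq> Z"
    proof
      fix n assume n: "n \<in> N"
      then have nc: "n \<in> carrier G" by simp
      have "n \<otimes> g \<otimes> inv n \<otimes> inv g \<in> N" if g: "g \<in> carrier G" for g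
      proof -
        have "n \<otimes> (g \<otimes> inv n \<otimes> inv g) \<in> N" using n N.inv_op_closed2[OF g] by simp
        then show ?thesis using g nc by (simp add: m_assoc)
      qed
      then show "n \<in> Z" using nc by (simp add: Z_def)
    qed
    ultimately have "(g \<otimes> z \<otimes> inv g \<otimes> inv z) \<otimes> z \<in> Z"
      using z subgroup.m_closed[OF Zsub] by blast
    then show "g \<otimes> z \<otimes> inv g \<in> Z" using g zc by (simp add: m_assoc)
  qed
  have "simple_commutators S n \<subseteq> Z"
  proof
    fix x assume x: "x \<in> simple_commutators S n"
    have "subgroup (carrier G) G" by (rule subgroup_self)
    then have xc: "x \<in> carrier G"
      using x simple_commutators_subset[OF _ S(1), of n] lower_central_series_Suc_subgroup(1)[of "carrier G" n]
      by blast
    define C where "C = {c \<in> carrier G. \<forall>s\<in>{x}. c \<otimes> s \<otimes> inv c \<otimes> inv s \<in> N}"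
    have Csub: "subgroup C G" unfolding C_def by (rule N.subgroup_centralizer_mod) (simp add: xc)
    have "S \<subseteq> C"
    proof
      fix s assume s: "s \<in> S"
      then have sc: "s \<in> carrier G" using S by blast
      have "x \<otimes> s \<otimes> inv x \<otimes> inv s \<in> simple_commutators S (Suc n)"
        unfolding simple_commutators.simps(2) by (rule image_eqI[of _ _ "(x, s)"]) (use x s in simp_all)
      then have "x \<otimes> s \<otimes> inv x \<otimes> inv s \<in> N" using Suc.prems(2) by blast
      then show "s \<in> C" using symm[OF xc sc] sc by (simp add: C_def)
    qed
    then have "carrier G \<subseteq> C" using generate_subgroup_incl[OF _ Csub] S(2) by blast
    then show "x \<in> Z" using xc symm[OF xc] by (auto simp: Z_def C_def)
  qed
  then have IH: "lower_central_series G n \<subseteq> Z" using Z by (rule Suc.IH[rotated])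
  have "{x \<otimes> y \<otimes> inv x \<otimes> inv y | x y. x \<in> lower_central_series G n \<and> y \<in> carrier G} \<subseteq> N"
    using IH by (auto simp: Z_def)
  then show ?case
    unfolding lower_central_series.simps(2) by (rule generate_subgroup_incl[OF _ N.subgroup_axioms])
qed

text \<open>For normal \<open>N\<close> this is virtual nilpotency of the quotient by
  \<open>N\<close>, phrased in \<open>G\<close> so that different \<open>N\<close> can be compared
  and unions of chains taken.\<close>

definition virtually_nilpotent_mod :: "'a set \<Rightarrow> bool"
  where "virtually_nilpotent_mod N \<longleftrightarrow> (\<exists>H n. subgroup H G \<and> finite (rcosets H) \<and>
    lower_central_series (G\<lparr>carrier := H\<rparr>) n \<subseteq> N)"

lemma virtually_nilpotent_iff: "virtually_nilpotent G \<longleftrightarrow> virtually_nilpotent_mod {\<one>}"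
proof -
  have "lower_central_series (G\<lparr>carrier := H\<rparr>) n = {\<one>} \<longleftrightarrow> lower_central_series (G\<lparr>carrier := H\<rparr>) n \<subseteq> {\<one>}"
    if H: "subgroup H G" for H n
  proof -
    have "\<one> \<in> lower_central_series (G\<lparr>carrier := H\<rparr>) n"
    proof (cases n)
      case 0
      then show ?thesis using subgroup.one_closed[OF H] by simp
    next
      case (Suc k)
      show ?thesis unfolding Suc lower_central_series_Suc_subgroup(2)[OF H] by (rule generate.one)
    qed
    then show ?thesis by blast
  qed
  then have "nilpotent_group (G\<lparr>carrier := H\<rparr>) \<longleftrightarrow> (\<exists>n. lower_central_series (G\<lparr>carrier := H\<rparr>) n \<subseteq> {\<one>})"
    if H: "subgroup H G" for H
    unfolding nilpotent_group_def using H subgroup_group[OF H] by simp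
  then show ?thesis
    unfolding virtually_nilpotent_def virtually_nilpotent_mod_def by blast
qed

text \<open>The property is finitary: \<open>H\<close> is finitely generated, so only finitely many
  simple commutators have to lie in the union, and these already lie in one member of the
  chain.\<close>

lemma virtually_nilpotent_mod_Union_chain:
  assumes S: "finite S" "S \<subseteq> carrier G" "generate G S = carrier G"
    and C: "\<C> \<noteq> {}" "subset.chain A \<C>" "\<And>N. N \<in> \<C> \<Longrightarrow> N \<lhd> G"
    and vn: "virtually_nilpotent_mod (\<Union>\<C>)"
  shows "\<exists>N\<in>\<C>. virtually_nilpotent_mod N"
proof -
  obtain H n where H: "subgroup H G" "finite (rcosets H)"
    and n: "lower_central_series (G\<lparr>carrier := H\<rparr>) n \<subseteq> \<Union>\<C>"
    using vn unfolding virtually_nilpotent_mod_def by blast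
  interpret H: group "G\<lparr>carrier := H\<rparr>" by (rule subgroup_group[OF H(1)])
  obtain S' where S': "finite S'" "S' \<subseteq> H" "generate G S' = H"
    using finite_index_subgroup_finitely_generated[OF S H] by blast
  have "simple_commutators S' n \<subseteq> \<Union>\<C>" using simple_commutators_subset[OF H(1) S'(2), of n] n by blast
  then obtain N where N: "N \<in> \<C>" "simple_commutators S' n \<subseteq> N"
    using finite_subset_Union_chain[OF finite_simple_commutators[OF S'(1)] _ C(1,2)] by metis
  have gen: "generate (G\<lparr>carrier := H\<rparr>) S' = carrier (G\<lparr>carrier := H\<rparr>)"
    using generate_consistent[OF S'(2) H(1)] S'(3) by simp
  have nor: "N \<inter> H \<lhd> G\<lparr>carrier := H\<rparr>" using normal_Int_subgroup[OF H(1) C(3)[OF N(1)]] by (simp add: Int_commute)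
  have "H.simple_commutators S' n = simple_commutators S' n \<and> simple_commutators S' n \<subseteq> H"
  proof (induction n)
    case 0
    then show ?case using S' by simp
  next
    case (Suc n)
    then have IH: "H.simple_commutators S' n = simple_commutators S' n" "simple_commutators S' n \<subseteq> H" by auto
    have "H.simple_commutators S' (Suc n) = simple_commutators S' (Suc n)"
      unfolding simple_commutators.simps(2) H.simple_commutators.simps(2) IH(1)
    proof (rule image_cong[OF refl], clarify)
      fix x y assume "x \<in> simple_commutators S' n" "y \<in> S'"
      then have "x \<in> H" "y \<in> H" using IH(2) S'(2) by auto
      then show "x \<otimes>\<^bsub>G\<lparr>carrier := H\<rparr>\<^esub> y \<otimes>\<^bsub>G\<lparr>carrier := H\<rparr>\<^esub> inv\<^bsub>G\<lparr>carrier := H\<rparr>\<^esub> x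
          \<otimes>\<^bsub>G\<lparr>carrier := H\<rparr>\<^esub> inv\<^bsub>G\<lparr>carrier := H\<rparr>\<^esub> y = x \<otimes> y \<otimes> inv x \<otimes> inv y"
        using m_inv_consistent[OF H(1)] by simp
    qed
    moreover have "simple_commutators S' (Suc n) \<subseteq> H"
      using simple_commutators_subset[OF H(1) S'(2), of "Suc n"]
        lower_central_series_Suc_subgroup(1)[OF H(1), of "Suc n"] by blast
    ultimately show ?case by blast
  qed
  then have "H.simple_commutators S' n \<subseteq> N \<inter> H" using N(2) by auto
  then have "lower_central_series (G\<lparr>carrier := H\<rparr>) n \<subseteq> N \<inter> H"
    using H.lower_central_series_subset_normal[OF _ gen nor] S'(2) by simp
  then show ?thesis using N(1) H unfolding virtually_nilpotent_mod_def by blast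
qed

lemma normal_Union_chain:
  assumes C: "\<C> \<noteq> {}" "subset.chain A \<C>" "\<And>N. N \<in> \<C> \<Longrightarrow> N \<lhd> G"
  shows "\<Union>\<C> \<lhd> G"
  unfolding normal_inv_iff
proof (intro conjI ballI subgroupI)
  have sub: "subgroup N G" if "N \<in> \<C>" for N using C(3)[OF that] by (rule normal_imp_subgroup)
  show "\<Union>\<C> \<subseteq> carrier G" using subgroup.subset[OF sub] by blast
  show "\<Union>\<C> \<noteq> {}" using C(1) subgroup.one_closed[OF sub] by blast
  show "inv a \<in> \<Union>\<C>" if "a \<in> \<Union>\<C>" for a using that subgroup.m_inv_closed[OF sub] by blast
  show "a \<otimes> b \<in> \<Union>\<C>" if ab: "a \<in> \<Union>\<C>" "b \<in> \<Union>\<C>" for a b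
  proof -
    obtain N K where NK: "N \<in> \<C>" "a \<in> N" "K \<in> \<C>" "b \<in> K" using ab by blast
    have "N \<subseteq> K \<or> K \<subseteq> N" using C(2) NK unfolding subset_chain_def by blast
    then show ?thesis using NK subgroup.m_closed[OF sub[OF NK(1)], of a b] subgroup.m_closed[OF sub[OF NK(3)], of a b]
      by blast
  qed
  show "g \<otimes> a \<otimes> inv g \<in> \<Union>\<C>" if "g \<in> carrier G" "a \<in> \<Union>\<C>" for g a
    using that normal.inv_op_closed2[OF C(3)] by blast
qed

end

section \<open>Elements of finite conjugacy class in a quotient\<close>

lemma (in normal) exists_FC_element_mod:
  assumes "H \<noteq> carrier G" "\<not> (\<not> trivial_group (G Mod H) \<and> icc (G Mod H))"
  shows "\<exists>x\<in>carrier G. x \<notin> H \<and> finite (conjugacy_class (G Mod H) (H #> x))"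
proof -
  interpret h: group_hom G "G Mod H" "(#>) H" by (rule group_hom_Mod)
  have "\<not> trivial_group (G Mod H)"
  proof
    assume "trivial_group (G Mod H)"
    then have "carrier (G Mod H) = {\<one>\<^bsub>G Mod H\<^esub>}" by (auto simp: trivial_group_def)
    then have "H #> x = H" if "x \<in> carrier G" for x using h.hom_closed[OF that] by simp
    then have "carrier G \<subseteq> H" using rcos_eq_iff by blast
    then show False using assms(1) subset by blast
  qed
  then obtain C where C: "C \<in> carrier (G Mod H)" "C \<noteq> \<one>\<^bsub>G Mod H\<^esub>" "finite (conjugacy_class (G Mod H) C)"
    using assms(2) unfolding icc_def by blast
  then obtain x where x: "x \<in> carrier G" "C = H #> x" by (auto simp: FactGroup_def RCOSETS_def)
  then have "x \<notin> H" using C(2) rcos_eq_iff by auto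
  with x C(3) show ?thesis by blast
qed

text \<open>\<open>f g\<close> records how \<open>g\<close> permutes \<open>\<C>\<close> by
  conjugation; two elements with the same permutation differ by a centralizing element. The
  conclusion has the shape expected by \<open>finite_index_of_finite_range\<close>.\<close>

lemma (in group) finite_index_centralizer:
  assumes \<C>: "finite \<C>" "\<C> \<subseteq> carrier G" "\<And>g c. g \<in> carrier G \<Longrightarrow> c \<in> \<C> \<Longrightarrow> inv g \<otimes> c \<otimes> g \<in> \<C>"
  shows "\<exists>f :: 'a \<Rightarrow> 'a \<Rightarrow> 'a. finite (f ` carrier G) \<and> (\<forall>g\<in>carrier G. \<forall>g'\<in>carrier G. f g = f g' \<longrightarrow>
    (\<forall>c\<in>\<C>. (g \<otimes> inv g') \<otimes> c = c \<otimes> (g \<otimes> inv g')))"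
proof (intro exI[of _ "\<lambda>g. \<lambda>c\<in>\<C>. inv g \<otimes> c \<otimes> g"] conjI ballI impI)
  let ?f = "\<lambda>g. \<lambda>c\<in>\<C>. inv g \<otimes> c \<otimes> g"
  have "?f ` carrier G \<subseteq> \<C> \<rightarrow>\<^sub>E \<C>" using \<C>(3) by auto
  then show "finite (?f ` carrier G)" by (rule finite_subset) (intro finite_PiE \<C>(1))
  fix g g' c assume g: "g \<in> carrier G" "g' \<in> carrier G" and eq: "?f g = ?f g'" and c: "c \<in> \<C>"
  have cc: "c \<in> carrier G" using c \<C> by blast
  have e: "inv g \<otimes> c \<otimes> g = inv g' \<otimes> c \<otimes> g'" using fun_cong[OF eq, of c] c by simp
  have "(g \<otimes> inv g') \<otimes> c = g \<otimes> (inv g' \<otimes> c \<otimes> g') \<otimes> inv g'" using g cc by (simp add: word_simps)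
  also have "\<dots> = c \<otimes> (g \<otimes> inv g')" unfolding e[symmetric] using g cc by (simp add: word_simps)
  finally show "(g \<otimes> inv g') \<otimes> c = c \<otimes> (g \<otimes> inv g')" .
qed

lemma (in group) conjugacy_class_conj_closed:
  assumes "x \<in> carrier G" "c \<in> conjugacy_class G x" "g \<in> carrier G"
  shows "g \<otimes> c \<otimes> inv g \<in> conjugacy_class G x"
proof -
  obtain k where k: "k \<in> carrier G" "c = k \<otimes> x \<otimes> inv k" using assms(2) by (auto simp: conjugacy_class_def)
  have "g \<otimes> c \<otimes> inv g = (g \<otimes> k) \<otimes> x \<otimes> inv (g \<otimes> k)" using assms k by (simp add: word_simps)
  then show ?thesis using assms(3) k(1) unfolding conjugacy_class_def by blast
qed

text \<open>\<open>Cn\<close> centralises a finite conjugacy class modulo \<open>H\<close>; the elements that commute with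
  \<open>Cn\<close> modulo \<open>H\<close> form a strictly larger normal subgroup \<open>A\<close>, and \<open>A \<inter> Cn\<close> is central in \<open>Cn\<close>
  modulo \<open>H\<close>, which costs one nilpotency step.\<close>

lemma (in normal) FC_element_enlarges:
  assumes x: "x \<in> carrier G" "x \<notin> H" "finite (conjugacy_class (G Mod H) (H #> x))"
  shows "\<exists>A. A \<lhd> G \<and> H \<subset> A \<and> (virtually_nilpotent_mod A \<longrightarrow> virtually_nilpotent_mod H)"
proof -
  define Q where "Q = G Mod H"
  define \<phi> where "\<phi> = (\<lambda>x. H #> x)"
  interpret h: group_hom G Q \<phi> unfolding Q_def \<phi>_def by (rule group_hom_Mod)
  have surj: "\<exists>g\<in>carrier G. C = \<phi> g" if "C \<in> carrier Q" for C
    using that by (auto simp: Q_def \<phi>_def FactGroup_def RCOSETS_def)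
  have comm: "a \<otimes> b \<otimes> inv a \<otimes> inv b \<in> H \<longleftrightarrow> \<phi> a \<otimes>\<^bsub>Q\<^esub> \<phi> b = \<phi> b \<otimes>\<^bsub>Q\<^esub> \<phi> a"
    if "a \<in> carrier G" "b \<in> carrier G" for a b
    unfolding Q_def \<phi>_def by (rule comm_mem_iff[OF that])
  define X where "X = \<phi> x"
  have X: "X \<in> carrier Q" using x by (simp add: X_def)
  define \<C> where "\<C> = conjugacy_class Q X"
  have "finite \<C>"
    unfolding \<C>_def X_def Q_def \<phi>_def by (rule x(3))
  moreover have "\<C> \<subseteq> carrier Q"
    using X by (auto simp: \<C>_def conjugacy_class_def)
  ultimately have \<C>: "finite \<C>" "\<C> \<subseteq> carrier Q" by blast+
  have closed: "g \<otimes>\<^bsub>Q\<^esub> c \<otimes>\<^bsub>Q\<^esub> inv\<^bsub>Q\<^esub> g \<in> \<C>" if "g \<in> carrier Q" "c \<in> \<C>" for g c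
    using h.H.conjugacy_class_conj_closed[OF X] that by (simp add: \<C>_def)
  have closed': "inv\<^bsub>Q\<^esub> g \<otimes>\<^bsub>Q\<^esub> c \<otimes>\<^bsub>Q\<^esub> g \<in> \<C>" if "g \<in> carrier Q" "c \<in> \<C>" for g c
    using closed[of "inv\<^bsub>Q\<^esub> g" c] that by simp
  \<comment> \<open>Preimages in \<open>G\<close>: \<open>Cn\<close> is that of the centralizer of
    the class \<open>\<C>\<close>, and \<open>A\<close> that of the centralizer of the image of
    \<open>Cn\<close>. Both are normal because \<open>\<C>\<close> is invariant under
    conjugation.\<close>
  define pre where "pre = {g \<in> carrier G. \<phi> g \<in> \<C>}"
  define Cn where "Cn = {c \<in> carrier G. \<forall>s\<in>pre. c \<otimes> s \<otimes> inv c \<otimes> inv s \<in> H}"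
  have Cn: "subgroup Cn G" unfolding Cn_def by (rule subgroup_centralizer_mod) (auto simp: pre_def)
  define A where "A = {a \<in> carrier G. \<forall>s\<in>Cn. a \<otimes> s \<otimes> inv a \<otimes> inv s \<in> H}"
  have Asub: "subgroup A G" unfolding A_def by (rule subgroup_centralizer_mod) (auto simp: Cn_def)
  have Cn_iff: "g \<in> Cn \<longleftrightarrow> g \<in> carrier G \<and> (\<forall>c\<in>\<C>. \<phi> g \<otimes>\<^bsub>Q\<^esub> c = c \<otimes>\<^bsub>Q\<^esub> \<phi> g)" for g
  proof
    assume g: "g \<in> Cn"
    then have gc: "g \<in> carrier G" by (simp add: Cn_def)
    have "\<phi> g \<otimes>\<^bsub>Q\<^esub> c = c \<otimes>\<^bsub>Q\<^esub> \<phi> g" if c: "c \<in> \<C>" for c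
    proof -
      obtain k where k: "k \<in> carrier G" "c = \<phi> k" using surj c \<C>(2) by blast
      then have "g \<otimes> k \<otimes> inv g \<otimes> inv k \<in> H" using g c by (simp add: Cn_def pre_def)
      then show ?thesis using comm[OF gc k(1)] k(2) by simp
    qed
    with gc show "g \<in> carrier G \<and> (\<forall>c\<in>\<C>. \<phi> g \<otimes>\<^bsub>Q\<^esub> c = c \<otimes>\<^bsub>Q\<^esub> \<phi> g)" by blast
  next
    assume g: "g \<in> carrier G \<and> (\<forall>c\<in>\<C>. \<phi> g \<otimes>\<^bsub>Q\<^esub> c = c \<otimes>\<^bsub>Q\<^esub> \<phi> g)"
    have "g \<otimes> s \<otimes> inv g \<otimes> inv s \<in> H" if "s \<in> pre" for s
      using comm[of g s] g that by (simp add: pre_def)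
    with g show "g \<in> Cn" by (simp add: Cn_def)
  qed
  have conj_comm: "(g \<otimes>\<^bsub>Q\<^esub> a \<otimes>\<^bsub>Q\<^esub> inv\<^bsub>Q\<^esub> g) \<otimes>\<^bsub>Q\<^esub> b = b \<otimes>\<^bsub>Q\<^esub> (g \<otimes>\<^bsub>Q\<^esub> a \<otimes>\<^bsub>Q\<^esub> inv\<^bsub>Q\<^esub> g)"
    if c: "g \<in> carrier Q" "a \<in> carrier Q" "b \<in> carrier Q"
    and ab: "a \<otimes>\<^bsub>Q\<^esub> (inv\<^bsub>Q\<^esub> g \<otimes>\<^bsub>Q\<^esub> b \<otimes>\<^bsub>Q\<^esub> g) = (inv\<^bsub>Q\<^esub> g \<otimes>\<^bsub>Q\<^esub> b \<otimes>\<^bsub>Q\<^esub> g) \<otimes>\<^bsub>Q\<^esub> a" for g a b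
  proof -
    have "(g \<otimes>\<^bsub>Q\<^esub> a \<otimes>\<^bsub>Q\<^esub> inv\<^bsub>Q\<^esub> g) \<otimes>\<^bsub>Q\<^esub> b = g \<otimes>\<^bsub>Q\<^esub> (a \<otimes>\<^bsub>Q\<^esub> (inv\<^bsub>Q\<^esub> g \<otimes>\<^bsub>Q\<^esub> b \<otimes>\<^bsub>Q\<^esub> g)) \<otimes>\<^bsub>Q\<^esub> inv\<^bsub>Q\<^esub> g"
      using c by (simp add: h.H.word_simps)
    also have "\<dots> = b \<otimes>\<^bsub>Q\<^esub> (g \<otimes>\<^bsub>Q\<^esub> a \<otimes>\<^bsub>Q\<^esub> inv\<^bsub>Q\<^esub> g)"
      unfolding ab using c by (simp add: h.H.word_simps)
    finally show ?thesis .
  qed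
  have Cn_conj: "inv g \<otimes> c \<otimes> g \<in> Cn" if g: "g \<in> carrier G" and c: "c \<in> Cn" for g c
  proof -
    have cc: "c \<in> carrier G" using c by (simp add: Cn_def)
    have gQ: "inv\<^bsub>Q\<^esub> (\<phi> g) \<in> carrier Q" "\<phi> c \<in> carrier Q" using g cc by simp_all
    have "\<phi> (inv g \<otimes> c \<otimes> g) \<otimes>\<^bsub>Q\<^esub> d = d \<otimes>\<^bsub>Q\<^esub> \<phi> (inv g \<otimes> c \<otimes> g)" if d: "d \<in> \<C>" for d
    proof -
      have dQ: "d \<in> carrier Q" using d \<C> by blast
      have "inv\<^bsub>Q\<^esub> (inv\<^bsub>Q\<^esub> (\<phi> g)) \<otimes>\<^bsub>Q\<^esub> d \<otimes>\<^bsub>Q\<^esub> inv\<^bsub>Q\<^esub> (\<phi> g) \<in> \<C>" by (rule closed'[OF gQ(1) d])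
      then have "\<phi> c \<otimes>\<^bsub>Q\<^esub> (inv\<^bsub>Q\<^esub> (inv\<^bsub>Q\<^esub> (\<phi> g)) \<otimes>\<^bsub>Q\<^esub> d \<otimes>\<^bsub>Q\<^esub> inv\<^bsub>Q\<^esub> (\<phi> g))
          = (inv\<^bsub>Q\<^esub> (inv\<^bsub>Q\<^esub> (\<phi> g)) \<otimes>\<^bsub>Q\<^esub> d \<otimes>\<^bsub>Q\<^esub> inv\<^bsub>Q\<^esub> (\<phi> g)) \<otimes>\<^bsub>Q\<^esub> \<phi> c"
        using c Cn_iff by blast
      from conj_comm[OF gQ dQ this] show ?thesis using g cc by simp
    qed
    then show ?thesis unfolding Cn_iff using g cc by simp
  qed
  have A: "A \<lhd> G"
    unfolding normal_inv_iff
  proof (intro conjI ballI Asub)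
    fix g a assume g: "g \<in> carrier G" and a: "a \<in> A"
    have ac: "a \<in> carrier G" using a by (simp add: A_def)
    have "(g \<otimes> a \<otimes> inv g) \<otimes> s \<otimes> inv (g \<otimes> a \<otimes> inv g) \<otimes> inv s \<in> H" if s: "s \<in> Cn" for s
    proof -
      have sc: "s \<in> carrier G" using s by (simp add: Cn_def)
      have gs: "inv g \<otimes> s \<otimes> g \<in> Cn" by (rule Cn_conj[OF g s])
      then have "\<phi> a \<otimes>\<^bsub>Q\<^esub> \<phi> (inv g \<otimes> s \<otimes> g) = \<phi> (inv g \<otimes> s \<otimes> g) \<otimes>\<^bsub>Q\<^esub> \<phi> a"
        using a comm[OF ac, of "inv g \<otimes> s \<otimes> g"] sc g by (simp add: A_def)
      then have "\<phi> (g \<otimes> a \<otimes> inv g) \<otimes>\<^bsub>Q\<^esub> \<phi> s = \<phi> s \<otimes>\<^bsub>Q\<^esub> \<phi> (g \<otimes> a \<otimes> inv g)"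
        using conj_comm[of "\<phi> g" "\<phi> a" "\<phi> s"] g ac sc by simp
      then show ?thesis using comm[of "g \<otimes> a \<otimes> inv g" s] g ac sc by simp
    qed
    then show "g \<otimes> a \<otimes> inv g \<in> A" using g ac by (simp add: A_def)
  qed
  have "X = \<one>\<^bsub>Q\<^esub> \<otimes>\<^bsub>Q\<^esub> X \<otimes>\<^bsub>Q\<^esub> inv\<^bsub>Q\<^esub> \<one>\<^bsub>Q\<^esub>" using X by simp
  then have XC: "X \<in> \<C>" unfolding \<C>_def conjugacy_class_def using h.H.one_closed by blast
  have HA: "H \<subseteq> A"
  proof
    fix n assume n: "n \<in> H"
    then have nc: "n \<in> carrier G" by simp
    have "n \<otimes> g \<otimes> inv n \<otimes> inv g \<in> H" if g: "g \<in> Cn" for g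
    proof -
      have gc: "g \<in> carrier G" using g by (simp add: Cn_def)
      have "n \<otimes> (g \<otimes> inv n \<otimes> inv g) \<in> H" using n inv_op_closed2[OF gc] by simp
      then show ?thesis using gc nc by (simp add: m_assoc)
    qed
    then show "n \<in> A" using nc by (simp add: A_def)
  qed
  have "x \<in> A"
  proof -
    have "x \<otimes> s \<otimes> inv x \<otimes> inv s \<in> H" if s: "s \<in> Cn" for s
    proof -
      have sc: "s \<in> carrier G" using s by (simp add: Cn_def)
      have "\<phi> s \<otimes>\<^bsub>Q\<^esub> X = X \<otimes>\<^bsub>Q\<^esub> \<phi> s" using s XC Cn_iff by blast
      then show ?thesis using comm[OF x(1) sc] by (simp add: X_def)
    qed
    then show ?thesis using x(1) by (simp add: A_def)
  qed
  then have "H \<subset> A" using HA x(2) by blast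
  moreover have "virtually_nilpotent_mod H" if vn: "virtually_nilpotent_mod A"
  proof -
    obtain K n where K: "subgroup K G" "finite (rcosets K)"
      and n: "lower_central_series (G\<lparr>carrier := K\<rparr>) n \<subseteq> A"
      using vn unfolding virtually_nilpotent_mod_def by blast
    obtain f :: "'a set \<Rightarrow> 'a set \<Rightarrow> 'a set" where f: "finite (f ` carrier Q)"
      "\<forall>g\<in>carrier Q. \<forall>g'\<in>carrier Q. f g = f g' \<longrightarrow>
        (\<forall>c\<in>\<C>. (g \<otimes>\<^bsub>Q\<^esub> inv\<^bsub>Q\<^esub> g') \<otimes>\<^bsub>Q\<^esub> c = c \<otimes>\<^bsub>Q\<^esub> (g \<otimes>\<^bsub>Q\<^esub> inv\<^bsub>Q\<^esub> g'))"
    proof -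
      have "\<exists>f :: 'a set \<Rightarrow> 'a set \<Rightarrow> 'a set. finite (f ` carrier Q) \<and>
          (\<forall>g\<in>carrier Q. \<forall>g'\<in>carrier Q. f g = f g' \<longrightarrow>
          (\<forall>c\<in>\<C>. (g \<otimes>\<^bsub>Q\<^esub> inv\<^bsub>Q\<^esub> g') \<otimes>\<^bsub>Q\<^esub> c = c \<otimes>\<^bsub>Q\<^esub> (g \<otimes>\<^bsub>Q\<^esub> inv\<^bsub>Q\<^esub> g')))"
        by (rule h.H.finite_index_centralizer[OF \<C>]) (rule closed')
      then show thesis using that by (elim exE conjE)
    qed
    have "finite (rcosets Cn)"
    proof (rule finite_index_of_finite_range[OF Cn, where f = "\<lambda>g. f (\<phi> g)"])
      have "(\<lambda>g. f (\<phi> g)) ` carrier G \<subseteq> f ` carrier Q" by auto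
      then show "finite ((\<lambda>g. f (\<phi> g)) ` carrier G)" using f(1) by (rule finite_subset)
      fix g g' assume g: "g \<in> carrier G" "g' \<in> carrier G" "f (\<phi> g) = f (\<phi> g')"
      then show "g \<otimes> inv g' \<in> Cn"
        unfolding Cn_iff using f(2)[rule_format, of "\<phi> g" "\<phi> g'"] by simp
    qed
    then have fin: "finite (rcosets (K \<inter> Cn))" by (intro finite_index_Int K Cn)
    have KC: "subgroup (K \<inter> Cn) G" by (intro subgroups_Inter_pair K Cn)
    have "lower_central_series (G\<lparr>carrier := K \<inter> Cn\<rparr>) (Suc n) \<subseteq> H"
      unfolding lower_central_series_Suc_subgroup(2)[OF KC]
    proof (rule generate_subgroup_incl[OF _ subgroup_axioms])
      have "lower_central_series (G\<lparr>carrier := K \<inter> Cn\<rparr>) n \<subseteq> A"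
        using lower_central_series_mono[OF KC K(1), of n] n by blast
      then show "{x \<otimes> y \<otimes> inv x \<otimes> inv y | x y. x \<in> lower_central_series (G\<lparr>carrier := K \<inter> Cn\<rparr>) n
          \<and> y \<in> K \<inter> Cn} \<subseteq> H"
        by (auto simp: A_def)
    qed
    then show ?thesis using KC fin unfolding virtually_nilpotent_mod_def by blast
  qed
  ultimately show ?thesis using A by blast
qed

lemma (in group) no_icc_quotient_imp_virtually_nilpotent:
  assumes fg: "finitely_generated_group G"
    and no: "\<not> (\<exists>N. N \<lhd> G \<and> \<not> trivial_group (G Mod N) \<and> icc (G Mod N))"
  shows "virtually_nilpotent G"
proof (rule ccontr)
  obtain S where S: "finite S" "S \<subseteq> carrier G" "generate G S = carrier G"
    using fg by (auto simp: finitely_generated_group_def)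
  assume "\<not> virtually_nilpotent G"
  then have one: "\<not> virtually_nilpotent_mod {\<one>}" by (simp add: virtually_nilpotent_iff)
  let ?\<N> = "{N. N \<lhd> G \<and> \<not> virtually_nilpotent_mod N}"
  have "\<exists>M\<in>?\<N>. \<forall>X\<in>?\<N>. M \<subseteq> X \<longrightarrow> X = M"
  proof (rule subset_Zorn_nonempty)
    show "?\<N> \<noteq> {}" using one one_is_normal by blast
    fix \<C> assume C: "\<C> \<noteq> {}" "subset.chain ?\<N> \<C>"
    then have CN: "\<C> \<subseteq> ?\<N>" by (simp add: subset_chain_def)
    have "\<Union>\<C> \<lhd> G" by (rule normal_Union_chain[OF C]) (use CN in blast)
    moreover have "\<not> virtually_nilpotent_mod (\<Union>\<C>)"
      using virtually_nilpotent_mod_Union_chain[OF S C] CN by blast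
    ultimately show "\<Union>\<C> \<in> ?\<N>" by blast
  qed
  then obtain N where N: "N \<lhd> G" "\<not> virtually_nilpotent_mod N"
    and max: "\<And>X. X \<lhd> G \<Longrightarrow> \<not> virtually_nilpotent_mod X \<Longrightarrow> N \<subseteq> X \<Longrightarrow> X = N" by blast
  interpret N: normal N G by (rule N)
  \<comment> \<open>The whole group lies outside the family given to Zorn's lemma, so the maximal
    \<open>N\<close> is proper and its quotient nontrivial.\<close>
  have "virtually_nilpotent_mod (carrier G)"
    unfolding virtually_nilpotent_mod_def
  proof (intro exI conjI)
    show "subgroup (carrier G) G" by (rule subgroup_self)
    have "\<exists>T. finite T \<and> T \<subseteq> carrier G \<and> (\<forall>g\<in>carrier G. \<exists>t\<in>T. g \<otimes> inv t \<in> carrier G)"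
      by (intro exI[of _ "{\<one>}"]) auto
    then show "finite (rcosets (carrier G))" by (simp add: finite_index_iff[OF subgroup_self])
    show "lower_central_series (G\<lparr>carrier := carrier G\<rparr>) 0 \<subseteq> carrier G" by simp
  qed
  then have "N \<noteq> carrier G" using N(2) by blast
  then obtain x where "x \<in> carrier G" "x \<notin> N" "finite (conjugacy_class (G Mod N) (N #> x))"
    using N.exists_FC_element_mod no N(1) by blast
  then obtain A where A: "A \<lhd> G" "N \<subset> A" "virtually_nilpotent_mod A \<longrightarrow> virtually_nilpotent_mod N"
    using N.FC_element_enlarges by blast
  then show False using max[of A] N(2) by blast
qed

text \<open>An element of the quotient commuting with the image of the finite index subgroup
  \<open>H\<close> has a finite class, hence is trivial under ICC. Going up the lower central series
  of \<open>H\<close> from its trivial end, each term falls into \<open>N\<close> in turn, and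
  finally \<open>H\<close> itself. Every element then commutes with the trivial image of
  \<open>H\<close>, and the quotient is trivial.\<close>

lemma (in group) virtually_nilpotent_imp_no_icc_quotient:
  assumes vn: "virtually_nilpotent G" and N: "N \<lhd> G"
    and nontriv: "\<not> trivial_group (G Mod N)" and icc: "icc (G Mod N)"
  shows False
proof -
  interpret N: normal N G by (rule N)
  define Q where "Q = G Mod N"
  define \<phi> where "\<phi> = (\<lambda>x. N #> x)"
  interpret h: group_hom G Q \<phi> unfolding Q_def \<phi>_def by (rule N.group_hom_Mod)
  have surj: "\<exists>g\<in>carrier G. C = \<phi> g" if "C \<in> carrier Q" for C
    using that by (auto simp: Q_def \<phi>_def FactGroup_def RCOSETS_def)
  obtain H n where H: "subgroup H G" "finite (rcosets H)"
    and n: "lower_central_series (G\<lparr>carrier := H\<rparr>) n \<subseteq> {\<one>}"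
    using vn unfolding virtually_nilpotent_iff virtually_nilpotent_mod_def by blast
  interpret H: subgroup H G by (rule H)
  obtain T where T: "finite T" "T \<subseteq> carrier G" and cov: "\<And>g. g \<in> carrier G \<Longrightarrow> \<exists>t\<in>T. g \<otimes> inv t \<in> H"
    using finite_index_iff[OF H(1)] H(2) by blast
  \<comment> \<open>The conjugate of \<open>\<phi> x\<close> by \<open>g\<close> depends only on the
    left coset \<open>g H\<close>, and there are finitely many of these.\<close>
  have fin: "finite (conjugacy_class Q (\<phi> x))"
    if x: "x \<in> carrier G" and comm: "\<And>h. h \<in> H \<Longrightarrow> \<phi> x \<otimes>\<^bsub>Q\<^esub> \<phi> h = \<phi> h \<otimes>\<^bsub>Q\<^esub> \<phi> x" for x
  proof (rule finite_subset)
    show "conjugacy_class Q (\<phi> x) \<subseteq> (\<lambda>t. \<phi> (inv t) \<otimes>\<^bsub>Q\<^esub> \<phi> x \<otimes>\<^bsub>Q\<^esub> \<phi> t) ` T"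
    proof
      fix C assume "C \<in> conjugacy_class Q (\<phi> x)"
      then obtain k where k: "k \<in> carrier Q" "C = k \<otimes>\<^bsub>Q\<^esub> \<phi> x \<otimes>\<^bsub>Q\<^esub> inv\<^bsub>Q\<^esub> k"
        by (auto simp: conjugacy_class_def)
      obtain g where g: "g \<in> carrier G" "k = \<phi> g" using surj k by blast
      obtain t where t: "t \<in> T" "inv g \<otimes> inv t \<in> H" using cov[of "inv g"] g by auto
      define h where "h = inv g \<otimes> inv t"
      have tc: "t \<in> carrier G" "h \<in> carrier G" "h \<in> H" using t T g by (auto simp: h_def)
      have geq: "g = inv t \<otimes> inv h" using g(1) tc(1) by (simp add: h_def word_simps)
      have c: "\<phi> x \<in> carrier Q" "\<phi> h \<in> carrier Q" "\<phi> t \<in> carrier Q" using x tc by simp_all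
      have "C = inv\<^bsub>Q\<^esub> \<phi> t \<otimes>\<^bsub>Q\<^esub> inv\<^bsub>Q\<^esub> \<phi> h \<otimes>\<^bsub>Q\<^esub> (\<phi> x \<otimes>\<^bsub>Q\<^esub> \<phi> h) \<otimes>\<^bsub>Q\<^esub> \<phi> t"
        unfolding k(2) g(2) geq using tc c by (simp add: h.H.word_simps)
      also have "\<dots> = inv\<^bsub>Q\<^esub> \<phi> t \<otimes>\<^bsub>Q\<^esub> \<phi> x \<otimes>\<^bsub>Q\<^esub> \<phi> t"
        unfolding comm[OF tc(3)] using c by (simp add: h.H.word_simps)
      finally show "C \<in> (\<lambda>t. \<phi> (inv t) \<otimes>\<^bsub>Q\<^esub> \<phi> x \<otimes>\<^bsub>Q\<^esub> \<phi> t) ` T"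
        using t(1) tc(1) by (intro image_eqI[of _ _ t]) simp_all
    qed
  qed (use T in simp)
  have no: "\<phi> x = \<one>\<^bsub>Q\<^esub>" if "x \<in> carrier G" "\<And>h. h \<in> H \<Longrightarrow> \<phi> x \<otimes>\<^bsub>Q\<^esub> \<phi> h = \<phi> h \<otimes>\<^bsub>Q\<^esub> \<phi> x" for x
    using fin[OF that] icc h.hom_closed[OF that(1)] unfolding icc_def Q_def[symmetric] by blast
  have in_N: "x \<in> N" if "x \<in> carrier G" "\<phi> x = \<one>\<^bsub>Q\<^esub>" for x
    using that N.rcos_eq_iff by (simp add: Q_def \<phi>_def)
  have comm: "a \<otimes> b \<otimes> inv a \<otimes> inv b \<in> N \<longleftrightarrow> \<phi> a \<otimes>\<^bsub>Q\<^esub> \<phi> b = \<phi> b \<otimes>\<^bsub>Q\<^esub> \<phi> a"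
    if "a \<in> carrier G" "b \<in> carrier G" for a b
    unfolding Q_def \<phi>_def by (rule N.comm_mem_iff[OF that])
  have down: "lower_central_series (G\<lparr>carrier := H\<rparr>) i \<subseteq> N"
    if i: "lower_central_series (G\<lparr>carrier := H\<rparr>) (Suc i) \<subseteq> N" for i
  proof
    fix x assume x: "x \<in> lower_central_series (G\<lparr>carrier := H\<rparr>) i"
    then have xc: "x \<in> carrier G" using lower_central_series_Suc_subgroup(1)[OF H(1), of i] H.subset by blast
    have "\<phi> x \<otimes>\<^bsub>Q\<^esub> \<phi> h = \<phi> h \<otimes>\<^bsub>Q\<^esub> \<phi> x" if h: "h \<in> H" for h
    proof -
      have "x \<otimes> h \<otimes> inv x \<otimes> inv h \<in> lower_central_series (G\<lparr>carrier := H\<rparr>) (Suc i)"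
        unfolding lower_central_series_Suc_subgroup(2)[OF H(1)] using x h by (intro generate.incl) blast
      then show ?thesis using i comm[OF xc H.mem_carrier[OF h]] by blast
    qed
    then show "x \<in> N" using no[OF xc] in_N[OF xc] by blast
  qed
  have "lower_central_series (G\<lparr>carrier := H\<rparr>) n \<subseteq> N" using n N.one_closed by blast
  then have "lower_central_series (G\<lparr>carrier := H\<rparr>) 0 \<subseteq> N"
  proof (induction n)
    case (Suc n)
    then show ?case using down by blast
  qed
  then have HN: "H \<subseteq> N" by simp
  have "\<phi> x \<otimes>\<^bsub>Q\<^esub> \<phi> h = \<phi> h \<otimes>\<^bsub>Q\<^esub> \<phi> x" if x: "x \<in> carrier G" and h: "h \<in> H" for x h
  proof -
    have "\<phi> h = \<one>\<^bsub>Q\<^esub>" using h HN N.rcos_eq_iff[of h] H.mem_carrier[OF h] by (auto simp: Q_def \<phi>_def)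
    then show ?thesis using x by simp
  qed
  then have "\<phi> x = \<one>\<^bsub>Q\<^esub>" if "x \<in> carrier G" for x using no that by blast
  then have "carrier Q = {\<one>\<^bsub>Q\<^esub>}" using surj by blast
  then show False using nontriv h.H.is_group by (simp add: Q_def trivial_group_def)
qed

section \<open>Proximal actions of groups without ICC quotients\<close>

lemma limitin_mono_filter:
  assumes "limitin X f l F" "F' \<le> F"
  shows "limitin X f l F'"
  using assms unfolding limitin_def by (meson filter_leD)

lemma limitin_mem_closedin:
  assumes lim: "limitin X f l F" and S: "closedin X S" and ev: "\<forall>\<^sub>F x in F. f x \<in> S" and F: "F \<noteq> bot"
  shows "l \<in> S"
proof (rule ccontr)
  assume "l \<notin> S"
  then have "l \<in> topspace X - S" using limitin_topspace[OF lim] by simp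
  moreover have "openin X (topspace X - S)" using S by (simp add: closedin_def)
  ultimately have "\<forall>\<^sub>F x in F. f x \<in> topspace X - S" by (intro limitinD[OF lim])
  with ev have "\<forall>\<^sub>F x in F. False" by eventually_elim simp
  with F show False by simp
qed

lemma Hausdorff_spaceD:
  assumes "Hausdorff_space X" "x \<in> topspace X" "y \<in> topspace X" "x \<noteq> y"
  shows "\<exists>U V. openin X U \<and> openin X V \<and> x \<in> U \<and> y \<in> V \<and> disjnt U V"
  using assms by (simp add: Hausdorff_space_def)

lemma limitin_unique_Hausdorff:
  assumes l: "limitin X f l F" and k: "limitin X f k F" and F: "F \<noteq> bot" and X: "Hausdorff_space X"
  shows "l = k"
proof (rule ccontr)
  assume "l \<noteq> k"
  from Hausdorff_spaceD[OF X limitin_topspace[OF l] limitin_topspace[OF k] this]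
  obtain U V where U: "openin X U" "openin X V" "l \<in> U" "k \<in> V" "disjnt U V" by (elim exE conjE)
  from limitinD[OF l U(1,3)] limitinD[OF k U(2,4)] have "\<forall>\<^sub>F x in F. False"
  proof eventually_elim
    case (elim x)
    with U(5) show ?case by (auto simp: disjnt_iff)
  qed
  with F show False by simp
qed

lemma closedin_fixed_points:
  assumes X: "Hausdorff_space X" and f: "continuous_map X X f"
  shows "closedin X {z \<in> topspace X. f z = z}"
proof -
  let ?D = "topspace X - {z \<in> topspace X. f z = z}"
  have "openin X ?D"
  proof (subst openin_subopen, intro ballI)
    fix z assume z: "z \<in> ?D"
    then have zX: "z \<in> topspace X" "f z \<noteq> z" by auto
    have "f z \<in> topspace X" using f zX(1) by (auto simp: continuous_map_def)
    from Hausdorff_spaceD[OF X this zX]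
    obtain U V where U: "openin X U" "openin X V" "f z \<in> U" "z \<in> V" "disjnt U V" by (elim exE conjE)
    let ?W = "{x \<in> topspace X. f x \<in> U} \<inter> V"
    have "openin X ?W" by (intro openin_Int openin_continuous_map_preimage[OF f U(1)] U(2))
    moreover have "z \<in> ?W" using zX U by simp
    moreover have "?W \<subseteq> ?D" using U(5) by (auto simp: disjnt_iff)
    ultimately show "\<exists>T. openin X T \<and> z \<in> T \<and> T \<subseteq> ?D" by (intro exI[of _ ?W] conjI)
  qed
  then show ?thesis by (simp add: closedin_def)
qed

lemma action_facts:
  assumes act: "continuous_action G E \<alpha>"
  shows "group G"
    and "\<And>g x. g \<in> carrier G \<Longrightarrow> x \<in> topspace E \<Longrightarrow> \<alpha> g x \<in> topspace E"
    and "\<And>g h x. g \<in> carrier G \<Longrightarrow> h \<in> carrier G \<Longrightarrow> x \<in> topspace E \<Longrightarrow>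
      \<alpha> (g \<otimes>\<^bsub>G\<^esub> h) x = \<alpha> g (\<alpha> h x)"
    and "\<And>x. x \<in> topspace E \<Longrightarrow> \<alpha> \<one>\<^bsub>G\<^esub> x = x"
    and "\<And>g. g \<in> carrier G \<Longrightarrow> continuous_map E E (\<alpha> g)"
proof -
  interpret act: group_action G "topspace E" \<alpha>
    using act by (simp add: continuous_action_def)
  show "group G" by (rule group_hom.axioms(1)[OF act.group_hom])
  show "\<alpha> g x \<in> topspace E" if "g \<in> carrier G" "x \<in> topspace E" for g x
    using that by (rule act.element_image[OF _ _ refl])
  show "\<alpha> (g \<otimes>\<^bsub>G\<^esub> h) x = \<alpha> g (\<alpha> h x)"
    if "g \<in> carrier G" "h \<in> carrier G" "x \<in> topspace E" for g h x
    using act.composition_rule[OF that(3,1,2)] .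
  show "\<alpha> \<one>\<^bsub>G\<^esub> x = x" if "x \<in> topspace E" for x
    using act.id_eq_one that by (metis restrict_apply')
  show "continuous_map E E (\<alpha> g)" if "g \<in> carrier G" for g
    using act that by (simp add: continuous_action_def)
qed

text \<open>An action of the quotient is an action of \<open>G\<close> through the quotient map,
  with the same fixed points. Proximality lifts because a filter on the quotient can be pushed
  forward along a section \<open>s\<close>.\<close>

theorem strongly_amenable_on_quotient:
  assumes N: "N \<lhd> G" and sa: "strongly_amenable_on TYPE('x) G"
  shows "strongly_amenable_on TYPE('x) (G Mod N)"
  unfolding strongly_amenable_on_def
proof (intro allI impI, elim conjE)
  fix E :: "'x topology" and \<alpha>
  assume E: "compact_space E" "Hausdorff_space E" "topspace E \<noteq> {}"
    and act: "continuous_action (G Mod N) E \<alpha>" and prox: "proximal_action (G Mod N) E \<alpha>"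
  interpret N: normal N G by (rule N)
  define Q where "Q = G Mod N"
  define \<phi> where "\<phi> = (\<lambda>g. N #>\<^bsub>G\<^esub> g)"
  interpret h: group_hom G Q \<phi> unfolding Q_def \<phi>_def by (rule N.group_hom_Mod)
  have "\<exists>g\<in>carrier G. C = \<phi> g" if "C \<in> carrier Q" for C
    using that by (auto simp: Q_def \<phi>_def FactGroup_def RCOSETS_def)
  then obtain s where s: "\<And>C. C \<in> carrier Q \<Longrightarrow> s C \<in> carrier G \<and> \<phi> (s C) = C" by metis
  define \<beta> where "\<beta> g = \<alpha> (\<phi> g)" for g
  have "group_hom Q (BijGroup (topspace E)) \<alpha>"
    using act by (simp add: continuous_action_def group_action_def Q_def)
  then interpret a: group_hom Q "BijGroup (topspace E)" \<alpha> .
  have "group_hom G (BijGroup (topspace E)) \<beta>"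
    by (intro group_hom.intro group_hom_axioms.intro homI)
      (simp_all add: \<beta>_def group_BijGroup)
  then have "continuous_action G E \<beta>"
    using act h.hom_closed by (simp add: continuous_action_def group_action_def \<beta>_def flip: Q_def)
  moreover have "proximal_action G E \<beta>"
    unfolding proximal_action_def
  proof (intro ballI)
    fix x y assume xy: "x \<in> topspace E" "y \<in> topspace E"
    obtain F z where F: "F \<noteq> bot" "\<forall>\<^sub>F C in F. C \<in> carrier Q"
      and lim: "limitin E (\<lambda>C. \<alpha> C x) z F" "limitin E (\<lambda>C. \<alpha> C y) z F"
      using prox xy unfolding proximal_action_def Q_def by blast
    have l: "limitin E (\<lambda>g. \<beta> g w) z (filtermap s F)" if "limitin E (\<lambda>C. \<alpha> C w) z F" for w
    proof -
      have "\<forall>\<^sub>F C in F. \<alpha> C w = \<beta> (s C) w"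
        using F(2) by eventually_elim (simp add: \<beta>_def s)
      then have "limitin E (\<lambda>C. \<beta> (s C) w) z F" using that by (rule limitin_transform_eventually)
      then show ?thesis by (simp add: limitin_def eventually_filtermap)
    qed
    have "filtermap s F \<noteq> bot" using F(1) by (simp add: filtermap_bot_iff)
    moreover have "\<forall>\<^sub>F g in filtermap s F. g \<in> carrier G"
      unfolding eventually_filtermap using F(2) by eventually_elim (simp add: s)
    ultimately show "\<exists>F z. F \<noteq> bot \<and> (\<forall>\<^sub>F g in F. g \<in> carrier G) \<and>
       limitin E (\<lambda>g. \<beta> g x) z F \<and> limitin E (\<lambda>g. \<beta> g y) z F"
      using l lim by blast
  qed
  ultimately have "compact_space E \<and> Hausdorff_space E \<and> topspace E \<noteq> {} \<and>
      continuous_action G E \<beta> \<and> proximal_action G E \<beta>"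
    using E by blast
  then have "\<exists>x\<in>topspace E. \<forall>g\<in>carrier G. \<beta> g x = x"
    by (rule mp[OF sa[unfolded strongly_amenable_on_def, THEN spec, THEN spec]])
  then obtain x where x: "x \<in> topspace E" "\<forall>g\<in>carrier G. \<beta> g x = x" by blast
  have "\<alpha> C x = x" if "C \<in> carrier Q" for C
    using x(2) s[OF that] unfolding \<beta>_def by metis
  then show "\<exists>x\<in>topspace E. \<forall>g\<in>carrier (G Mod N). \<alpha> g x = x"
    using x(1) unfolding Q_def by blast
qed

text \<open>Zorn's lemma is applied to the open complements: the union of a chain of proper ones is
  again proper, because by compactness it would otherwise equal one of them.\<close>

lemma exists_minimal_invariant_closed:
  assumes E: "compact_space E" "topspace E \<noteq> {}"
    and inE: "\<forall>g\<in>A. \<forall>x\<in>topspace E. \<alpha> g x \<in> topspace E"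
  obtains M where "closedin E M" "M \<noteq> {}" "\<And>g x. g \<in> A \<Longrightarrow> x \<in> M \<Longrightarrow> \<alpha> g x \<in> M"
    "\<And>K. closedin E K \<Longrightarrow> K \<noteq> {} \<Longrightarrow> K \<subseteq> M \<Longrightarrow> (\<And>g x. g \<in> A \<Longrightarrow> x \<in> K \<Longrightarrow> \<alpha> g x \<in> K) \<Longrightarrow> K = M"
proof -
  let ?\<U> = "{U. openin E U \<and> U \<noteq> topspace E \<and> (\<forall>g\<in>A. \<forall>x\<in>topspace E - U. \<alpha> g x \<notin> U)}"
  have "\<exists>U\<in>?\<U>. \<forall>V\<in>?\<U>. U \<subseteq> V \<longrightarrow> V = U"
  proof (rule subset_Zorn_nonempty)
    have "{} \<noteq> topspace E" using E(2) by metis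
    then have "{} \<in> ?\<U>" by simp
    then show "?\<U> \<noteq> {}" by blast
    fix \<C> assume C: "\<C> \<noteq> {}" "subset.chain ?\<U> \<C>"
    then have CU: "\<C> \<subseteq> ?\<U>" by (simp add: subset_chain_def)
    have "openin E (\<Union>\<C>)" using CU by (intro openin_Union) blast
    moreover have "\<Union>\<C> \<noteq> topspace E"
    proof
      assume eq: "\<Union>\<C> = topspace E"
      have "(\<forall>U\<in>\<C>. openin E U) \<and> topspace E \<subseteq> \<Union>\<C>" using CU eq by blast
      then have "\<exists>\<F>. finite \<F> \<and> \<F> \<subseteq> \<C> \<and> topspace E \<subseteq> \<Union>\<F>"
        by (rule E(1)[unfolded compact_space_alt, THEN spec, THEN mp])
      then obtain \<F> where F: "finite \<F>" "\<F> \<subseteq> \<C>" "topspace E \<subseteq> \<Union>\<F>"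
        by blast
      have "\<F> \<noteq> {}" using F(3) E(2) by auto
      moreover have "subset.chain ?\<U> \<F>" using C(2) F(2) unfolding subset_chain_def by (meson subset_eq)
      ultimately have "\<Union>\<F> \<in> \<F>" by (rule Union_in_chain[OF F(1)])
      then have "\<Union>\<F> \<in> ?\<U>" by (rule subsetD[OF subset_trans[OF F(2) CU]])
      note U = CollectD[OF this]
      have "\<Union>\<F> = topspace E"
        by (rule subset_antisym[OF openin_subset[OF conjunct1[OF U]] F(3)])
      with conjunct1[OF conjunct2[OF U]] show False by (rule notE)
    qed
    moreover have "\<forall>g\<in>A. \<forall>x\<in>topspace E - \<Union>\<C>. \<alpha> g x \<notin> \<Union>\<C>" using CU by blast
    ultimately show "\<Union>\<C> \<in> ?\<U>" by blast
  qed
  then obtain U where UU: "U \<in> ?\<U>" and mx: "\<forall>V\<in>?\<U>. U \<subseteq> V \<longrightarrow> V = U"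
    by (elim bexE)
  note U = conjunct1[OF CollectD[OF UU]] conjunct1[OF conjunct2[OF CollectD[OF UU]]]
    conjunct2[OF conjunct2[OF CollectD[OF UU]], rule_format]
  show ?thesis
  proof (rule that[of "topspace E - U"])
    show "closedin E (topspace E - U)" by (rule openin_closedin_eq[THEN iffD1, OF U(1), THEN conjunct2])
    show "topspace E - U \<noteq> {}" using U(2) openin_subset[OF U(1)] by auto
    show "\<alpha> g x \<in> topspace E - U" if "g \<in> A" "x \<in> topspace E - U" for g x
      using U(3)[OF that] inE[rule_format, of g x] that by simp
    fix K assume K: "closedin E K" "K \<noteq> {}" "K \<subseteq> topspace E - U" and inv: "\<And>g x. g \<in> A \<Longrightarrow> x \<in> K \<Longrightarrow> \<alpha> g x \<in> K"
    have sub: "K \<subseteq> topspace E" using K(1) by (rule closedin_subset)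
    have dd: "topspace E - (topspace E - K) = K" using sub by (rule double_diff) (rule subset_refl)
    have "topspace E - K = U"
    proof (rule mx[rule_format], intro CollectI conjI)
      show "openin E (topspace E - K)" using K(1) by (simp add: closedin_def)
      obtain k where "k \<in> K" using K(2) by (meson ex_in_conv)
      then show "topspace E - K \<noteq> topspace E" using sub by auto
      show "\<forall>g\<in>A. \<forall>x\<in>topspace E - (topspace E - K). \<alpha> g x \<notin> topspace E - K"
        unfolding dd using inv by simp
      show "U \<subseteq> topspace E - K" using K(3) openin_subset[OF U(1)] by auto
    qed
    then show "K = topspace E - U" using dd by simp
  qed
qed

text \<open>A subset of largest size of the finite class \<open>\<K>\<close> having a common fixed point \<open>z\<close> is all of
  \<open>\<K>\<close>: otherwise some \<open>C \<in> \<K>\<close> moves \<open>z\<close>, and making \<open>z\<close> and \<open>C z\<close> proximal while the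
  conjugation action on \<open>\<K>\<close> stays constant yields a common fixed point of a larger subset.\<close>

lemma finite_class_common_fixed_point:
  assumes E: "Hausdorff_space E" and act: "continuous_action G E \<alpha>" and prox: "proximal_action G E \<alpha>"
    and M: "closedin E M" "M \<noteq> {}" "\<And>g x. g \<in> carrier G \<Longrightarrow> x \<in> M \<Longrightarrow> \<alpha> g x \<in> M"
    and N: "N \<lhd> G" and ker: "\<And>g h x. g \<in> carrier G \<Longrightarrow> h \<in> carrier G \<Longrightarrow> N #>\<^bsub>G\<^esub> g = N #>\<^bsub>G\<^esub> h \<Longrightarrow> x \<in> M \<Longrightarrow>
      \<alpha> g x = \<alpha> h x"
    and K: "finite \<K>" "\<K> \<subseteq> carrier (G Mod N)" "\<And>C D. C \<in> carrier (G Mod N) \<Longrightarrow> D \<in> \<K> \<Longrightarrow>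
      C \<otimes>\<^bsub>G Mod N\<^esub> D \<otimes>\<^bsub>G Mod N\<^esub> inv\<^bsub>G Mod N\<^esub> C \<in> \<K>"
  shows "\<exists>z\<in>M. \<forall>g\<in>carrier G. N #>\<^bsub>G\<^esub> g \<in> \<K> \<longrightarrow> \<alpha> g z = z"
proof -
  interpret N: normal N G by (rule N)
  define Q where "Q = G Mod N"
  define \<phi> where "\<phi> = (\<lambda>g. N #>\<^bsub>G\<^esub> g)"
  interpret h: group_hom G Q \<phi> unfolding Q_def \<phi>_def by (rule N.group_hom_Mod)
  note af = action_facts[OF act]
  have ME: "x \<in> topspace E" if "x \<in> M" for x using closedin_subset[OF M(1)] that by blast
  have "\<exists>g\<in>carrier G. C = \<phi> g" if "C \<in> carrier Q" for C
    using that by (auto simp: Q_def \<phi>_def FactGroup_def RCOSETS_def)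
  \<comment> \<open>A class \<open>C\<close> acts on \<open>M\<close> through a representative
    \<open>s C\<close>; by \<open>ker\<close> the choice does not matter.\<close>
  then obtain s where s: "\<And>C. C \<in> carrier Q \<Longrightarrow> s C \<in> carrier G \<and> \<phi> (s C) = C" by metis
  have KQ: "C \<in> carrier Q" if "C \<in> \<K>" for C using K(2) that by (auto simp: Q_def)
  have sK: "s C \<in> carrier G" "\<phi> (s C) = C" if "C \<in> \<K>" for C using s[OF KQ[OF that]] by auto
  define cj where "cj g C = \<phi> g \<otimes>\<^bsub>Q\<^esub> C \<otimes>\<^bsub>Q\<^esub> inv\<^bsub>Q\<^esub> \<phi> g" for g C
  have cjK: "cj g C \<in> \<K>" if "g \<in> carrier G" "C \<in> \<K>" for g C
    using K(3)[of "\<phi> g" C] that h.hom_closed[of g] by (simp add: cj_def Q_def)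
  have cj_inj: "C = D" if "g \<in> carrier G" "C \<in> \<K>" "D \<in> \<K>" "cj g C = cj g D" for g C D
    using that KQ by (simp add: cj_def)
  have equiv: "\<alpha> g (\<alpha> (s C) x) = \<alpha> (s (cj g C)) (\<alpha> g x)" if g: "g \<in> carrier G" and C: "C \<in> \<K>" and x: "x \<in> M" for g C x
  proof -
    have sc: "s C \<in> carrier G" "s (cj g C) \<in> carrier G" using sK C cjK[OF g C] by auto
    have "\<alpha> (s (cj g C)) (\<alpha> g x) = \<alpha> (s (cj g C) \<otimes>\<^bsub>G\<^esub> g) x" using af(3) sc g ME[OF x] by simp
    also have "\<dots> = \<alpha> (g \<otimes>\<^bsub>G\<^esub> s C) x"
    proof (rule ker)
      have "\<phi> (s (cj g C) \<otimes>\<^bsub>G\<^esub> g) = \<phi> (g \<otimes>\<^bsub>G\<^esub> s C)"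
        using sc g sK(2)[OF C] sK(2)[OF cjK[OF g C]] KQ[OF C] by (simp add: cj_def h.H.word_simps)
      then show "N #>\<^bsub>G\<^esub> (s (cj g C) \<otimes>\<^bsub>G\<^esub> g) = N #>\<^bsub>G\<^esub> (g \<otimes>\<^bsub>G\<^esub> s C)" by (simp add: \<phi>_def)
    qed (use sc g x in simp_all)
    also have "\<dots> = \<alpha> g (\<alpha> (s C) x)" using af(3) sc g ME[OF x] by simp
    finally show ?thesis by simp
  qed
  define Fx where "Fx S = {z \<in> M. \<forall>C\<in>S. \<alpha> (s C) z = z}" for S
  have "\<exists>S. (S \<subseteq> \<K> \<and> Fx S \<noteq> {}) \<and> (\<forall>T. T \<subseteq> \<K> \<and> Fx T \<noteq> {} \<longrightarrow> card T \<le> card S)"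
  proof (rule ex_has_greatest_nat)
    show "{} \<subseteq> \<K> \<and> Fx {} \<noteq> {}" using M(2) by (auto simp: Fx_def)
    show "\<forall>T. T \<subseteq> \<K> \<and> Fx T \<noteq> {} \<longrightarrow> card T < Suc (card \<K>)"
      using card_mono[OF K(1)] by (simp add: less_Suc_eq_le)
  qed
  then obtain S where S: "S \<subseteq> \<K>" "Fx S \<noteq> {}" and max: "\<And>T. T \<subseteq> \<K> \<Longrightarrow> Fx T \<noteq> {} \<Longrightarrow> card T \<le> card S"
    by blast
  have "S = \<K>"
  proof (rule ccontr)
    assume "S \<noteq> \<K>"
    then obtain C where C: "C \<in> \<K>" "C \<notin> S" using S(1) by blast
    obtain z where z: "z \<in> M" "\<And>D. D \<in> S \<Longrightarrow> \<alpha> (s D) z = z" using S(2) by (auto simp: Fx_def)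
    have CzM: "\<alpha> (s C) z \<in> M" using M(3) sK C z(1) by simp
    obtain F w where F: "F \<noteq> bot" "\<forall>\<^sub>F g in F. g \<in> carrier G"
      and lim: "limitin E (\<lambda>g. \<alpha> g z) w F" "limitin E (\<lambda>g. \<alpha> g (\<alpha> (s C) z)) w F"
      using prox ME[OF z(1)] ME[OF CzM] unfolding proximal_action_def by blast
    define P where "P g = (\<lambda>D\<in>\<K>. cj g D)" for g
    \<comment> \<open>\<open>P\<close> eventually takes values in a finite set along
      \<open>F\<close>, so one value \<open>\<psi>\<close> occurs frequently, and \<open>F\<close>
      can be refined to where \<open>P\<close> is constant.\<close>
    have "\<exists>\<psi>\<in>\<K> \<rightarrow>\<^sub>E \<K>. \<exists>\<^sub>F g in F. P g = \<psi>"
    proof (rule ccontr)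
      assume "\<not> ?thesis"
      then have "\<forall>\<psi>\<in>\<K> \<rightarrow>\<^sub>E \<K>. \<forall>\<^sub>F g in F. P g \<noteq> \<psi>" by (auto simp: frequently_def)
      then have "\<forall>\<^sub>F g in F. \<forall>\<psi>\<in>\<K> \<rightarrow>\<^sub>E \<K>. P g \<noteq> \<psi>"
        by (intro eventually_ball_finite finite_PiE K(1))
      then have "\<forall>\<^sub>F g in F. False"
        using F(2)
      proof eventually_elim
        case (elim g)
        then have "P g \<in> \<K> \<rightarrow>\<^sub>E \<K>" using cjK by (auto simp: P_def)
        with elim show ?case by blast
      qed
      with F(1) show False by simp
    qed
    then obtain \<psi> where \<psi>: "\<exists>\<^sub>F g in F. P g = \<psi>" by blast
    define F' where "F' = inf F (principal {g. P g = \<psi>})"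
    have F'F: "F' \<le> F" by (simp add: F'_def)
    have F': "F' \<noteq> bot"
    proof
      assume "F' = bot"
      then have "\<forall>\<^sub>F g in F'. False" by simp
      then have "\<forall>\<^sub>F g in F. P g \<noteq> \<psi>" by (simp add: F'_def eventually_inf_principal)
      with \<psi> show False by (simp add: frequently_def)
    qed
    have "\<forall>\<^sub>F g in F'. P g = \<psi>" by (simp add: F'_def eventually_inf_principal)
    moreover have "\<forall>\<^sub>F g in F'. g \<in> carrier G" using F(2) F'F by (rule filter_leD[rotated])
    ultimately have ev: "\<forall>\<^sub>F g in F'. g \<in> carrier G \<and> P g = \<psi>" by eventually_elim simp
    have "\<exists>g. g \<in> carrier G \<and> P g = \<psi>" using eventually_happens[OF ev] F' by simp
    then obtain g0 where g0: "g0 \<in> carrier G" "P g0 = \<psi>" by (elim exE conjE)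
    have \<psi>D: "\<psi> D = cj g0 D" if "D \<in> \<K>" for D using g0(2) that by (auto simp: P_def)
    have \<psi>K: "\<psi> D \<in> \<K>" if "D \<in> \<K>" for D using \<psi>D[OF that] cjK[OF g0(1) that] by simp
    have wM: "w \<in> M"
    proof (rule limitin_mem_closedin[OF lim(1) M(1) _ F(1)])
      show "\<forall>\<^sub>F g in F. \<alpha> g z \<in> M" using F(2) by eventually_elim (rule M(3)[OF _ z(1)])
    qed
    \<comment> \<open>Along \<open>F'\<close> the points \<open>\<alpha> g z\<close> and
      \<open>\<alpha> g (\<alpha> (s D) z)\<close> both tend to \<open>w\<close>: for
      \<open>D \<in> S\<close> they coincide, for \<open>D = C\<close> this is the choice of
      \<open>F\<close>. By \<open>equiv\<close> the second is the image of the first under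
      \<open>\<psi> D\<close>, so \<open>\<psi> D\<close> fixes \<open>w\<close>.\<close>
    have fixw: "\<alpha> (s (\<psi> D)) w = w" if D: "D \<in> insert C S" for D
    proof -
      have DK: "D \<in> \<K>" using D C S by blast
      have "limitin E (\<lambda>g. \<alpha> g (\<alpha> (s D) z)) w F" using D lim z(2) by auto
      then have l1: "limitin E (\<lambda>g. \<alpha> g (\<alpha> (s D) z)) w F'" using F'F by (rule limitin_mono_filter)
      have "continuous_map E E (\<alpha> (s (\<psi> D)))" using af(5) sK(1)[OF \<psi>K[OF DK]] by blast
      from continuous_map_limit[OF this limitin_mono_filter[OF lim(1) F'F]]
      have l2: "limitin E (\<lambda>g. \<alpha> (s (\<psi> D)) (\<alpha> g z)) (\<alpha> (s (\<psi> D)) w) F'" by (simp add: comp_def)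
      have "\<forall>\<^sub>F g in F'. \<alpha> (s (\<psi> D)) (\<alpha> g z) = \<alpha> g (\<alpha> (s D) z)"
        using ev
      proof eventually_elim
        case (elim g)
        then have "\<psi> D = cj g D" using DK by (auto simp: P_def)
        then show ?case using equiv[OF _ DK z(1), of g] elim by simp
      qed
      then have l3: "limitin E (\<lambda>g. \<alpha> g (\<alpha> (s D) z)) (\<alpha> (s (\<psi> D)) w) F'"
        using l2 by (rule limitin_transform_eventually)
      show ?thesis by (rule limitin_unique_Hausdorff[OF l3 l1 F' E])
    qed
    have "w \<in> Fx (\<psi> ` insert C S)"
      unfolding Fx_def using wM fixw by (intro CollectI conjI ballI) auto
    then have ne: "Fx (\<psi> ` insert C S) \<noteq> {}" by (metis empty_iff)
    have "\<psi> ` insert C S \<subseteq> \<K>" using \<psi>K C(1) subsetD[OF S(1)] by auto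
    then have le: "card (\<psi> ` insert C S) \<le> card S" using ne by (rule max)
    have inj: "inj_on \<psi> (insert C S)"
    proof (rule inj_onI)
      fix D D' assume D: "D \<in> insert C S" "D' \<in> insert C S" "\<psi> D = \<psi> D'"
      then have "D \<in> \<K>" "D' \<in> \<K>" using C S by auto
      then show "D = D'" using cj_inj[OF g0(1)] \<psi>D D(3) by simp
    qed
    have "card (insert C S) \<le> card S" using le unfolding card_image[OF inj] .
    then show False using C finite_subset[OF S(1) K(1)] by simp
  qed
  then obtain z where z: "z \<in> M" "\<And>C. C \<in> \<K> \<Longrightarrow> \<alpha> (s C) z = z" using S(2) by (auto simp: Fx_def)
  have "\<alpha> g z = z" if g: "g \<in> carrier G" "N #>\<^bsub>G\<^esub> g \<in> \<K>" for g
  proof -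
    have "\<alpha> g z = \<alpha> (s (N #>\<^bsub>G\<^esub> g)) z"
      by (rule ker) (use g z sK[OF g(2)] in \<open>simp_all add: \<phi>_def\<close>)
    then show ?thesis using z(2)[OF g(2)] by simp
  qed
  then show ?thesis by (intro bexI[OF _ z(1)] ballI impI)
qed

theorem no_icc_quotient_imp_strongly_amenable_on:
  fixes G (structure)
  assumes no: "\<not> (\<exists>N. N \<lhd> G \<and> \<not> trivial_group (G Mod N) \<and> icc (G Mod N))"
  shows "strongly_amenable_on TYPE('x) G"
  unfolding strongly_amenable_on_def
proof (intro allI impI, elim conjE)
  fix E :: "'x topology" and \<alpha>
  assume E: "compact_space E" "Hausdorff_space E" "topspace E \<noteq> {}"
    and act: "continuous_action G E \<alpha>" and prox: "proximal_action G E \<alpha>"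
  note af = action_facts[OF act]
  interpret group G by (rule af(1))
  have inE: "\<forall>g\<in>carrier G. \<forall>x\<in>topspace E. \<alpha> g x \<in> topspace E" using af(2) by simp
  obtain M where M: "closedin E M" "M \<noteq> {}" "\<And>g x. g \<in> carrier G \<Longrightarrow> x \<in> M \<Longrightarrow> \<alpha> g x \<in> M"
    and min: "\<And>K. closedin E K \<Longrightarrow> K \<noteq> {} \<Longrightarrow> K \<subseteq> M \<Longrightarrow>
      (\<And>g x. g \<in> carrier G \<Longrightarrow> x \<in> K \<Longrightarrow> \<alpha> g x \<in> K) \<Longrightarrow> K = M"
    by (fact exists_minimal_invariant_closed[OF E(1,3) inE])
  have ME: "x \<in> topspace E" if "x \<in> M" for x using closedin_subset[OF M(1)] that by blast
  note mult = af(3)[OF _ _ ME] and one = af(4)[OF ME]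
  \<comment> \<open>The kernel of the action on \<open>M\<close>: the quotient by it acts faithfully
    on \<open>M\<close>, and it is to this quotient that the hypothesis is applied.\<close>
  define N where "N = {g \<in> carrier G. \<forall>x\<in>M. \<alpha> g x = x}"
  have invx: "\<alpha> (inv g) (\<alpha> g x) = x" "\<alpha> g (\<alpha> (inv g) x) = x" if "g \<in> carrier G" "x \<in> M" for g x
    using mult[of "inv g" g x] mult[of g "inv g" x] one[of x] that by simp_all
  have N: "N \<lhd> G"
    unfolding normal_inv_iff
  proof (intro conjI ballI subgroupI)
    show "N \<subseteq> carrier G" by (auto simp: N_def)
    have "\<one> \<in> N" using one by (simp add: N_def)
    then show "N \<noteq> {}" by blast
    show "inv a \<in> N" if a: "a \<in> N" for a
    proof -
      have ac: "a \<in> carrier G" "\<And>x. x \<in> M \<Longrightarrow> \<alpha> a x = x" using a by (auto simp: N_def)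
      have "\<alpha> (inv a) x = x" if "x \<in> M" for x using invx(1)[OF ac(1) that] ac(2)[OF that] by simp
      then show ?thesis using ac(1) by (simp add: N_def)
    qed
    show "a \<otimes> b \<in> N" if "a \<in> N" "b \<in> N" for a b
      using that mult by (simp add: N_def)
    show "g \<otimes> a \<otimes> inv g \<in> N" if g: "g \<in> carrier G" and a: "a \<in> N" for g a
    proof -
      have ac: "a \<in> carrier G" "\<And>x. x \<in> M \<Longrightarrow> \<alpha> a x = x" using a by (auto simp: N_def)
      have "\<alpha> (g \<otimes> a \<otimes> inv g) x = x" if x: "x \<in> M" for x
      proof -
        have ix: "\<alpha> (inv g) x \<in> M" using M(3) g x by simp
        have "\<alpha> (g \<otimes> a \<otimes> inv g) x = \<alpha> g (\<alpha> a (\<alpha> (inv g) x))"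
          using mult[of "g \<otimes> a" "inv g" x] mult[of g a "\<alpha> (inv g) x"] g ac(1) x ix by simp
        then show ?thesis using ac(2)[OF ix] invx(2)[OF g x] by simp
      qed
      then show ?thesis using g ac(1) by (simp add: N_def)
    qed
  qed
  interpret N: normal N G by (rule N)
  define Q where "Q = G Mod N"
  define \<phi> where "\<phi> = (\<lambda>g. N #> g)"
  interpret h: group_hom G Q \<phi> unfolding Q_def \<phi>_def by (rule N.group_hom_Mod)
  have ker: "\<alpha> g x = \<alpha> h x" if g: "g \<in> carrier G" "h \<in> carrier G" "N #> g = N #> h" "x \<in> M" for g h x
  proof -
    have "g \<in> N #> h" using rcos_self[OF g(1) N.subgroup_axioms] g(3) by simp
    then have "\<exists>n\<in>N. g = n \<otimes> h" by (simp only: r_coset_def UN_iff singleton_iff)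
    then obtain n where n: "n \<in> N" "g = n \<otimes> h" by (rule bexE) (rule that)
    have nN: "n \<in> carrier G \<and> (\<forall>x\<in>M. \<alpha> n x = x)" using n(1) unfolding N_def by (rule CollectD)
    have hx: "\<alpha> h x \<in> M" by (rule M(3)[OF g(2,4)])
    have "n \<in> carrier G" by (rule conjunct1[OF nN])
    moreover have "\<alpha> n (\<alpha> h x) = \<alpha> h x" by (rule bspec[OF conjunct2[OF nN] hx])
    ultimately show ?thesis unfolding n(2) using mult[of n h x] g(2,4) by simp
  qed
  have "N = carrier G"
  proof (rule ccontr)
    assume "N \<noteq> carrier G"
    moreover have "\<not> (\<not> trivial_group (G Mod N) \<and> icc (G Mod N))"
    proof
      assume "\<not> trivial_group (G Mod N) \<and> icc (G Mod N)"
      then have "\<exists>N. N \<lhd> G \<and> \<not> trivial_group (G Mod N) \<and> icc (G Mod N)"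
        by (intro exI[of _ N] conjI N) (rule conjunct1, assumption, rule conjunct2, assumption)
      with no show False by (rule notE)
    qed
    ultimately obtain x where x: "x \<in> carrier G" "x \<notin> N" "finite (conjugacy_class (G Mod N) (N #> x))"
      using N.exists_FC_element_mod by metis
    define \<K> where "\<K> = conjugacy_class Q (\<phi> x)"
    have \<phi>x: "\<phi> x \<in> carrier Q" using x by simp
    have K1: "finite \<K>" unfolding \<K>_def Q_def \<phi>_def by (rule x(3))
    have K2: "\<K> \<subseteq> carrier Q" using \<phi>x by (auto simp: \<K>_def conjugacy_class_def)
    have K3: "C \<otimes>\<^bsub>Q\<^esub> D \<otimes>\<^bsub>Q\<^esub> inv\<^bsub>Q\<^esub> C \<in> \<K>" if "C \<in> carrier Q" "D \<in> \<K>" for C D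
      using h.H.conjugacy_class_conj_closed[OF \<phi>x] that by (simp add: \<K>_def)
    have xK: "\<phi> x \<in> \<K>"
    proof -
      have "\<phi> x = \<one>\<^bsub>Q\<^esub> \<otimes>\<^bsub>Q\<^esub> \<phi> x \<otimes>\<^bsub>Q\<^esub> inv\<^bsub>Q\<^esub> \<one>\<^bsub>Q\<^esub>" using \<phi>x by simp
      then show ?thesis unfolding \<K>_def conjugacy_class_def using h.H.one_closed by blast
    qed
    define L where "L = {g \<in> carrier G. \<phi> g \<in> \<K>}"
    \<comment> \<open>Common fixed points in \<open>M\<close> of all elements whose coset belongs to
      the class: nonempty by \<open>finite_class_common_fixed_point\<close> and invariant because
      the class is, so all of \<open>M\<close> by minimality. Then \<open>x\<close> acts trivially
      on \<open>M\<close>, against \<open>x \<notin> N\<close>.\<close>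
    define Z where "Z = M \<inter> (\<Inter>g\<in>L. {z \<in> topspace E. \<alpha> g z = z})"
    have Z: "z \<in> Z \<longleftrightarrow> z \<in> M \<and> (\<forall>g\<in>L. \<alpha> g z = z)" for z using ME by (auto simp: Z_def)
    have "L \<noteq> {}" using x(1) xK by (auto simp: L_def)
    then have "closedin E Z"
      unfolding Z_def
      by (intro closedin_Int M(1) closedin_INT closedin_fixed_points[OF E(2)] af(5))
        (auto simp: L_def)
    moreover have "Z \<noteq> {}"
    proof -
      have "\<exists>z\<in>M. \<forall>g\<in>carrier G. N #> g \<in> \<K> \<longrightarrow> \<alpha> g z = z"
        by (rule finite_class_common_fixed_point[OF E(2) act prox M(1,2) _ N])
          (fact M(3), fact ker, fact K1, fact K2[unfolded Q_def], fact K3[unfolded Q_def])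
      then show ?thesis using Z by (auto simp: L_def \<phi>_def)
    qed
    moreover have "Z \<subseteq> M" by (auto simp: Z_def)
    moreover have "\<alpha> g z \<in> Z" if g: "g \<in> carrier G" and z: "z \<in> Z" for g z
    proof -
      have zM: "z \<in> M" using z Z by blast
      have "\<alpha> k (\<alpha> g z) = \<alpha> g z" if k: "k \<in> L" for k
      proof -
        have kc: "k \<in> carrier G" "\<phi> k \<in> \<K>" using k by (auto simp: L_def)
        have "inv\<^bsub>Q\<^esub> \<phi> g \<otimes>\<^bsub>Q\<^esub> \<phi> k \<otimes>\<^bsub>Q\<^esub> inv\<^bsub>Q\<^esub> (inv\<^bsub>Q\<^esub> \<phi> g) \<in> \<K>" using K3[of "inv\<^bsub>Q\<^esub> \<phi> g" "\<phi> k"] g kc by simp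
        then have "inv g \<otimes> k \<otimes> g \<in> L" using g kc by (simp add: L_def)
        then have e: "\<alpha> (inv g \<otimes> k \<otimes> g) z = z" using z Z by blast
        have "\<alpha> k (\<alpha> g z) = \<alpha> (k \<otimes> g) z" using mult kc g zM by simp
        also have "k \<otimes> g = g \<otimes> (inv g \<otimes> k \<otimes> g)" using kc g by (simp add: word_simps)
        also have "\<alpha> (g \<otimes> (inv g \<otimes> k \<otimes> g)) z = \<alpha> g (\<alpha> (inv g \<otimes> k \<otimes> g) z)" using mult kc g zM by simp
        finally show ?thesis using e by simp
      qed
      then show ?thesis using Z M(3)[OF g zM] by blast
    qed
    ultimately have ZM: "Z = M" by (rule min)
    have xL: "x \<in> L" using x(1) xK by (simp add: L_def)
    have "\<alpha> x z = z" if "z \<in> M" for z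
      using Z[of z, unfolded ZM] that xL by simp
    then have "x \<in> N" unfolding N_def by (intro CollectI conjI x(1) ballI)
    with x(2) show False by (rule notE)
  qed
  then have eq: "carrier G = {g \<in> carrier G. \<forall>x\<in>M. \<alpha> g x = x}" unfolding N_def by (rule sym)
  have triv: "\<alpha> g z = z" if "g \<in> carrier G" "z \<in> M" for g z
    by (rule bspec[OF conjunct2[OF CollectD[OF subsetD[OF equalityD1[OF eq] that(1)]]] that(2)])
  obtain p where p: "p \<in> M" using M(2) by (meson ex_in_conv)
  show "\<exists>x\<in>topspace E. \<forall>g\<in>carrier G. \<alpha> g x = x"
    using triv[OF _ p] by (intro bexI[OF _ ME[OF p]] ballI)
qed

section \<open>The two equivalences\<close>

lemma (in group) icc_infinite:
  assumes "icc G" "\<not> trivial_group G"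
  shows "infinite (carrier G)"
proof
  assume fin: "finite (carrier G)"
  obtain x where x: "x \<in> carrier G" "x \<noteq> \<one>"
    using assms(2) is_group one_closed unfolding trivial_group_def by auto
  have "conjugacy_class G x \<subseteq> carrier G" using x(1) by (auto simp: conjugacy_class_def)
  then have "finite (conjugacy_class G x)" using fin by (rule finite_subset)
  then show False using assms(1) x by (simp add: icc_def)
qed

text \<open>Elements of the quotient have type \<open>'a set\<close>, so the subshift built for it
  lives on \<open>'a set \<Rightarrow> bool\<close>; \<open>strongly_amenable_imp_on\<close> moves
  strong amenability of \<open>G\<close> to that type before it is passed to the quotient.\<close>

lemma (in group) strongly_amenable_imp_no_icc_quotient:
  assumes cnt: "countable (carrier G)" and sa: "strongly_amenable G"
  shows "\<not> (\<exists>N. N \<lhd> G \<and> \<not> trivial_group (G Mod N) \<and> icc (G Mod N))"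
proof
  assume "\<exists>N. N \<lhd> G \<and> \<not> trivial_group (G Mod N) \<and> icc (G Mod N)"
  then obtain N where N: "N \<lhd> G" "\<not> trivial_group (G Mod N)" "icc (G Mod N)" by blast
  interpret N: normal N G by (rule N(1))
  interpret Q: group "G Mod N" by (rule N.factorgroup_is_group)
  have "carrier (G Mod N) = (\<lambda>g. N #> g) ` carrier G" by (auto simp: FactGroup_def RCOSETS_def)
  then have "countable (carrier (G Mod N))" using cnt by simp
  then have "\<not> strongly_amenable_on TYPE('a set \<Rightarrow> bool) (G Mod N)"
    by (rule Q.icc_not_strongly_amenable_on[OF _ Q.icc_infinite[OF N(3,2)] N(3)])
  moreover have "strongly_amenable_on TYPE('a set \<Rightarrow> bool) (G Mod N)"
    by (rule strongly_amenable_on_quotient[OF N(1) strongly_amenable_imp_on[OF sa]])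
  ultimately show False by (rule notE)
qed

theorem theorem1:
  fixes G :: "('a, 'b) monoid_scheme"
  assumes "group G"
  shows "(countable (carrier G) \<longrightarrow>
            (strongly_amenable G \<longleftrightarrow>
             \<not> (\<exists>N. N \<lhd> G \<and> \<not> trivial_group (G Mod N) \<and> icc (G Mod N)))) \<and>
         (finitely_generated_group G \<longrightarrow>
            (strongly_amenable G \<longleftrightarrow> virtually_nilpotent G))"
proof -
  interpret group G by (rule assms)
  let ?no = "\<not> (\<exists>N. N \<lhd> G \<and> \<not> trivial_group (G Mod N) \<and> icc (G Mod N))"
  have 1: "strongly_amenable G \<longleftrightarrow> ?no" if "countable (carrier G)"
  proof
    show "?no" if "strongly_amenable G"
      by (rule strongly_amenable_imp_no_icc_quotient[OF \<open>countable (carrier G)\<close> that])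
    show "strongly_amenable G" if "?no"
      unfolding strongly_amenable_def by (rule no_icc_quotient_imp_strongly_amenable_on[OF that])
  qed
  have 2: "strongly_amenable G \<longleftrightarrow> virtually_nilpotent G" if fg: "finitely_generated_group G"
  proof -
    obtain S where S: "finite S" "S \<subseteq> carrier G" "generate G S = carrier G"
      using fg unfolding finitely_generated_group_def by blast
    have "countable (carrier G)"
      using countable_generate[OF countable_finite[OF S(1)] S(2)] unfolding S(3) .
    then have "strongly_amenable G \<longleftrightarrow> ?no" by (rule 1)
    also have "?no \<longleftrightarrow> virtually_nilpotent G"
    proof
      show "virtually_nilpotent G" if "?no"
        by (rule no_icc_quotient_imp_virtually_nilpotent[OF fg that])
      show "?no" if vn: "virtually_nilpotent G"
        using virtually_nilpotent_imp_no_icc_quotient[OF vn] by blast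
    qed
    finally show ?thesis .
  qed
  from 1 2 show ?thesis by blast
qed

end
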